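(* Let $\mathbb{F}$ be $\mathbb{R}$ or $\mathbb{C}$ and let $1\le n\le k$ be integers. The principal $\operatorname{GL}(n,\mathbb{F})$-bundle $\pi:\operatorname{St}(n,\mathbb{F}^k)\to \operatorname{Gr}_n(\mathbb{F}^k)$ is classified by a map $f:\operatorname{Gr}_n(\mathbb{F}^k)\to B\operatorname{GL}(n,\mathbb{F})$, and the map induced by $f$ on homotopy groups is an isomorphism in the stable range $k \gg n$, in the following sense: (1) for $\mathbb{F}=\mathbb{R}$, $f$ induces an isomorphism on $\pi_i$ for all $i\leq k-n-1$; (2) for $\mathbb{F}=\mathbb{C}$, $f$ induces an isomorphism on $\pi_i$ for all $i\leq 2(k-n)$.
   Context: $\operatorname{St}(n,\mathbb{F}^k)$ is the space of $n$-tuples $(v_1,\ldots,v_n)$ of linearly independent vectors of $\mathbb{F}^k$, with the subspace topology from $(\mathbb{F}^k)^n$. $\operatorname{Gr}_n(\mathbb{F}^k)$ is the set of $n$-dimensional linear subspaces of $\mathbb{F}^k$, with the topology induced by the metric $\delta(E,F)=\|P_E-P_F\|$ ($P_E$ the orthogonal projection onto $E$, $\|\cdot\|$ the operator norm). The bundle projection is $\pi(v_1,\ldots,v_n)=\operatorname{span}\{v_1,\ldots,v_n\}$, and $g=(g_{ij})\in\operatorname{GL}(n,\mathbb{F})$ acts on the right by $(v_1,\ldots,v_n)\cdot g=(\sum_j g_{j1}v_j,\ldots,\sum_j g_{jn}v_j)$. $B\operatorname{GL}(n,\mathbb{F})$ is the classifying space of the topological group $\operatorname{GL}(n,\mathbb{F})$,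 i.e. the base of a universal principal $\operatorname{GL}(n,\mathbb{F})$-bundle $E\operatorname{GL}(n,\mathbb{F})\to B\operatorname{GL}(n,\mathbb{F})$ with contractible total space; "classified by $f$" means that the bundle is isomorphic, as a principal bundle, to the pullback of the universal bundle along $f$. *)

theory Defs
  imports "HOL-Analysis.Analysis" "HOL-Algebra.Group"
begin

subsection \<open>Homotopy groups\<close>

text \<open>
  The cube \<open>I\<^sup>i\<close>, with coordinates indexed by \<open>0, \<dots>, i - 1\<close>. Points are the functions
  \<open>nat \<Rightarrow> real\<close> that are \<open>undefined\<close> outside \<open>{..<i}\<close>; in particular \<open>I\<^sup>0\<close> is a single point
  with empty boundary.
\<close>

definition cube :: "nat \<Rightarrow> (nat \<Rightarrow> real) topology" where
  "cube i = product_topology (\<lambda>_. top_of_set {0..1}) {..<i}"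

definition cube_boundary :: "nat \<Rightarrow> (nat \<Rightarrow> real) set" where
  "cube_boundary i = {t \<in> topspace (cube i). \<exists>j<i. t j = 0 \<or> t j = 1}"

definition sphere_maps :: "nat \<Rightarrow> 'a topology \<Rightarrow> 'a \<Rightarrow> ((nat \<Rightarrow> real) \<Rightarrow> 'a) set" where
  "sphere_maps i X x = {a. continuous_map (cube i) X a \<and> (\<forall>t\<in>cube_boundary i. a t = x)}"

definition sphere_homotopy ::
    "nat \<Rightarrow> 'a topology \<Rightarrow> 'a \<Rightarrow> (((nat \<Rightarrow> real) \<Rightarrow> 'a) \<times> ((nat \<Rightarrow> real) \<Rightarrow> 'a)) set" where
  "sphere_homotopy i X x =
     {(a, b). a \<in> sphere_maps i X x \<and> b \<in> sphere_maps i X x \<and>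
        homotopic_with (\<lambda>h. \<forall>t\<in>cube_boundary i. h t = x) (cube i) X a b}"

definition sphere_concat ::
    "((nat \<Rightarrow> real) \<Rightarrow> 'a) \<Rightarrow> ((nat \<Rightarrow> real) \<Rightarrow> 'a) \<Rightarrow> (nat \<Rightarrow> real) \<Rightarrow> 'a" where
  "sphere_concat a b =
     (\<lambda>t. if t 0 \<le> 1/2 then a (t(0 := 2 * t 0)) else b (t(0 := 2 * t 0 - 1)))"

text \<open>
  For \<open>i = 0\<close> the carrier is the set of path components of \<open>X\<close>, and only the carrier is meaningful.
\<close>

definition homotopy_group :: "nat \<Rightarrow> 'a topology \<Rightarrow> 'a \<Rightarrow> ((nat \<Rightarrow> real) \<Rightarrow> 'a) set monoid" where
  "homotopy_group i X x =
     \<lparr>carrier = sphere_maps i X x // sphere_homotopy i X x,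
      mult = (\<lambda>A B. \<Union>a\<in>A. \<Union>b\<in>B. sphere_homotopy i X x `` {sphere_concat a b}),
      one = sphere_homotopy i X x `` {\<lambda>_. x}\<rparr>"

definition homotopy_map ::
    "nat \<Rightarrow> 'b topology \<Rightarrow> ('a \<Rightarrow> 'b) \<Rightarrow> 'a \<Rightarrow>
     ((nat \<Rightarrow> real) \<Rightarrow> 'a) set \<Rightarrow> ((nat \<Rightarrow> real) \<Rightarrow> 'b) set" where
  "homotopy_map i Y f x A = (\<Union>a\<in>A. sphere_homotopy i Y (f x) `` {f \<circ> a})"

text \<open>
  An isomorphism at every base point: of groups for \<open>i \<ge> 1\<close>, of sets for \<open>i = 0\<close>.
\<close>

definition homotopy_iso :: "nat \<Rightarrow> 'a topology \<Rightarrow> 'b topology \<Rightarrow> ('a \<Rightarrow> 'b) \<Rightarrow> bool" where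
  "homotopy_iso i X Y f \<longleftrightarrow>
     (\<forall>x\<in>topspace X.
        if i = 0
        then bij_betw (homotopy_map i Y f x)
               (carrier (homotopy_group i X x)) (carrier (homotopy_group i Y (f x)))
        else homotopy_map i Y f x \<in> iso (homotopy_group i X x) (homotopy_group i Y (f x)))"


subsection \<open>Principal bundles\<close>

definition topological_group :: "('g, 'm) monoid_scheme \<Rightarrow> 'g topology \<Rightarrow> bool" where
  "topological_group G T \<longleftrightarrow>
     group G \<and> topspace T = carrier G \<and>
     continuous_map (prod_topology T T) T (\<lambda>(g, h). g \<otimes>\<^bsub>G\<^esub> h) \<and>
     continuous_map T T (\<lambda>g. inv\<^bsub>G\<^esub> g)"

record ('e, 'b, 'g) gbundle =
  total_space :: "'e topology"
  base_space :: "'b topology"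
  bundle_proj :: "'e \<Rightarrow> 'b"
  bundle_act :: "'e \<Rightarrow> 'g \<Rightarrow> 'e"

definition principal_bundle ::
    "('g, 'm) monoid_scheme \<Rightarrow> 'g topology \<Rightarrow> ('e, 'b, 'g) gbundle \<Rightarrow> bool" where
  "principal_bundle G T P \<longleftrightarrow>
     topological_group G T \<and>
     continuous_map (total_space P) (base_space P) (bundle_proj P) \<and>
     continuous_map (prod_topology (total_space P) T) (total_space P)
       (\<lambda>(e, g). bundle_act P e g) \<and>
     (\<forall>e\<in>topspace (total_space P).
        bundle_act P e \<one>\<^bsub>G\<^esub> = e \<and>
        (\<forall>g\<in>carrier G. bundle_proj P (bundle_act P e g) = bundle_proj P e \<and>
           (\<forall>h\<in>carrier G.
              bundle_act P e (g \<otimes>\<^bsub>G\<^esub> h) = bundle_act P (bundle_act P e g) h))) \<and>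
     (\<forall>b\<in>topspace (base_space P). \<exists>U \<phi>.
        openin (base_space P) U \<and> b \<in> U \<and>
        homeomorphic_map (prod_topology (subtopology (base_space P) U) T)
          (subtopology (total_space P) {e \<in> topspace (total_space P). bundle_proj P e \<in> U}) \<phi> \<and>
        (\<forall>u\<in>U. \<forall>g\<in>carrier G. bundle_proj P (\<phi> (u, g)) = u \<and>
           (\<forall>h\<in>carrier G. \<phi> (u, g \<otimes>\<^bsub>G\<^esub> h) = bundle_act P (\<phi> (u, g)) h)))"

text \<open>
  A universal bundle \<open>EG \<rightarrow> BG\<close>. Nonemptiness has to be required because the library counts the
  empty space as contractible.
\<close>

definition universal_principal_bundle ::
    "('g, 'm) monoid_scheme \<Rightarrow> 'g topology \<Rightarrow> ('e, 'b, 'g) gbundle \<Rightarrow> bool" where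
  "universal_principal_bundle G T P \<longleftrightarrow>
     principal_bundle G T P \<and>
     topspace (total_space P) \<noteq> {} \<and> contractible_space (total_space P)"

definition bundle_pullback ::
    "'a topology \<Rightarrow> ('a \<Rightarrow> 'b) \<Rightarrow> ('e, 'b, 'g) gbundle \<Rightarrow> ('a \<times> 'e, 'a, 'g) gbundle" where
  "bundle_pullback X f P =
     \<lparr>total_space = subtopology (prod_topology X (total_space P)) {(x, e). f x = bundle_proj P e},
      base_space = X,
      bundle_proj = fst,
      bundle_act = (\<lambda>(x, e) g. (x, bundle_act P e g))\<rparr>"

definition principal_bundle_isomorphic ::
    "('g, 'm) monoid_scheme \<Rightarrow> ('e, 'b, 'g) gbundle \<Rightarrow> ('d, 'b, 'g) gbundle \<Rightarrow> bool" where
  "principal_bundle_isomorphic G P Q \<longleftrightarrow>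
     base_space P = base_space Q \<and>
     (\<exists>\<phi>. homeomorphic_map (total_space P) (total_space Q) \<phi> \<and>
        (\<forall>e\<in>topspace (total_space P). bundle_proj Q (\<phi> e) = bundle_proj P e \<and>
           (\<forall>g\<in>carrier G. \<phi> (bundle_act P e g) = bundle_act Q (\<phi> e) g)))"

definition classified_by ::
    "('g, 'm) monoid_scheme \<Rightarrow> ('d, 'a, 'g) gbundle \<Rightarrow> ('e, 'b, 'g) gbundle \<Rightarrow> ('a \<Rightarrow> 'b) \<Rightarrow> bool"
  where
  "classified_by G P E f \<longleftrightarrow>
     continuous_map (base_space P) (base_space E) f \<and>
     principal_bundle_isomorphic G P (bundle_pullback (base_space P) f E)"


subsection \<open>The scalar fields\<close>

text \<open>
  A uniform treatment of \<open>\<real>\<close> and \<open>\<complex>\<close> with their conjugations. The axiom says that multiplication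
  by \<open>scalar_conj y\<close> is the adjoint of multiplication by \<open>y\<close>, so the conjugation is determined by the
  norm and the field structure.
\<close>

class scalar_field = real_normed_field + euclidean_space +
  fixes scalar_conj :: "'a \<Rightarrow> 'a"
  assumes inner_mult_scalar_conj: "inner x (a * y) = inner (x * scalar_conj y) a"

instantiation real :: scalar_field
begin
definition scalar_conj_real :: "real \<Rightarrow> real" where "scalar_conj_real x = x"
instance by standard (simp add: scalar_conj_real_def)
end

instantiation complex :: scalar_field
begin
definition scalar_conj_complex :: "complex \<Rightarrow> complex" where "scalar_conj_complex z = cnj z"
instance by standard (simp add: scalar_conj_complex_def inner_complex_def algebra_simps)
end

definition hermitian_product :: "'a::scalar_field ^ 'k \<Rightarrow> 'a ^ 'k \<Rightarrow> 'a" where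
  "hermitian_product x y = (\<Sum>i\<in>UNIV. x $ i * scalar_conj (y $ i))"


subsection \<open>The Grassmannian\<close>

definition grassmannian :: "nat \<Rightarrow> ('a::field ^ 'k) set set" where
  "grassmannian n = {S. vec.subspace S \<and> vec.dim S = n}"

text \<open>
  Orthogonal projection onto the span of \<open>S\<close>, which is \<open>S\<close> itself when \<open>S\<close> is a subspace. Taking the
  span makes the distance below nonnegative and symmetric on all sets, as \<^locale>\<open>Metric_space\<close>
  requires.
\<close>

definition orthogonal_projection :: "('a::scalar_field ^ 'k) set \<Rightarrow> 'a ^ 'k \<Rightarrow> 'a ^ 'k" where
  "orthogonal_projection S x =
     (THE y. y \<in> vec.span S \<and> (\<forall>z\<in>vec.span S. hermitian_product (x - y) z = 0))"

definition grassmannian_dist :: "('a::scalar_field ^ 'k) set \<Rightarrow> ('a ^ 'k) set \<Rightarrow> real" where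
  "grassmannian_dist E F = onorm (\<lambda>x. orthogonal_projection E x - orthogonal_projection F x)"

lemma inner_scale_hermitian_product:
  fixes x y :: "'a::scalar_field ^ 'k"
  shows "inner x (c *s y) = inner (hermitian_product x y) c"
  by (simp add: inner_vec_def hermitian_product_def inner_sum_left inner_mult_scalar_conj)

lemma hermitian_orthogonal_iff:
  fixes x :: "'a::scalar_field ^ 'k"
  shows "(\<forall>z\<in>vec.span S. hermitian_product x z = 0) \<longleftrightarrow> (\<forall>z\<in>vec.span S. inner x z = 0)"
proof safe
  fix z assume "\<forall>z\<in>vec.span S. hermitian_product x z = 0" "z \<in> vec.span S"
  then show "inner x z = 0"
    using inner_scale_hermitian_product [of x 1 z] by simp
next
  fix z assume "\<forall>z\<in>vec.span S. inner x z = 0" "z \<in> vec.span S"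
  then have "inner (hermitian_product x z) c = 0" for c
    using inner_scale_hermitian_product [of x c z] vec.span_scale by metis
  then show "hermitian_product x z = 0"
    using inner_eq_zero_iff by blast
qed

lemma subspace_vec_span: "subspace (vec.span (S :: ('a::scalar_field ^ 'k) set))"
proof (rule subspaceI)
  fix c and x :: "'a ^ 'k" assume "x \<in> vec.span S"
  moreover have "c *\<^sub>R x = of_real c *s x"
    by (vector scaleR_conv_of_real)
  ultimately show "c *\<^sub>R x \<in> vec.span S"
    by (simp add: vec.span_scale)
qed (auto intro: vec.span_zero vec.span_add)

lemma orthogonal_projection_unique:
  fixes x :: "'a::scalar_field ^ 'k"
  shows "\<exists>!y. y \<in> vec.span S \<and> (\<forall>z\<in>vec.span S. hermitian_product (x - y) z = 0)"
proof -
  obtain y z where "y \<in> span (vec.span S)" "\<And>w. w \<in> span (vec.span S) \<Longrightarrow> orthogonal z w" "x = y + z"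
    using orthogonal_subspace_decomp_exists [of "vec.span S" x] by blast
  then have y: "y \<in> vec.span S" "\<forall>w\<in>vec.span S. inner (x - y) w = 0"
    by (auto simp: span_eq_iff [THEN iffD2, OF subspace_vec_span] orthogonal_def)
  show ?thesis
    unfolding hermitian_orthogonal_iff
  proof (rule ex1I [of _ y])
    fix y' assume y': "y' \<in> vec.span S \<and> (\<forall>w\<in>vec.span S. inner (x - y') w = 0)"
    with y have "y' - y \<in> vec.span S"
      by (simp add: vec.span_diff)
    with y y' have "inner (x - y) (y' - y) - inner (x - y') (y' - y) = 0"
      by simp
    then show "y' = y"
      by (simp flip: inner_diff_left)
  qed (use y in simp)
qed

lemma orthogonal_projection:
  fixes x :: "'a::scalar_field ^ 'k"
  shows "orthogonal_projection S x \<in> vec.span S"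
    and "z \<in> vec.span S \<Longrightarrow> inner (x - orthogonal_projection S x) z = 0"
proof -
  have "orthogonal_projection S x \<in> vec.span S \<and>
      (\<forall>z\<in>vec.span S. hermitian_product (x - orthogonal_projection S x) z = 0)"
    unfolding orthogonal_projection_def by (rule theI' [OF orthogonal_projection_unique])
  then show "orthogonal_projection S x \<in> vec.span S"
    and "z \<in> vec.span S \<Longrightarrow> inner (x - orthogonal_projection S x) z = 0"
    unfolding hermitian_orthogonal_iff by blast+
qed

lemma orthogonal_projection_eqI:
  fixes x :: "'a::scalar_field ^ 'k"
  assumes "y \<in> vec.span S" "\<And>z. z \<in> vec.span S \<Longrightarrow> inner (x - y) z = 0"
  shows "orthogonal_projection S x = y"
  unfolding orthogonal_projection_def
proof (rule the1_equality [OF orthogonal_projection_unique])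
  show "y \<in> vec.span S \<and> (\<forall>z\<in>vec.span S. hermitian_product (x - y) z = 0)"
    unfolding hermitian_orthogonal_iff using assms by blast
qed

lemma bounded_linear_orthogonal_projection:
  "bounded_linear (orthogonal_projection (S :: ('a::scalar_field ^ 'k) set))"
proof -
  note P = orthogonal_projection [where S = S] and V = subspace_vec_span [of S]
  have "linear (orthogonal_projection S)"
  proof (rule linearI)
    fix x y
    have "inner (x + y - (orthogonal_projection S x + orthogonal_projection S y)) z = 0"
      if "z \<in> vec.span S" for z
      using P(2) [OF that, of x] P(2) [OF that, of y] by (simp add: inner_diff_left inner_add_left)
    then show "orthogonal_projection S (x + y) = orthogonal_projection S x + orthogonal_projection S y"
      by (intro orthogonal_projection_eqI vec.span_add P(1))
  next
    fix c x
    have "inner (c *\<^sub>R x - c *\<^sub>R orthogonal_projection S x) z = 0" if "z \<in> vec.span S" for z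
      using P(2) [OF that, of x] by (simp flip: scaleR_diff_right)
    then show "orthogonal_projection S (c *\<^sub>R x) = c *\<^sub>R orthogonal_projection S x"
      by (intro orthogonal_projection_eqI subspace_scale [OF V] P(1))
  qed
  then show ?thesis
    by (simp add: linear_conv_bounded_linear)
qed

lemma orthogonal_projection_image: "range (orthogonal_projection S) = vec.span S"
  for S :: "('a::scalar_field ^ 'k) set"
proof
  show "vec.span S \<subseteq> range (orthogonal_projection S)"
    by (metis orthogonal_projection_eqI diff_self inner_zero_left rangeI subsetI)
qed (use orthogonal_projection in auto)

lemma Metric_space_grassmannian:
  "Metric_space (grassmannian n :: ('a::scalar_field ^ 'k) set set) grassmannian_dist"
proof
  note bl = bounded_linear_sub [OF bounded_linear_orthogonal_projection bounded_linear_orthogonal_projection]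
  fix E F G :: "('a ^ 'k) set"
  show "0 \<le> grassmannian_dist E F"
    unfolding grassmannian_dist_def by (rule onorm_pos_le [OF bl])
  show "grassmannian_dist E F = grassmannian_dist F E"
    unfolding grassmannian_dist_def by (subst onorm_neg [symmetric]) simp
  show "grassmannian_dist E G \<le> grassmannian_dist E F + grassmannian_dist F G"
    using onorm_triangle [OF bl [of E F] bl [of F G]] by (simp add: grassmannian_dist_def)
  assume "E \<in> grassmannian n" "F \<in> grassmannian n"
  then have "vec.span E = E" "vec.span F = F"
    by (auto simp: grassmannian_def)
  have "orthogonal_projection E = orthogonal_projection F \<longleftrightarrow> E = F"
    by (metis orthogonal_projection_image \<open>vec.span E = E\<close> \<open>vec.span F = F\<close>)
  then show "grassmannian_dist E F = 0 \<longleftrightarrow> E = F"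
    by (simp add: grassmannian_dist_def onorm_eq_0 [OF bl] fun_eq_iff)
qed

definition grassmannian_topology :: "nat \<Rightarrow> ('a::scalar_field ^ 'k) set topology" where
  "grassmannian_topology n = Metric_space.mtopology (grassmannian n) grassmannian_dist"


subsection \<open>The Stiefel bundle\<close>

definition GL :: "('a::field ^ 'n ^ 'n) monoid" where
  "GL = \<lparr>carrier = {g. invertible g}, mult = (**), one = mat 1\<rparr>"

definition GL_topology :: "('a::scalar_field ^ 'n ^ 'n) topology" where
  "GL_topology = top_of_set (carrier GL)"

text \<open>
  An \<open>n\<close>-tuple of vectors of \<open>\<bbbF>\<^sup>k\<close> is an element of \<open>(\<bbbF>\<^sup>k)\<^sup>n\<close>, of type \<^typ>\<open>'a ^ 'k ^ 'n\<close>.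
\<close>

definition stiefel :: "('a::field ^ 'k ^ 'n) set" where
  "stiefel = {v. \<forall>c :: 'n \<Rightarrow> 'a. (\<Sum>j\<in>UNIV. c j *s v $ j) = 0 \<longrightarrow> (\<forall>j. c j = 0)}"

definition stiefel_bundle :: "('a::scalar_field ^ 'k ^ 'n, ('a ^ 'k) set, 'a ^ 'n ^ 'n) gbundle" where
  "stiefel_bundle =
     \<lparr>total_space = top_of_set stiefel,
      base_space = grassmannian_topology CARD('n),
      bundle_proj = (\<lambda>v. vec.span (range (($) v))),
      bundle_act = (\<lambda>v g. \<chi> i. \<Sum>j\<in>UNIV. g $ j $ i *s v $ j)\<rparr>"

end

theory Submission
  imports Defs
begin

text \<open>
  A classifying map \<open>f\<close> comes with a homeomorphism of the Stiefel space \<open>St\<close> with the pullback of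
  \<open>E \<rightarrow> B\<close>. A map \<open>I\<^sup>m \<rightarrow> B\<close> lifts to \<open>E\<close>, because a principal bundle over a cube is trivial. If the
  map on the boundary factors through \<open>f\<close>, then the lift there defines a map into the pullback \<open>St\<close>;
  extending it over the cube and projecting to the Grassmannian gives surjectivity on homotopy groups
  (where \<open>E\<close> contractible makes the two lifts homotopic) and, one dimension higher, injectivity.

  Maps \<open>\<partial>I\<^sup>m \<rightarrow> St\<close> extend to \<open>I\<^sup>m\<close> for \<open>m < d (k - n + 1)\<close>, where \<open>d = dim\<^sub>\<real> \<bbbF>\<close>, by general position: the tuples
  that are linearly dependent form a set of real codimension \<open>d (k - n + 1)\<close>.

  A classifying map is the same as an equivariant map \<open>St \<rightarrow> E\<close>. The sets on which a given minor does not
  vanish are trivial bundles that cover \<open>St\<close>, and an equivariant map is extended from one of them to the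
  next by the contraction of \<open>E\<close>.
\<close>

section \<open>Cubes\<close>

text \<open>Both ranges are one inequality. Filling in the Stiefel space is used for cubes of
  dimension i (surjectivity) and i + 1 (injectivity), so the condition is i + 1 < d (k - n + 1); it
  reads i \<le> k - n - 1 for d = 1 and i \<le> 2 (k - n) for d = 2.

  A classifying map is known only through the isomorphism of bundles, so a map into the Stiefel
  space is handled as a compatible pair of maps into the Grassmannian and into E. The second
  component is what the contractibility of E can act on.

  Two obstacles shape the rest. An equivariant map given on an open set need not extend continuously
  to its frontier; it is therefore given up on a margin, by passing from a threshold c / 2 to c, and
  finitely many minors make finitely many such losses, so a positive c survives. General position
  needs differentiability, since continuous maps need not preserve null sets; this is why the
  extended map is replaced by a polynomial one, and why openness of the set of frames is used to
  restore the boundary values.\<close>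

lemma topspace_cube: "topspace (cube m) = {..<m} \<rightarrow>\<^sub>E {0..1}"
  by (simp add: cube_def)

lemma cube_boundary_subset: "cube_boundary m \<subseteq> topspace (cube m)"
  by (auto simp: cube_boundary_def)

lemma continuous_map_cube_component:
  assumes "j < m" "continuous_map X (cube m) f"
  shows "continuous_map X euclideanreal (\<lambda>x. f x j)"
  using assms unfolding cube_def continuous_map_componentwise
  by (auto simp: continuous_map_in_subtopology)

lemma continuous_map_cube_coordinate:
  assumes "j < m"
  shows "continuous_map (subtopology (cube m) S) euclideanreal (\<lambda>t. t j)"
  using assms by (intro continuous_map_cube_component [where m = m])
    (simp_all add: continuous_map_from_subtopology)

lemma continuous_map_into_cube:
  assumes "\<And>x. x \<in> topspace X \<Longrightarrow> f x \<in> topspace (cube m)"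
    and "\<And>j. j < m \<Longrightarrow> continuous_map X euclideanreal (\<lambda>x. f x j)"
  shows "continuous_map X (cube m) f"
  using assms unfolding cube_def continuous_map_componentwise
  by (auto simp: continuous_map_in_subtopology PiE_iff image_subset_iff)

text \<open>Twice the distance from the centre (1/2, ..., 1/2) in the maximum norm, so the boundary
  of the cube is the level set 1. For m = 0 it is constantly 0, in accordance with the empty
  boundary of the point.\<close>

primrec cube_norm :: "nat \<Rightarrow> (nat \<Rightarrow> real) \<Rightarrow> real" where
  "cube_norm 0 t = 0"
| "cube_norm (Suc m) t = max (cube_norm m t) \<bar>2 * t m - 1\<bar>"

lemma cube_norm_le_iff: "cube_norm m t \<le> r \<longleftrightarrow> 0 \<le> r \<and> (\<forall>j<m. \<bar>2 * t j - 1\<bar> \<le> r)"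
  by (induction m) (auto simp: less_Suc_eq)

lemma cube_norm_attained: "cube_norm m t = 0 \<or> (\<exists>j<m. cube_norm m t = \<bar>2 * t j - 1\<bar>)"
  by (induction m) (auto simp: less_Suc_eq max_def)

lemma continuous_map_cube_norm:
  assumes "k \<le> m"
  shows "continuous_map (subtopology (cube m) S) euclideanreal (cube_norm k)"
  using assms
proof (induction k)
  case (Suc k)
  then show ?case
    by (simp add: continuous_map_real_max continuous_map_real_abs continuous_map_diff
        continuous_map_real_mult_left continuous_map_cube_coordinate)
qed (simp add: cube_norm.simps(1) [abs_def])

lemma cube_norm_le_1: "t \<in> topspace (cube m) \<Longrightarrow> cube_norm m t \<le> 1"
  unfolding cube_norm_le_iff topspace_cube by (fastforce simp: PiE_iff Pi_iff abs_le_iff)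

lemma cube_boundary_iff:
  assumes "t \<in> topspace (cube m)"
  shows "t \<in> cube_boundary m \<longleftrightarrow> cube_norm m t = 1"
proof
  assume "t \<in> cube_boundary m"
  then obtain j where j: "j < m" "\<bar>2 * t j - 1\<bar> = 1"
    by (force simp: cube_boundary_def)
  then have "1 \<le> cube_norm m t"
    using cube_norm_le_iff by (metis order_refl)
  with cube_norm_le_1 [OF assms] show "cube_norm m t = 1"
    by simp
next
  assume "cube_norm m t = 1"
  then obtain j where "j < m" "\<bar>2 * t j - 1\<bar> = 1"
    using cube_norm_attained [of m t] by force
  with assms show "t \<in> cube_boundary m"
    by (auto simp: cube_boundary_def abs_if split: if_splits)
qed

text \<open>For m > 0 this says that every map of the sphere of dimension m - 1 to X is
  null-homotopic. For m = 0 the boundary is empty and it says that X is nonempty.\<close>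

definition cube_fillable :: "nat \<Rightarrow> 'a topology \<Rightarrow> bool" where
  "cube_fillable m X \<longleftrightarrow>
     (\<forall>a. continuous_map (subtopology (cube m) (cube_boundary m)) X a \<longrightarrow>
       (\<exists>b. continuous_map (cube m) X b \<and> (\<forall>t\<in>cube_boundary m. b t = a t)))"

lemma contractible_spaceE:
  assumes "contractible_space X" "topspace X \<noteq> {}"
  obtains H c where "continuous_map (prod_topology (top_of_set {0..1::real}) X) X H"
    and "c \<in> topspace X" and "\<And>x. H (0, x) = x" and "\<And>x. H (1, x) = c"
proof -
  obtain c H where H: "continuous_map (prod_topology (top_of_set {0..1::real}) X) X H"
      "\<And>x. H (0::real, x) = x" "\<And>x. H (1, x) = c"
    using assms(1) unfolding contractible_space_def homotopic_with_def by auto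
  obtain x where "x \<in> topspace X"
    using assms(2) by blast
  then have "H (1, x) \<in> topspace X"
    using continuous_map_image_subset_topspace [OF H(1)] by (auto simp: image_subset_iff)
  then have "c \<in> topspace X"
    by (simp add: H)
  then show thesis
    by (rule that [OF H(1) _ H(2,3)])
qed

text \<open>The cube is a cone over its boundary: the contraction of X is run along the rays from
  the centre, with the end value c on the inner half and the given map on the boundary.\<close>

lemma cube_fillable_contractible:
  assumes "contractible_space X" "topspace X \<noteq> {}"
  shows "cube_fillable m X"
  unfolding cube_fillable_def
proof (intro allI impI)
  fix a assume a: "continuous_map (subtopology (cube m) (cube_boundary m)) X a"
  obtain H c where H: "continuous_map (prod_topology (top_of_set {0..1::real}) X) X H"
    and c: "c \<in> topspace X" and H0: "\<And>x. H (0::real, x) = x" and H1: "\<And>x. H (1, x) = c"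
    using contractible_spaceE [OF assms] by metis
  \<comment> \<open>Radial projection from the centre to the boundary, used only where
    \<open>cube_norm m t\<close> is at least 1/2. In \<open>b\<close> the time
    \<open>2 - 2 * cube_norm m t\<close> is 1 at norm 1/2, where H takes the value c, and 0 on the
    boundary, where H is the identity.\<close>
  define \<rho> where "\<rho> t = (\<lambda>j\<in>{..<m}. 1/2 + (t j - 1/2) / cube_norm m t)" for t
  define b where "b t = (if cube_norm m t \<le> 1/2 then c else H (2 - 2 * cube_norm m t, a (\<rho> t)))" for t
  let ?S = "{t \<in> topspace (cube m). 1/2 \<le> cube_norm m t}"
  have \<rho>: "\<rho> t \<in> cube_boundary m" if t: "t \<in> ?S" for t
  proof -
    have r: "cube_norm m t > 0" using t by auto
    have le: "\<bar>2 * t j - 1\<bar> \<le> cube_norm m t" if "j < m" for j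
      using cube_norm_le_iff [of m t "cube_norm m t"] that by auto
    have eq: "2 * \<rho> t j - 1 = (2 * t j - 1) / cube_norm m t" if "j < m" for j
      using that r by (simp add: \<rho>_def field_simps)
    have "\<bar>2 * \<rho> t j - 1\<bar> \<le> 1" if "j < m" for j
      using le [OF that] r by (simp add: eq that abs_divide)
    then have "0 \<le> \<rho> t j \<and> \<rho> t j \<le> 1" if "j < m" for j
      using that by (fastforce simp: abs_le_iff)
    then have "\<rho> t \<in> topspace (cube m)"
      unfolding topspace_cube by (auto simp: PiE_iff \<rho>_def [of t])
    moreover obtain j where "j < m" "cube_norm m t = \<bar>2 * t j - 1\<bar>"
      using cube_norm_attained [of m t] r by force
    then have "\<bar>2 * \<rho> t j - 1\<bar> = 1"
      using r by (simp add: eq abs_divide)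
    ultimately show ?thesis
      using \<open>j < m\<close> by (auto simp: cube_boundary_def abs_if split: if_splits)
  qed
  have c\<rho>: "continuous_map (subtopology (cube m) ?S) (subtopology (cube m) (cube_boundary m)) \<rho>"
  proof (intro continuous_map_into_subtopology continuous_map_into_cube)
    fix j assume "j < m"
    then show "continuous_map (subtopology (cube m) ?S) euclideanreal (\<lambda>t. \<rho> t j)"
      unfolding \<rho>_def
      by (auto intro!: continuous_map_add continuous_map_diff continuous_map_real_divide
          continuous_map_cube_coordinate continuous_map_cube_norm)
  qed (use \<rho> cube_boundary_subset in \<open>auto simp: image_subset_iff\<close>)
  have "continuous_map (cube m) X b"
    unfolding b_def
  proof (rule continuous_map_cases_le)
    show "continuous_map (cube m) euclideanreal (cube_norm m)"
      using continuous_map_cube_norm [of m m UNIV] by simp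
    have "continuous_map (subtopology (cube m) ?S) (top_of_set {0..1}) (\<lambda>t. 2 - 2 * cube_norm m t)"
      by (intro continuous_map_into_subtopology continuous_map_diff continuous_map_real_mult_left
          continuous_map_cube_norm) (auto dest: cube_norm_le_1)
    then have "continuous_map (subtopology (cube m) ?S) X (H \<circ> (\<lambda>t. (2 - 2 * cube_norm m t, (a \<circ> \<rho>) t)))"
      by (intro continuous_map_compose [OF _ H] continuous_map_pairedI continuous_map_compose [OF c\<rho> a])
    then show "continuous_map (subtopology (cube m) ?S) X (\<lambda>t. H (2 - 2 * cube_norm m t, a (\<rho> t)))"
      by (simp add: o_def)
    fix t assume "cube_norm m t = 1/2"
    then have "2 - 2 * cube_norm m t = 1"
      by simp
    then show "c = H (2 - 2 * cube_norm m t, a (\<rho> t))"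
      by (simp only: H1)
  qed (use c in auto)
  moreover have "b t = a t" if t: "t \<in> cube_boundary m" for t
  proof -
    have "t \<in> topspace (cube m)" "cube_norm m t = 1"
      using t cube_boundary_subset cube_boundary_iff by blast+
    moreover from this have "\<rho> t = t"
      unfolding \<rho>_def topspace_cube by (auto simp: PiE_iff extensional_def)
    ultimately show ?thesis
      by (simp add: b_def H0)
  qed
  ultimately show "\<exists>b. continuous_map (cube m) X b \<and> (\<forall>t\<in>cube_boundary m. b t = a t)"
    by blast
qed

section \<open>Homotopy groups\<close>

lemma cube_update:
  assumes "t \<in> topspace (cube i)" "s \<in> {0..1}"
  shows "t(i := s) \<in> topspace (cube (Suc i))"
  using assms by (auto simp: topspace_cube PiE_iff extensional_def)

lemma cube_restrict:
  assumes "t \<in> topspace (cube (Suc i))"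
  shows "restrict t {..<i} \<in> topspace (cube i)" "t i \<in> {0..1}" "(restrict t {..<i})(i := t i) = t"
  using assms by (fastforce simp: topspace_cube PiE_iff extensional_def)+

lemma cube_boundary_restrict:
  assumes "t \<in> topspace (cube (Suc i))"
  shows "t \<in> cube_boundary (Suc i) \<longleftrightarrow> t i = 0 \<or> t i = 1 \<or> restrict t {..<i} \<in> cube_boundary i"
  using assms cube_restrict(1) [OF assms] by (auto simp: cube_boundary_def less_Suc_eq)

lemma cube_boundary_update:
  assumes "t \<in> topspace (cube i)" "s \<in> {0..1}"
  shows "t(i := s) \<in> cube_boundary (Suc i) \<longleftrightarrow> s = 0 \<or> s = 1 \<or> t \<in> cube_boundary i"
proof -
  have "restrict (t(i := s)) {..<i} = t"
    using assms(1) by (auto simp: topspace_cube PiE_iff extensional_def)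
  then show ?thesis
    using cube_boundary_restrict [OF cube_update [OF assms]] by simp
qed

lemma continuous_map_cube_restrict:
  "continuous_map (cube (Suc i)) (prod_topology (top_of_set {0..1}) (cube i)) (\<lambda>t. (t i, restrict t {..<i}))"
proof (intro continuous_map_pairedI)
  show "continuous_map (cube (Suc i)) (top_of_set {0..1}) (\<lambda>t. t i)"
    using continuous_map_cube_coordinate [of i "Suc i" UNIV] cube_restrict(2)
    by (auto simp: continuous_map_in_subtopology image_subset_iff)
  show "continuous_map (cube (Suc i)) (cube i) (\<lambda>t. restrict t {..<i})"
    using continuous_map_cube_coordinate [of _ "Suc i" UNIV] cube_restrict(1)
    by (intro continuous_map_into_cube) auto
qed

lemma continuous_map_cube_update:
  "continuous_map (prod_topology (top_of_set {0..1}) (cube i)) (cube (Suc i)) (\<lambda>(s, t). t(i := s))"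
proof (rule continuous_map_into_cube)
  fix x assume "x \<in> topspace (prod_topology (top_of_set {0..1::real}) (cube i))"
  then show "(case x of (s, t) \<Rightarrow> t(i := s)) \<in> topspace (cube (Suc i))"
    using cube_update by auto
next
  fix j assume j: "j < Suc i"
  show "continuous_map (prod_topology (top_of_set {0..1::real}) (cube i)) euclideanreal
          (\<lambda>x. (case x of (s, t) \<Rightarrow> t(i := s)) j)"
  proof (cases "j = i")
    case True
    have "continuous_map (prod_topology (top_of_set {0..1::real}) (cube i)) euclideanreal fst"
      using continuous_map_fst continuous_map_in_subtopology by blast
    moreover have "(\<lambda>x. (case x of (s :: real, t) \<Rightarrow> t(i := s)) j) = fst"
      using True by auto
    ultimately show ?thesis
      by simp
  next
    case False
    with j have "continuous_map (prod_topology (top_of_set {0..1::real}) (cube i)) euclideanreal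
          (\<lambda>x. snd x j)"
      by (intro continuous_map_cube_component [where m = i] continuous_map_snd) auto
    then show ?thesis
      using False by (simp add: case_prod_unfold)
  qed
qed

text \<open>Time becomes the last coordinate i of \<open>cube (Suc i)\<close>, so that lifting and
  filling over cubes apply to homotopies as well. For i > 0 it is a different coordinate from 0, in
  which maps are concatenated.\<close>

lemma sphere_homotopy_iff:
  "(a, b) \<in> sphere_homotopy i X x \<longleftrightarrow>
     a \<in> sphere_maps i X x \<and> b \<in> sphere_maps i X x \<and>
     (\<exists>h. continuous_map (cube (Suc i)) X h \<and>
        (\<forall>t\<in>topspace (cube i). h (t(i := 0)) = a t \<and> h (t(i := 1)) = b t) \<and>
        (\<forall>t\<in>cube_boundary i. \<forall>s\<in>{0..1}. h (t(i := s)) = x))"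
  (is "_ \<longleftrightarrow> ?a \<and> ?b \<and> (\<exists>h. ?P h)")
proof -
  let ?H = "\<lambda>h. continuous_map (prod_topology (top_of_set {0..1}) (cube i)) X h \<and>
       (\<forall>t\<in>topspace (cube i). h (0, t) = a t) \<and> (\<forall>t\<in>topspace (cube i). h (1, t) = b t) \<and>
       (\<forall>s\<in>{0..1::real}. \<forall>t\<in>cube_boundary i. h (s, t) = x)"
  have *: "homotopic_with (\<lambda>h. \<forall>t\<in>cube_boundary i. h t = x) (cube i) X a b \<longleftrightarrow> (\<exists>h. ?H h)"
    using cube_boundary_subset by (subst homotopic_with) (auto simp: subset_iff)
  have "?P (h \<circ> (\<lambda>t. (t i, restrict t {..<i})))" if "?H h" for h
  proof -
    have "restrict (t(i := s)) {..<i} = t" if "t \<in> topspace (cube i)" for t s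
      using that by (auto simp: topspace_cube PiE_iff extensional_def)
    with that show ?thesis
      using cube_boundary_subset [of i] continuous_map_compose [OF continuous_map_cube_restrict, of i X h]
      by (auto simp: subset_iff)
  qed
  moreover have "?H (h \<circ> (\<lambda>(s, t). t(i := s)))" if "?P h" for h
    using that continuous_map_compose [OF continuous_map_cube_update, of i X h] by auto
  ultimately have "(\<exists>h. ?H h) \<longleftrightarrow> (\<exists>h. ?P h)"
    by iprover
  with * show ?thesis
    by (simp add: sphere_homotopy_def)
qed

lemma equiv_sphere_homotopy: "equiv (sphere_maps i X x) (sphere_homotopy i X x)"
proof (rule equivI)
  show "sphere_homotopy i X x \<subseteq> sphere_maps i X x \<times> sphere_maps i X x"
    by (auto simp: sphere_homotopy_def)
  show "refl_on (sphere_maps i X x) (sphere_homotopy i X x)"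
    by (auto simp: refl_on_def sphere_homotopy_def sphere_maps_def)
  show "sym (sphere_homotopy i X x)"
    by (auto simp: sym_def sphere_homotopy_def homotopic_with_symD)
  show "trans (sphere_homotopy i X x)"
    unfolding trans_def sphere_homotopy_def using homotopic_with_trans by blast
qed

lemma sphere_maps_compose:
  assumes "continuous_map X Y f" "a \<in> sphere_maps i X x"
  shows "f \<circ> a \<in> sphere_maps i Y (f x)"
  using assms continuous_map_compose [of _ X a Y f] by (simp add: sphere_maps_def)

lemma sphere_homotopy_compose:
  assumes "continuous_map X Y f" "(a, b) \<in> sphere_homotopy i X x"
  shows "(f \<circ> a, f \<circ> b) \<in> sphere_homotopy i Y (f x)"
proof -
  have "homotopic_with (\<lambda>h. \<forall>t\<in>cube_boundary i. h t = f x) (cube i) Y (f \<circ> a) (f \<circ> b)"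
    by (rule homotopic_with_compose_continuous_map_left [OF _ assms(1)])
      (use assms(2) in \<open>auto simp: sphere_homotopy_def intro: homotopic_with_mono\<close>)
  then show ?thesis
    using assms(2) sphere_maps_compose [OF assms(1)] by (simp add: sphere_homotopy_def)
qed

text \<open>\<open>homotopy_map\<close> is a union over all representatives; they contribute the
  same class, so the union is the class of any one of them.\<close>

lemma homotopy_map_class:
  assumes "continuous_map X Y f" "a \<in> sphere_maps i X x"
  shows "homotopy_map i Y f x (sphere_homotopy i X x `` {a}) = sphere_homotopy i Y (f x) `` {f \<circ> a}"
proof -
  note eX = equiv_sphere_homotopy [of i X x] and eY = equiv_sphere_homotopy [of i Y "f x"]
  have "sphere_homotopy i Y (f x) `` {f \<circ> b} = sphere_homotopy i Y (f x) `` {f \<circ> a}"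
    if "(a, b) \<in> sphere_homotopy i X x" for b
    using equiv_class_eq [OF eY sphere_homotopy_compose [OF assms(1) that]] by simp
  then show ?thesis
    unfolding homotopy_map_def by (intro UN_constant_eq [OF equiv_class_self [OF eX assms(2)]]) blast
qed

text \<open>Only the face t 0 = 1 of a and the face t 0 = 0 of b have to match. No base point is
  fixed, so the lemma serves both for maps of spheres and for homotopies between them.\<close>

lemma continuous_map_sphere_concat:
  assumes m: "0 < m" and a: "continuous_map (cube m) X a" and b: "continuous_map (cube m) X b"
    and ab: "\<And>t. t \<in> topspace (cube m) \<Longrightarrow> t 0 = 1 \<Longrightarrow> a t = b (t(0 := 0))"
  shows "continuous_map (cube m) X (sphere_concat a b)"
  unfolding sphere_concat_def
proof (rule continuous_map_cases_le)
  let ?L = "{t \<in> topspace (cube m). t 0 \<le> 1/2}" and ?R = "{t \<in> topspace (cube m). 1/2 \<le> t 0}"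
  have "continuous_map (subtopology (cube m) ?L) (cube m) (\<lambda>t. t(0 := 2 * t 0))"
  proof (rule continuous_map_into_cube)
    fix j assume "j < m"
    with m show "continuous_map (subtopology (cube m) ?L) euclideanreal (\<lambda>x. (x(0 := 2 * x 0)) j)"
      by (cases "j = 0") (auto intro!: continuous_map_real_mult_left continuous_map_cube_coordinate)
  qed (auto simp: topspace_cube PiE_iff extensional_def m)
  from continuous_map_compose [OF this a]
  show "continuous_map (subtopology (cube m) ?L) X (\<lambda>t. a (t(0 := 2 * t 0)))"
    by (simp add: o_def)
  have "continuous_map (subtopology (cube m) ?R) (cube m) (\<lambda>t. t(0 := 2 * t 0 - 1))"
  proof (rule continuous_map_into_cube)
    fix j assume "j < m"
    with m show "continuous_map (subtopology (cube m) ?R) euclideanreal (\<lambda>x. (x(0 := 2 * x 0 - 1)) j)"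
      by (cases "j = 0") (auto intro!: continuous_map_diff continuous_map_real_mult_left continuous_map_cube_coordinate)
  qed (auto simp: topspace_cube PiE_iff extensional_def m)
  from continuous_map_compose [OF this b]
  show "continuous_map (subtopology (cube m) ?R) X (\<lambda>t. b (t(0 := 2 * t 0 - 1)))"
    by (simp add: o_def)
  show "continuous_map (cube m) euclideanreal (\<lambda>t. t 0)"
    using continuous_map_cube_coordinate [OF m, of UNIV] by simp
  fix t assume "t \<in> topspace (cube m)" and t: "t 0 = 1/2"
  then have "t(0 := 1) \<in> topspace (cube m)"
    using m by (auto simp: topspace_cube PiE_iff extensional_def)
  moreover from t have "2 * t 0 = 1"
    by simp
  ultimately show "a (t(0 := 2 * t 0)) = b (t(0 := 2 * t 0 - 1))"
    using ab [of "t(0 := 1)"] by simp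
qed simp

lemma sphere_concat_boundary:
  assumes "0 < i" "t \<in> cube_boundary i"
    and a: "\<forall>t\<in>cube_boundary i. a t = x" and b: "\<forall>t\<in>cube_boundary i. b t = x"
  shows "sphere_concat a b t = x"
proof -
  obtain j where t: "t \<in> {..<i} \<rightarrow>\<^sub>E {0..1}" "j < i" "t j = 0 \<or> t j = 1"
    using assms(2) by (auto simp: cube_boundary_def topspace_cube)
  have "t(0 := 2 * t 0) \<in> cube_boundary i" if "t 0 \<le> 1/2"
    using t assms(1) that unfolding cube_boundary_def topspace_cube
    by (intro CollectI conjI exI [of _ j]) (auto simp: PiE_iff extensional_def)
  moreover have "t(0 := 2 * t 0 - 1) \<in> cube_boundary i" if "\<not> t 0 \<le> 1/2"
    using t assms(1) that unfolding cube_boundary_def topspace_cube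
    by (intro CollectI conjI exI [of _ j]) (auto simp: PiE_iff extensional_def)
  ultimately show ?thesis
    using a b by (auto simp: sphere_concat_def)
qed

lemma sphere_maps_concat:
  assumes i: "0 < i" and a: "a \<in> sphere_maps i X x" and b: "b \<in> sphere_maps i X x"
  shows "sphere_concat a b \<in> sphere_maps i X x"
proof -
  have "a t = b (t(0 := 0))" if "t \<in> topspace (cube i)" "t 0 = 1" for t
  proof -
    have "t \<in> cube_boundary i" "t(0 := 0) \<in> cube_boundary i"
      using that i by (auto simp: cube_boundary_def topspace_cube PiE_iff extensional_def)
    then show ?thesis
      using a b by (simp add: sphere_maps_def)
  qed
  then have "continuous_map (cube i) X (sphere_concat a b)"
    using a b i by (intro continuous_map_sphere_concat) (auto simp: sphere_maps_def)
  moreover have "\<forall>t\<in>cube_boundary i. sphere_concat a b t = x"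
    using a b by (auto simp: sphere_maps_def intro!: sphere_concat_boundary [OF i])
  ultimately show ?thesis
    by (simp add: sphere_maps_def)
qed

text \<open>The homotopies themselves are concatenated: for 0 < i the coordinate 0 of concatenation
  and the time coordinate i are different, so each time slice of the result is the concatenation of
  the two slices.\<close>

lemma sphere_homotopy_concat:
  assumes i: "0 < i" and a: "(a, a') \<in> sphere_homotopy i X x" and b: "(b, b') \<in> sphere_homotopy i X x"
  shows "(sphere_concat a b, sphere_concat a' b') \<in> sphere_homotopy i X x"
proof -
  obtain h where h: "continuous_map (cube (Suc i)) X h"
      "\<And>t. t \<in> topspace (cube i) \<Longrightarrow> h (t(i := 0)) = a t \<and> h (t(i := 1)) = a' t"
      "\<And>t s. t \<in> cube_boundary i \<Longrightarrow> s \<in> {0..1} \<Longrightarrow> h (t(i := s)) = x"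
    using a unfolding sphere_homotopy_iff by blast
  obtain k where k: "continuous_map (cube (Suc i)) X k"
      "\<And>t. t \<in> topspace (cube i) \<Longrightarrow> k (t(i := 0)) = b t \<and> k (t(i := 1)) = b' t"
      "\<And>t s. t \<in> cube_boundary i \<Longrightarrow> s \<in> {0..1} \<Longrightarrow> k (t(i := s)) = x"
    using b unfolding sphere_homotopy_iff by blast
  have "h t = k (t(0 := 0))" if t: "t \<in> topspace (cube (Suc i))" "t 0 = 1" for t
  proof -
    let ?r = "restrict t {..<i}"
    have r: "?r \<in> cube_boundary i" "?r(0 := 0) \<in> cube_boundary i"
      using that i cube_restrict(1) [OF t(1)]
      by (auto simp: cube_boundary_def topspace_cube PiE_iff extensional_def)
    have "h (?r(i := t i)) = x" "k ((?r(0 := 0))(i := t i)) = x"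
      using r cube_restrict(2) [OF t(1)] by (intro h k; simp)+
    moreover have "(?r(0 := 0))(i := t i) = t(0 := 0)"
      using i cube_restrict(3) [OF t(1)] by (metis fun_upd_twist less_irrefl)
    ultimately show ?thesis
      using cube_restrict(3) [OF t(1)] by simp
  qed
  then have "continuous_map (cube (Suc i)) X (sphere_concat h k)"
    using h k i by (intro continuous_map_sphere_concat) auto
  moreover have concat_update:
    "sphere_concat h k (t(i := s)) = sphere_concat (\<lambda>t. h (t(i := s))) (\<lambda>t. k (t(i := s))) t" for t s
    using i by (simp add: sphere_concat_def fun_upd_twist)
  have "sphere_concat h k (t(i := 0)) = sphere_concat a b t \<and>
        sphere_concat h k (t(i := 1)) = sphere_concat a' b' t" if "t \<in> topspace (cube i)" for t
  proof -
    have "t(0 := 2 * t 0) \<in> topspace (cube i)" if "t 0 \<le> 1/2"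
      using \<open>t \<in> topspace (cube i)\<close> that i by (auto simp: topspace_cube PiE_iff extensional_def)
    moreover have "t(0 := 2 * t 0 - 1) \<in> topspace (cube i)" if "\<not> t 0 \<le> 1/2"
      using \<open>t \<in> topspace (cube i)\<close> that i by (auto simp: topspace_cube PiE_iff extensional_def)
    ultimately show ?thesis
      unfolding concat_update using h(2) k(2) by (simp add: sphere_concat_def)
  qed
  moreover have "sphere_concat h k (t(i := s)) = x" if "t \<in> cube_boundary i" "s \<in> {0..1}" for t s
    unfolding concat_update using h(3) k(3) that by (intro sphere_concat_boundary [OF i]) auto
  moreover have "sphere_concat a b \<in> sphere_maps i X x" "sphere_concat a' b' \<in> sphere_maps i X x"
    using a b by (auto simp: sphere_homotopy_def intro: sphere_maps_concat [OF i])
  ultimately show ?thesis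
    unfolding sphere_homotopy_iff by (intro conjI exI [of _ "sphere_concat h k"]) blast+
qed

section \<open>Induced maps on homotopy classes\<close>

lemma carrier_homotopy_group_iff:
  "A \<in> carrier (homotopy_group i X x) \<longleftrightarrow>
     (\<exists>a\<in>sphere_maps i X x. A = sphere_homotopy i X x `` {a})"
  by (auto simp: homotopy_group_def quotient_def)

lemma homotopy_map_closed:
  assumes "continuous_map X Y f" "A \<in> carrier (homotopy_group i X x)"
  shows "homotopy_map i Y f x A \<in> carrier (homotopy_group i Y (f x))"
proof -
  obtain a where a: "a \<in> sphere_maps i X x" "A = sphere_homotopy i X x `` {a}"
    using assms(2) unfolding carrier_homotopy_group_iff by blast
  show ?thesis
    unfolding a(2) homotopy_map_class [OF assms(1) a(1)] carrier_homotopy_group_iff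
    using sphere_maps_compose [OF assms(1) a(1)] by blast
qed

lemma homotopy_group_mult_class:
  assumes i: "0 < i" and a: "a \<in> sphere_maps i X x" and b: "b \<in> sphere_maps i X x"
  shows "mult (homotopy_group i X x) (sphere_homotopy i X x `` {a}) (sphere_homotopy i X x `` {b}) =
         sphere_homotopy i X x `` {sphere_concat a b}"
proof -
  note e = equiv_sphere_homotopy [of i X x]
  have *: "sphere_homotopy i X x `` {sphere_concat a' b'} = sphere_homotopy i X x `` {sphere_concat a b}"
    if "(a, a') \<in> sphere_homotopy i X x" "(b, b') \<in> sphere_homotopy i X x" for a' b'
    using equiv_class_eq [OF e sphere_homotopy_concat [OF i that]] by simp
  show ?thesis
    unfolding homotopy_group_def monoid.select_convs
    using equiv_class_self [OF e a] equiv_class_self [OF e b]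
    by (intro SUP_eq_const *; blast)
qed

lemma homotopy_map_hom:
  assumes i: "0 < i" and f: "continuous_map X Y f"
  shows "homotopy_map i Y f x \<in> hom (homotopy_group i X x) (homotopy_group i Y (f x))"
proof (rule homI)
  fix A assume "A \<in> carrier (homotopy_group i X x)"
  then show "homotopy_map i Y f x A \<in> carrier (homotopy_group i Y (f x))"
    by (rule homotopy_map_closed [OF f])
next
  fix A B assume "A \<in> carrier (homotopy_group i X x)" "B \<in> carrier (homotopy_group i X x)"
  then obtain a b where a: "a \<in> sphere_maps i X x" "A = sphere_homotopy i X x `` {a}"
    and b: "b \<in> sphere_maps i X x" "B = sphere_homotopy i X x `` {b}"
    unfolding carrier_homotopy_group_iff by blast
  have "f \<circ> sphere_concat a b = sphere_concat (f \<circ> a) (f \<circ> b)"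
    by (auto simp: sphere_concat_def fun_eq_iff)
  then show "homotopy_map i Y f x (A \<otimes>\<^bsub>homotopy_group i X x\<^esub> B) =
      homotopy_map i Y f x A \<otimes>\<^bsub>homotopy_group i Y (f x)\<^esub> homotopy_map i Y f x B"
    using a b i by (simp add: homotopy_group_mult_class homotopy_map_class [OF f]
        sphere_maps_concat sphere_maps_compose [OF f])
qed

text \<open>Composition with f commutes with concatenation, so for i > 0 the induced map is
  automatically a homomorphism. Both cases of \<open>homotopy_iso\<close> thus come down to
  bijectivity, and this can be tested on representatives.\<close>

lemma homotopy_isoI:
  assumes f: "continuous_map X Y f"
    and inj: "\<And>x a b. \<lbrakk>x \<in> topspace X; a \<in> sphere_maps i X x; b \<in> sphere_maps i X x;
        (f \<circ> a, f \<circ> b) \<in> sphere_homotopy i Y (f x)\<rbrakk> \<Longrightarrow> (a, b) \<in> sphere_homotopy i X x"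
    and surj: "\<And>x b. \<lbrakk>x \<in> topspace X; b \<in> sphere_maps i Y (f x)\<rbrakk> \<Longrightarrow>
        \<exists>a\<in>sphere_maps i X x. (f \<circ> a, b) \<in> sphere_homotopy i Y (f x)"
  shows "homotopy_iso i X Y f"
proof -
  have "bij_betw (homotopy_map i Y f x)
          (carrier (homotopy_group i X x)) (carrier (homotopy_group i Y (f x)))"
    if x: "x \<in> topspace X" for x
    unfolding bij_betw_def
  proof
    note eX = equiv_sphere_homotopy [of i X x] and eY = equiv_sphere_homotopy [of i Y "f x"]
    show "inj_on (homotopy_map i Y f x) (carrier (homotopy_group i X x))"
    proof (rule inj_onI)
      fix A B assume "A \<in> carrier (homotopy_group i X x)" "B \<in> carrier (homotopy_group i X x)"
        and eq: "homotopy_map i Y f x A = homotopy_map i Y f x B"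
      then obtain a b where a: "a \<in> sphere_maps i X x" "A = sphere_homotopy i X x `` {a}"
        and b: "b \<in> sphere_maps i X x" "B = sphere_homotopy i X x `` {b}"
        unfolding carrier_homotopy_group_iff by blast
      then have "(f \<circ> a, f \<circ> b) \<in> sphere_homotopy i Y (f x)"
        using eq eq_equiv_class [OF _ eY] by (simp add: homotopy_map_class [OF f] sphere_maps_compose [OF f])
      from inj [OF x a(1) b(1) this] show "A = B"
        using equiv_class_eq [OF eX] a b by simp
    qed
    have "B \<in> homotopy_map i Y f x ` carrier (homotopy_group i X x)"
      if B: "B \<in> carrier (homotopy_group i Y (f x))" for B
    proof -
      obtain b where b: "b \<in> sphere_maps i Y (f x)" "B = sphere_homotopy i Y (f x) `` {b}"
        using B unfolding carrier_homotopy_group_iff by blast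
      obtain a where a: "a \<in> sphere_maps i X x" "(f \<circ> a, b) \<in> sphere_homotopy i Y (f x)"
        using surj [OF x b(1)] by blast
      then have "B = homotopy_map i Y f x (sphere_homotopy i X x `` {a})"
        using equiv_class_eq [OF eY] b by (simp add: homotopy_map_class [OF f])
      moreover have "sphere_homotopy i X x `` {a} \<in> carrier (homotopy_group i X x)"
        using a(1) unfolding carrier_homotopy_group_iff by blast
      ultimately show ?thesis
        by (rule image_eqI)
    qed
    with homotopy_map_closed [OF f] show "homotopy_map i Y f x ` carrier (homotopy_group i X x) =
        carrier (homotopy_group i Y (f x))"
      by (intro subset_antisym subsetI) (erule imageE, simp)
  qed
  then show ?thesis
    using homotopy_map_hom [OF _ f] by (auto simp: homotopy_iso_def Group.iso_def)
qed

text \<open>The boundary of the cube of dimension i + 1 consists of a bottom, a top and sides over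
  \<open>cube_boundary i\<close>. The seam at height 1/2 lies in the sides, where u and v
  agree.\<close>

lemma continuous_map_on_cube_boundary:
  assumes u: "continuous_map (cube i) X u" and v: "continuous_map (cube i) X v"
    and uv: "\<And>t. t \<in> cube_boundary i \<Longrightarrow> u t = v t"
  shows "continuous_map (subtopology (cube (Suc i)) (cube_boundary (Suc i))) X
           (\<lambda>t. if t i \<le> 1/2 then u (restrict t {..<i}) else v (restrict t {..<i}))"
proof (rule continuous_map_cases_le)
  let ?S = "subtopology (cube (Suc i)) (cube_boundary (Suc i))"
  have r: "continuous_map (cube (Suc i)) (cube i) (\<lambda>t. restrict t {..<i})"
    using continuous_map_cube_restrict [of i] by (simp add: continuous_map_pairwise o_def)
  show "continuous_map (subtopology ?S A) X (\<lambda>t. u (restrict t {..<i}))" for A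
    using continuous_map_from_subtopology [OF continuous_map_from_subtopology [OF continuous_map_compose [OF r u]]]
    by (simp add: o_def)
  show "continuous_map (subtopology ?S A) X (\<lambda>t. v (restrict t {..<i}))" for A
    using continuous_map_from_subtopology [OF continuous_map_from_subtopology [OF continuous_map_compose [OF r v]]]
    by (simp add: o_def)
  show "continuous_map ?S euclideanreal (\<lambda>t. t i)"
    by (simp add: continuous_map_cube_coordinate)
  fix t assume "t \<in> topspace ?S" "t i = 1/2"
  then have "restrict t {..<i} \<in> cube_boundary i"
    using cube_boundary_restrict by auto
  then show "u (restrict t {..<i}) = v (restrict t {..<i})"
    by (rule uv)
qed simp

lemma restrict_cube: "t \<in> topspace (cube i) \<Longrightarrow> restrict t {..<i} = t"
  by (auto simp: topspace_cube PiE_iff extensional_def)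

text \<open>On the boundary u and v have to be equal but may vary. A filling in E of the map that is
  u on the bottom and v on the top joins them relative to the boundary; constancy there appears only
  after projection, where both have the value b.\<close>

lemma homotopic_projections:
  assumes p: "continuous_map E B p" and E: "cube_fillable (Suc i) E"
    and u: "continuous_map (cube i) E u" and v: "continuous_map (cube i) E v"
    and uv: "\<And>t. t \<in> cube_boundary i \<Longrightarrow> u t = v t"
    and pu: "p \<circ> u \<in> sphere_maps i B b" and pv: "p \<circ> v \<in> sphere_maps i B b"
  shows "(p \<circ> u, p \<circ> v) \<in> sphere_homotopy i B b"
proof -
  let ?k = "\<lambda>t. if t i \<le> 1/2 then u (restrict t {..<i}) else v (restrict t {..<i})"
  obtain K where K: "continuous_map (cube (Suc i)) E K"
      "\<And>t. t \<in> cube_boundary (Suc i) \<Longrightarrow> K t = ?k t"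
    using E continuous_map_on_cube_boundary [OF u v uv] unfolding cube_fillable_def by blast
  have "(p \<circ> K) (t(i := s)) = (if s \<le> 1/2 then (p \<circ> u) t else (p \<circ> v) t)"
    if "t \<in> topspace (cube i)" "s = 0 \<or> s = 1 \<or> s \<in> {0..1} \<and> t \<in> cube_boundary i" for t s
  proof -
    have "t(i := s) \<in> cube_boundary (Suc i)"
      using that cube_boundary_update [OF that(1), of s] by auto
    then show ?thesis
      using that(1) by (simp add: K(2) restrict_cube)
  qed
  note pK = this
  have "\<forall>t\<in>topspace (cube i). (p \<circ> K) (t(i := 0)) = (p \<circ> u) t \<and> (p \<circ> K) (t(i := 1)) = (p \<circ> v) t"
    using pK by simp
  moreover have "\<forall>t\<in>cube_boundary i. \<forall>s\<in>{0..1}. (p \<circ> K) (t(i := s)) = b"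
  proof (intro ballI)
    fix t s assume t: "t \<in> cube_boundary i" "s \<in> {0..1::real}"
    with pu pv have "(p \<circ> u) t = b" "(p \<circ> v) t = b"
      unfolding sphere_maps_def by blast+
    with t show "(p \<circ> K) (t(i := s)) = b"
      using pK [of t s] cube_boundary_subset [THEN subsetD, OF t(1)] by auto
  qed
  moreover have "continuous_map (cube (Suc i)) B (p \<circ> K)"
    by (rule continuous_map_compose [OF K(1) p])
  ultimately show ?thesis
    using pu pv unfolding sphere_homotopy_iff by blast
qed

text \<open>T is the total space over X, and E the one over B. The fact \<open>pair\<close>
  expresses that a map into T is a map a into X together with a lift of f \<circ> a to E.
  Injectivity fills a boundary in T in dimension i + 1; surjectivity fills one in T in dimension i
  and compares lifts by filling in E in dimension i + 1.\<close>

lemma homotopy_iso_pullback: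
  assumes f: "continuous_map X B f" and p: "continuous_map E B p"
    and \<phi>: "homeomorphic_map T (subtopology (prod_topology X E) {(x, e). f x = p e}) \<phi>"
    and lift: "\<And>m a. continuous_map (cube m) B a \<Longrightarrow>
        \<exists>l. continuous_map (cube m) E l \<and> (\<forall>t\<in>topspace (cube m). p (l t) = a t)"
    and E: "cube_fillable (Suc i) E" and T: "cube_fillable i T" "cube_fillable (Suc i) T"
  shows "homotopy_iso i X B f"
proof (rule homotopy_isoI [OF f])
  let ?Q = "subtopology (prod_topology X E) {(x, e). f x = p e}"
  obtain \<psi> where \<psi>: "homeomorphic_maps T ?Q \<phi> \<psi>"
    using \<phi> homeomorphic_map_maps by blast
  then have c\<phi>: "continuous_map T ?Q \<phi>" and c\<psi>: "continuous_map ?Q T \<psi>"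
    and \<phi>\<psi>: "\<And>y. y \<in> topspace ?Q \<Longrightarrow> \<phi> (\<psi> y) = y"
    unfolding homeomorphic_maps_def by blast+
  have q: "continuous_map T X (\<lambda>v. fst (\<phi> v))" and F: "continuous_map T E (\<lambda>v. snd (\<phi> v))"
    using c\<phi> by (auto simp: continuous_map_in_subtopology continuous_map_pairwise o_def)
  have fq: "f (fst (\<phi> v)) = p (snd (\<phi> v))" if "v \<in> topspace T" for v
  proof -
    have "\<phi> v \<in> topspace ?Q"
      using continuous_map_image_subset_topspace [OF c\<phi>] that by blast
    then show ?thesis
      by auto
  qed
  have pair: "continuous_map Y T (\<lambda>y. \<psi> (a y, l y)) \<and> (\<forall>y\<in>topspace Y. \<phi> (\<psi> (a y, l y)) = (a y, l y))"
    if "continuous_map Y X a" "continuous_map Y E l" "\<And>y. y \<in> topspace Y \<Longrightarrow> f (a y) = p (l y)"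
    for Y :: "(nat \<Rightarrow> real) topology" and a l
  proof -
    have "continuous_map Y ?Q (\<lambda>y. (a y, l y))"
      using that by (auto simp: continuous_map_in_subtopology continuous_map_pairedI)
    moreover from this have "(a y, l y) \<in> topspace ?Q" if "y \<in> topspace Y" for y
      using continuous_map_image_subset_topspace that by blast
    ultimately show ?thesis
      using continuous_map_compose [OF _ c\<psi>] \<phi>\<psi> by (simp add: o_def)
  qed
  {
    fix x a b assume a: "a \<in> sphere_maps i X x" and b: "b \<in> sphere_maps i X x"
      and "(f \<circ> a, f \<circ> b) \<in> sphere_homotopy i B (f x)"
    then obtain h where h: "continuous_map (cube (Suc i)) B h"
        "\<And>t. t \<in> topspace (cube i) \<Longrightarrow> h (t(i := 0)) = f (a t) \<and> h (t(i := 1)) = f (b t)"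
        "\<And>t s. t \<in> cube_boundary i \<Longrightarrow> s \<in> {0..1} \<Longrightarrow> h (t(i := s)) = f x"
      unfolding sphere_homotopy_iff by auto
    obtain l where l: "continuous_map (cube (Suc i)) E l" "\<And>t. t \<in> topspace (cube (Suc i)) \<Longrightarrow> p (l t) = h t"
      using lift [OF h(1)] by blast
    \<comment> \<open>The boundary map that a homotopy from a to b must have: a on the bottom, b on
      the top and x on the sides. Its image under f is the restriction of h, so l is a compatible
      second component.\<close>
    let ?k = "\<lambda>t. if t i \<le> 1/2 then a (restrict t {..<i}) else b (restrict t {..<i})"
    let ?Y = "subtopology (cube (Suc i)) (cube_boundary (Suc i))"
    have ab: "a t = x" "b t = x" if "t \<in> cube_boundary i" for t
      using a b that unfolding sphere_maps_def by blast+
    have k: "continuous_map ?Y X ?k"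
      using a b ab by (intro continuous_map_on_cube_boundary) (auto simp: sphere_maps_def)
    have fk: "f (?k t) = p (l t)" if "t \<in> topspace ?Y" for t
    proof -
      have t: "t \<in> topspace (cube (Suc i))" "t \<in> cube_boundary (Suc i)"
        using that by auto
      note r = cube_restrict [OF t(1)]
      consider "t i = 0" | "t i = 1" | "restrict t {..<i} \<in> cube_boundary i"
        using t(2) cube_boundary_restrict [OF t(1)] by blast
      then have "f (?k t) = h ((restrict t {..<i})(i := t i))"
      proof cases
        case 3
        then show ?thesis
          by (simp only: h(3) [OF _ r(2)] ab if_cancel)
      qed (use h(2) [OF r(1)] in simp_all)
      then show ?thesis
        using r(3) l(2) [OF t(1)] by simp
    qed
    obtain c where c: "continuous_map (cube (Suc i)) T c"
        "\<And>t. t \<in> cube_boundary (Suc i) \<Longrightarrow> c t = \<psi> (?k t, l t)"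
      using T(2) pair [OF k continuous_map_from_subtopology [OF l(1)] fk] unfolding cube_fillable_def by blast
    have \<phi>c: "fst (\<phi> (c (t(i := s)))) = (if s \<le> 1/2 then a t else b t)"
      if "t \<in> topspace (cube i)" "s = 0 \<or> s = 1 \<or> s \<in> {0..1} \<and> t \<in> cube_boundary i" for t s
    proof -
      have t: "t(i := s) \<in> cube_boundary (Suc i)"
        using that cube_boundary_update [OF that(1), of s] by auto
      then have "t(i := s) \<in> topspace ?Y"
        using cube_boundary_subset by auto
      then have "fst (\<phi> (c (t(i := s)))) = ?k (t(i := s))"
        unfolding c(2) [OF t]
        using pair [OF k continuous_map_from_subtopology [OF l(1)] fk, THEN conjunct2, rule_format]
        by (simp only: fst_conv)
      then show ?thesis
        using that(1) by (simp add: restrict_cube)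
    qed
    have "\<forall>t\<in>topspace (cube i). fst (\<phi> (c (t(i := 0)))) = a t \<and> fst (\<phi> (c (t(i := 1)))) = b t"
      using \<phi>c by simp
    moreover have "\<forall>t\<in>cube_boundary i. \<forall>s\<in>{0..1}. fst (\<phi> (c (t(i := s)))) = x"
      using \<phi>c ab cube_boundary_subset by (simp add: subset_iff)
    moreover have "continuous_map (cube (Suc i)) X (\<lambda>t. fst (\<phi> (c t)))"
      using continuous_map_compose [OF c(1) q] by (simp add: o_def)
    ultimately show "(a, b) \<in> sphere_homotopy i X x"
      using a b unfolding sphere_homotopy_iff by blast
  next
    fix x b assume x: "x \<in> topspace X" and b: "b \<in> sphere_maps i B (f x)"
    then have cb: "continuous_map (cube i) B b" and bx: "\<And>t. t \<in> cube_boundary i \<Longrightarrow> b t = f x"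
      by (auto simp: sphere_maps_def)
    obtain l where l: "continuous_map (cube i) E l" "\<And>t. t \<in> topspace (cube i) \<Longrightarrow> p (l t) = b t"
      using lift [OF cb] by blast
    let ?Y = "subtopology (cube i) (cube_boundary i)"
    have cx: "continuous_map ?Y X (\<lambda>t. x)"
      using x by simp
    have fx: "f x = p (l t)" if "t \<in> topspace ?Y" for t
      using that l(2) bx by simp
    obtain c where c: "continuous_map (cube i) T c" "\<And>t. t \<in> cube_boundary i \<Longrightarrow> c t = \<psi> (x, l t)"
      using T(1) pair [OF cx continuous_map_from_subtopology [OF l(1)] fx] unfolding cube_fillable_def by blast
    have \<phi>c: "\<phi> (c t) = (x, l t)" if "t \<in> cube_boundary i" for t
    proof -
      have "t \<in> topspace ?Y"
        using that cube_boundary_subset by auto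
      then show ?thesis
        using pair [OF cx continuous_map_from_subtopology [OF l(1)] fx] by (simp add: c(2) [OF that])
    qed
    \<comment> \<open>\<open>?a\<close> is the wanted preimage. \<open>?u\<close> lifts
      \<open>f \<circ> ?a\<close> and l lifts b; the two lifts agree on the boundary, and inside the
      cube only fillability of E relates them.\<close>
    let ?a = "\<lambda>t. fst (\<phi> (c t))" and ?u = "\<lambda>t. snd (\<phi> (c t))"
    have a: "?a \<in> sphere_maps i X x" and u: "continuous_map (cube i) E ?u"
      using continuous_map_compose [OF c(1) q] continuous_map_compose [OF c(1) F] \<phi>c
      by (auto simp: sphere_maps_def o_def)
    have c_in: "c t \<in> topspace T" if "t \<in> topspace (cube i)" for t
      using continuous_map_image_subset_topspace [OF c(1)] that by blast
    have pu: "p \<circ> ?u \<in> sphere_maps i B (f x)"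
      using continuous_map_compose [OF u p] \<phi>c l(2) bx cube_boundary_subset
      by (auto simp: sphere_maps_def subset_iff)
    have pl: "p \<circ> l \<in> sphere_maps i B (f x)"
      using continuous_map_compose [OF l(1) p] l(2) bx cube_boundary_subset
      by (auto simp: sphere_maps_def subset_iff)
    \<comment> \<open>Maps are functions on all of \<open>nat \<Rightarrow> real\<close>.
      \<open>f \<circ> ?a\<close> and \<open>p \<circ> ?u\<close>, and likewise b and
      \<open>p \<circ> l\<close>, are known to agree on the cube only, so the homotopy is
      transferred along equality there.\<close>
    have congr: "(\<alpha>, \<beta>) \<in> sphere_homotopy i B (f x) \<longleftrightarrow> (\<alpha>', \<beta>') \<in> sphere_homotopy i B (f x)"
      if "\<And>t. t \<in> topspace (cube i) \<Longrightarrow> \<alpha> t = \<alpha>' t \<and> \<beta> t = \<beta>' t"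
        "\<alpha> \<in> sphere_maps i B (f x)" "\<alpha>' \<in> sphere_maps i B (f x)"
        "\<beta> \<in> sphere_maps i B (f x)" "\<beta>' \<in> sphere_maps i B (f x)" for \<alpha> \<beta> \<alpha>' \<beta>'
      unfolding sphere_homotopy_iff using that by auto
    have "(p \<circ> ?u, p \<circ> l) \<in> sphere_homotopy i B (f x)"
      using \<phi>c by (intro homotopic_projections [OF p E u l(1) _ pu pl]) simp
    then have "(f \<circ> ?a, b) \<in> sphere_homotopy i B (f x)"
      using fq c_in l(2) by (subst congr [OF _ sphere_maps_compose [OF f a] pu b pl]) auto
    with a show "\<exists>a\<in>sphere_maps i X x. (f \<circ> a, b) \<in> sphere_homotopy i B (f x)"
      by blast
  }
qed

section \<open>Principal bundles\<close>

lemma continuous_map_openin_cover: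
  assumes "\<And>x. x \<in> topspace X \<Longrightarrow> \<exists>U. openin X U \<and> x \<in> U \<and> continuous_map (subtopology X U) Y f"
  shows "continuous_map X Y f"
proof (rule pasting_lemma [where I = "{U. openin X U \<and> continuous_map (subtopology X U) Y f}"
      and T = id and f = "\<lambda>_. f"])
  fix x assume "x \<in> topspace X"
  with assms show "\<exists>U. U \<in> {U. openin X U \<and> continuous_map (subtopology X U) Y f} \<and> x \<in> id U \<and> f x = f x"
    by auto
qed auto

lemma subtopology_subtopology_Collect:
  "subtopology (subtopology X S) {t \<in> topspace (subtopology X S). Q t} = subtopology X {t \<in> S. Q t}"
proof -
  have "S \<inter> {t \<in> topspace (subtopology X S). Q t} = topspace X \<inter> {t \<in> S. Q t}"
    by auto
  then show ?thesis
    unfolding subtopology_subtopology by (metis subtopology_restrict)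
qed

context
  fixes G :: "('g, 'm) monoid_scheme" and T :: "'g topology" and P :: "('e, 'b, 'g) gbundle"
  assumes principal: "principal_bundle G T P"
begin

lemma principal_group: "Group.group G" and principal_topspace: "topspace T = carrier G"
  and principal_mult: "continuous_map (prod_topology T T) T (\<lambda>(g, h). g \<otimes>\<^bsub>G\<^esub> h)"
  and principal_inv: "continuous_map T T (\<lambda>g. inv\<^bsub>G\<^esub> g)"
  and principal_proj: "continuous_map (total_space P) (base_space P) (bundle_proj P)"
  and principal_act: "continuous_map (prod_topology (total_space P) T) (total_space P) (\<lambda>(e, g). bundle_act P e g)"
  using principal by (simp_all add: principal_bundle_def topological_group_def)

lemma principal_act_one: "e \<in> topspace (total_space P) \<Longrightarrow> bundle_act P e \<one>\<^bsub>G\<^esub> = e"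
  and principal_act_mult: "\<lbrakk>e \<in> topspace (total_space P); g \<in> carrier G; h \<in> carrier G\<rbrakk> \<Longrightarrow>
    bundle_act P e (g \<otimes>\<^bsub>G\<^esub> h) = bundle_act P (bundle_act P e g) h"
  and principal_proj_act: "\<lbrakk>e \<in> topspace (total_space P); g \<in> carrier G\<rbrakk> \<Longrightarrow>
    bundle_proj P (bundle_act P e g) = bundle_proj P e"
  using principal by (simp_all add: principal_bundle_def)

lemma principal_act_closed:
  "\<lbrakk>e \<in> topspace (total_space P); g \<in> carrier G\<rbrakk> \<Longrightarrow> bundle_act P e g \<in> topspace (total_space P)"
  using continuous_map_image_subset_topspace [OF principal_act] principal_topspace by auto

lemma continuous_map_principal_act:
  assumes "continuous_map X (total_space P) f" "continuous_map X T g"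
  shows "continuous_map X (total_space P) (\<lambda>x. bundle_act P (f x) (g x))"
  using continuous_map_compose [OF continuous_map_pairedI [OF assms] principal_act] by (simp add: o_def)

lemma continuous_map_principal_mult_inv:
  assumes "continuous_map X T f" "continuous_map X T g"
  shows "continuous_map X T (\<lambda>x. inv\<^bsub>G\<^esub> (f x) \<otimes>\<^bsub>G\<^esub> g x)"
  using continuous_map_compose [OF continuous_map_pairedI
      [OF continuous_map_compose [OF assms(1) principal_inv] assms(2)] principal_mult] by (simp add: o_def)

text \<open>The homeomorphism \<open>\<phi>\<close> of a local trivialization is split into the
  section \<open>\<phi> (u, 1)\<close> and the group coordinate of its inverse, so that each can be
  composed with other maps by itself.\<close>

definition trivialization :: "'b set \<Rightarrow> ('b \<Rightarrow> 'e) \<Rightarrow> ('e \<Rightarrow> 'g) \<Rightarrow> bool" where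
  "trivialization U \<sigma> \<gamma> \<longleftrightarrow>
     openin (base_space P) U \<and>
     continuous_map (subtopology (base_space P) U) (total_space P) \<sigma> \<and>
     (\<forall>u\<in>U. bundle_proj P (\<sigma> u) = u) \<and>
     continuous_map (subtopology (total_space P) {e \<in> topspace (total_space P). bundle_proj P e \<in> U}) T \<gamma> \<and>
     (\<forall>e\<in>topspace (total_space P). bundle_proj P e \<in> U \<longrightarrow>
        bundle_act P (\<sigma> (bundle_proj P e)) (\<gamma> e) = e) \<and>
     (\<forall>u\<in>U. \<forall>g\<in>carrier G. \<gamma> (bundle_act P (\<sigma> u) g) = g)"

lemma trivializationD:
  assumes "trivialization U \<sigma> \<gamma>"
  shows "openin (base_space P) U"
    and "continuous_map (subtopology (base_space P) U) (total_space P) \<sigma>"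
    and "\<And>u. u \<in> U \<Longrightarrow> bundle_proj P (\<sigma> u) = u"
    and "continuous_map (subtopology (total_space P) {e \<in> topspace (total_space P). bundle_proj P e \<in> U}) T \<gamma>"
    and "\<And>e. e \<in> topspace (total_space P) \<Longrightarrow> bundle_proj P e \<in> U \<Longrightarrow>
           bundle_act P (\<sigma> (bundle_proj P e)) (\<gamma> e) = e"
    and "\<And>u g. u \<in> U \<Longrightarrow> g \<in> carrier G \<Longrightarrow> \<gamma> (bundle_act P (\<sigma> u) g) = g"
  using assms unfolding trivialization_def by blast+

lemma principal_local_triviality:
  assumes "b \<in> topspace (base_space P)"
  shows "\<exists>U \<sigma> \<gamma>. b \<in> U \<and> trivialization U \<sigma> \<gamma>"
proof -
  interpret group G by (rule principal_group)
  obtain U \<phi> where U: "openin (base_space P) U" "b \<in> U"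
    and \<phi>: "homeomorphic_map (prod_topology (subtopology (base_space P) U) T)
          (subtopology (total_space P) {e \<in> topspace (total_space P). bundle_proj P e \<in> U}) \<phi>"
    and \<phi>pa: "\<forall>u\<in>U. \<forall>g\<in>carrier G. bundle_proj P (\<phi> (u, g)) = u \<and>
       (\<forall>h\<in>carrier G. \<phi> (u, g \<otimes>\<^bsub>G\<^esub> h) = bundle_act P (\<phi> (u, g)) h)"
    using principal [unfolded principal_bundle_def, THEN conjunct2, THEN conjunct2, THEN conjunct2,
        THEN conjunct2, THEN bspec, OF assms]
    by (elim exE conjE)
  have \<phi>p: "\<And>u g. u \<in> U \<Longrightarrow> g \<in> carrier G \<Longrightarrow> bundle_proj P (\<phi> (u, g)) = u"
    and \<phi>a: "\<And>u g h. u \<in> U \<Longrightarrow> g \<in> carrier G \<Longrightarrow> h \<in> carrier G \<Longrightarrow>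
       \<phi> (u, g \<otimes>\<^bsub>G\<^esub> h) = bundle_act P (\<phi> (u, g)) h"
    using \<phi>pa by blast+
  let ?X = "prod_topology (subtopology (base_space P) U) T"
  let ?Y = "subtopology (total_space P) {e \<in> topspace (total_space P). bundle_proj P e \<in> U}"
  obtain \<psi> where \<psi>: "homeomorphic_maps ?X ?Y \<phi> \<psi>"
    using \<phi> homeomorphic_map_maps by blast
  then have c\<phi>: "continuous_map ?X ?Y \<phi>" and c\<psi>: "continuous_map ?Y ?X \<psi>"
    and \<phi>\<psi>: "\<And>y. y \<in> topspace ?Y \<Longrightarrow> \<phi> (\<psi> y) = y" and \<psi>\<phi>: "\<And>x. x \<in> topspace ?X \<Longrightarrow> \<psi> (\<phi> x) = x"
    unfolding homeomorphic_maps_def by blast+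
  have UB: "U \<subseteq> topspace (base_space P)"
    using U openin_subset by blast
  have X: "(u, g) \<in> topspace ?X" if "u \<in> U" "g \<in> carrier G" for u g
    using that UB principal_topspace by auto
  define \<sigma> where "\<sigma> u = \<phi> (u, \<one>\<^bsub>G\<^esub>)" for u
  define \<gamma> where "\<gamma> e = snd (\<psi> e)" for e
  have act\<sigma>: "bundle_act P (\<sigma> u) g = \<phi> (u, g)" if "u \<in> U" "g \<in> carrier G" for u g
    using \<phi>a [of u "\<one>\<^bsub>G\<^esub>" g] that by (simp add: \<sigma>_def)
  have "trivialization U \<sigma> \<gamma>"
    unfolding trivialization_def
  proof (intro conjI ballI impI)
    show "openin (base_space P) U"
      by (rule U)
    have "continuous_map (subtopology (base_space P) U) ?X (\<lambda>u. (u, \<one>\<^bsub>G\<^esub>))"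
      by (intro continuous_map_pairedI) (auto simp: principal_topspace)
    from continuous_map_compose [OF this c\<phi>]
    show "continuous_map (subtopology (base_space P) U) (total_space P) \<sigma>"
      by (simp add: o_def \<sigma>_def [abs_def] continuous_map_in_subtopology)
    show "bundle_proj P (\<sigma> u) = u" if "u \<in> U" for u
      using that by (simp add: \<sigma>_def \<phi>p)
    show "continuous_map ?Y T \<gamma>"
      using c\<psi> by (simp add: \<gamma>_def [abs_def] continuous_map_pairwise o_def)
    show "bundle_act P (\<sigma> (bundle_proj P e)) (\<gamma> e) = e"
      if e: "e \<in> topspace (total_space P)" "bundle_proj P e \<in> U" for e
    proof -
      have eY: "e \<in> topspace ?Y"
        using e by auto
      then have "\<psi> e \<in> topspace ?X"
        using continuous_map_image_subset_topspace [OF c\<psi>] by blast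
      then obtain u g where ug: "\<psi> e = (u, g)" "u \<in> U" "g \<in> carrier G"
        using principal_topspace by (cases "\<psi> e") auto
      then have "e = \<phi> (u, g)"
        using \<phi>\<psi> [OF eY] by simp
      then show ?thesis
        using ug \<phi>p [of u g] by (simp add: act\<sigma> \<gamma>_def)
    qed
    show "\<gamma> (bundle_act P (\<sigma> u) g) = g" if "u \<in> U" "g \<in> carrier G" for u g
      using \<psi>\<phi> [OF X [OF that]] by (simp add: act\<sigma> that \<gamma>_def)
  qed
  with U(2) show ?thesis
    by blast
qed

text \<open>The division map of the bundle: the group element that carries e to e'. It is meaningful
  only for two points of the same fibre.\<close>

definition translation :: "'e \<Rightarrow> 'e \<Rightarrow> 'g" where
  "translation e e' = (THE g. g \<in> carrier G \<and> bundle_act P e g = e')"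

text \<open>That the action is free and transitive on fibres comes from local triviality: with s the
  value of a local section, e = s \<gamma>(e) and e' = s \<gamma>(e'), which forces the element to
  be the quotient of the two group coordinates.\<close>

lemma translation_ex1:
  assumes e: "e \<in> topspace (total_space P)" "e' \<in> topspace (total_space P)"
    and eq: "bundle_proj P e = bundle_proj P e'"
  shows "\<exists>!g. g \<in> carrier G \<and> bundle_act P e g = e'"
proof -
  interpret group G by (rule principal_group)
  have b: "bundle_proj P e \<in> topspace (base_space P)"
    using continuous_map_image_subset_topspace [OF principal_proj] e(1) by blast
  obtain U \<sigma> \<gamma> where U: "bundle_proj P e \<in> U" and triv: "trivialization U \<sigma> \<gamma>"
    using principal_local_triviality [OF b] by blast
  note \<sigma> = trivializationD(2) [OF triv] and \<gamma> = trivializationD(4) [OF triv]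
    and \<sigma>\<gamma> = trivializationD(5) [OF triv] and \<gamma>\<sigma> = trivializationD(6) [OF triv]
  define s where "s = \<sigma> (bundle_proj P e)"
  have s: "s \<in> topspace (total_space P)"
    using continuous_map_image_subset_topspace [OF \<sigma>] b U by (auto simp: s_def)
  have \<gamma>_closed: "\<gamma> e \<in> carrier G" "\<gamma> e' \<in> carrier G"
    using continuous_map_image_subset_topspace [OF \<gamma>] e U eq principal_topspace by auto
  have se: "bundle_act P s (\<gamma> e) = e" "bundle_act P s (\<gamma> e') = e'"
    using \<sigma>\<gamma> [OF e(1) U] \<sigma>\<gamma> [OF e(2)] eq U by (simp_all add: s_def)
  show ?thesis
  proof (rule ex1I)
    have "bundle_act P e (inv\<^bsub>G\<^esub> (\<gamma> e) \<otimes>\<^bsub>G\<^esub> \<gamma> e') = bundle_act P s (\<gamma> e \<otimes>\<^bsub>G\<^esub> (inv\<^bsub>G\<^esub> (\<gamma> e) \<otimes>\<^bsub>G\<^esub> \<gamma> e'))"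
      using s \<gamma>_closed by (subst (1) se(1) [symmetric], subst principal_act_mult [symmetric]) auto
    also have "\<dots> = e'"
      using se \<gamma>_closed by (simp add: m_assoc [symmetric])
    finally show "inv\<^bsub>G\<^esub> (\<gamma> e) \<otimes>\<^bsub>G\<^esub> \<gamma> e' \<in> carrier G \<and> bundle_act P e (inv\<^bsub>G\<^esub> (\<gamma> e) \<otimes>\<^bsub>G\<^esub> \<gamma> e') = e'"
      using \<gamma>_closed by simp
  next
    fix g assume g: "g \<in> carrier G \<and> bundle_act P e g = e'"
    then have "bundle_act P s (\<gamma> e \<otimes>\<^bsub>G\<^esub> g) = e'"
      using principal_act_mult [OF s] \<gamma>_closed se by simp
    then have "\<gamma> e \<otimes>\<^bsub>G\<^esub> g = \<gamma> e'"
      using \<gamma>\<sigma> [OF U, of "\<gamma> e \<otimes>\<^bsub>G\<^esub> g"] g \<gamma>_closed by (simp add: s_def)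
    then show "g = inv\<^bsub>G\<^esub> (\<gamma> e) \<otimes>\<^bsub>G\<^esub> \<gamma> e'"
      using g \<gamma>_closed inv_solve_left by metis
  qed
qed

lemma translation:
  assumes "e \<in> topspace (total_space P)" "e' \<in> topspace (total_space P)" "bundle_proj P e = bundle_proj P e'"
  shows "translation e e' \<in> carrier G" "bundle_act P e (translation e e') = e'"
  using theI' [OF translation_ex1 [OF assms]] by (simp_all add: translation_def)

lemma translation_eqI:
  assumes "e \<in> topspace (total_space P)" "g \<in> carrier G"
  shows "translation e (bundle_act P e g) = g"
  unfolding translation_def
  by (rule the1_equality [OF translation_ex1])
    (use assms principal_act_closed principal_proj_act in auto)

text \<open>Continuity is local, and over a trivialization the section cancels: the translation is
  the inverse of one group coordinate times the other.\<close>

lemma continuous_map_translation: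
  assumes e: "continuous_map X (total_space P) e" "continuous_map X (total_space P) e'"
    and eq: "\<And>x. x \<in> topspace X \<Longrightarrow> bundle_proj P (e x) = bundle_proj P (e' x)"
  shows "continuous_map X T (\<lambda>x. translation (e x) (e' x))"
proof (rule continuous_map_openin_cover)
  interpret group G by (rule principal_group)
  fix x assume x: "x \<in> topspace X"
  have pe: "continuous_map X (base_space P) (\<lambda>x. bundle_proj P (e x))"
    using continuous_map_compose [OF e(1) principal_proj] by (simp add: o_def)
  then have b: "bundle_proj P (e x) \<in> topspace (base_space P)"
    using continuous_map_image_subset_topspace x by blast
  obtain U \<sigma> \<gamma> where U: "bundle_proj P (e x) \<in> U" and triv: "trivialization U \<sigma> \<gamma>"
    using principal_local_triviality [OF b] by blast
  note \<sigma> = trivializationD(2) [OF triv] and \<gamma> = trivializationD(4) [OF triv]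
    and \<sigma>\<gamma> = trivializationD(5) [OF triv] and \<gamma>\<sigma> = trivializationD(6) [OF triv]
  define V where "V = {y \<in> topspace X. bundle_proj P (e y) \<in> U}"
  have e_in: "e y \<in> topspace (total_space P)" "e' y \<in> topspace (total_space P)" if "y \<in> topspace X" for y
    using that e continuous_map_image_subset_topspace by blast+
  have c: "continuous_map (subtopology X V) T (\<lambda>y. \<gamma> (e y))" "continuous_map (subtopology X V) T (\<lambda>y. \<gamma> (e' y))"
  proof -
    have "continuous_map (subtopology X V) (subtopology (total_space P) {e \<in> topspace (total_space P). bundle_proj P e \<in> U}) e"
      "continuous_map (subtopology X V) (subtopology (total_space P) {e \<in> topspace (total_space P). bundle_proj P e \<in> U}) e'"
      by (rule continuous_map_into_subtopology; use e e_in eq in \<open>auto simp: V_def continuous_map_from_subtopology\<close>)+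
    then show "continuous_map (subtopology X V) T (\<lambda>y. \<gamma> (e y))" "continuous_map (subtopology X V) T (\<lambda>y. \<gamma> (e' y))"
      using continuous_map_compose [OF _ \<gamma>] by (auto simp: o_def)
  qed
  have "translation (e y) (e' y) = inv\<^bsub>G\<^esub> (\<gamma> (e y)) \<otimes>\<^bsub>G\<^esub> \<gamma> (e' y)" if y: "y \<in> V" for y
  proof -
    have yX: "y \<in> topspace X" and yU: "bundle_proj P (e y) \<in> U"
      using y by (auto simp: V_def)
    have \<gamma>_closed: "\<gamma> (e y) \<in> carrier G" "\<gamma> (e' y) \<in> carrier G"
      using continuous_map_image_subset_topspace [OF c(1)] continuous_map_image_subset_topspace [OF c(2)]
        y yX principal_topspace by auto
    define s where "s = \<sigma> (bundle_proj P (e y))"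
    have s: "s \<in> topspace (total_space P)"
      using continuous_map_image_subset_topspace [OF \<sigma>] yU openin_subset [OF trivializationD(1) [OF triv]] by (auto simp: s_def)
    have se: "bundle_act P s (\<gamma> (e y)) = e y" "bundle_act P s (\<gamma> (e' y)) = e' y"
      using \<sigma>\<gamma> [OF e_in(1) [OF yX] yU] \<sigma>\<gamma> [OF e_in(2) [OF yX]] eq [OF yX] yU by (simp_all add: s_def)
    have "bundle_act P (e y) (inv\<^bsub>G\<^esub> (\<gamma> (e y)) \<otimes>\<^bsub>G\<^esub> \<gamma> (e' y)) =
        bundle_act P s (\<gamma> (e y) \<otimes>\<^bsub>G\<^esub> (inv\<^bsub>G\<^esub> (\<gamma> (e y)) \<otimes>\<^bsub>G\<^esub> \<gamma> (e' y)))"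
      using s \<gamma>_closed by (simp add: principal_act_mult se)
    also have "\<dots> = e' y"
      using se \<gamma>_closed by (simp add: m_assoc [symmetric])
    finally show ?thesis
      using translation_eqI [OF e_in(1) [OF yX], of "inv\<^bsub>G\<^esub> (\<gamma> (e y)) \<otimes>\<^bsub>G\<^esub> \<gamma> (e' y)"] \<gamma>_closed by simp
  qed
  then have "continuous_map (subtopology X V) T (\<lambda>x. translation (e x) (e' x))"
    by (intro continuous_map_eq [OF continuous_map_principal_mult_inv [OF c]]) (simp add: V_def)
  moreover have "openin X V"
    unfolding V_def by (rule openin_continuous_map_preimage [OF pe trivializationD(1) [OF triv]])
  ultimately show "\<exists>U. openin X U \<and> x \<in> U \<and> continuous_map (subtopology X U) T (\<lambda>x. translation (e x) (e' x))"
    using x U by (intro exI [of _ V]) (auto simp: V_def)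
qed

text \<open>S is an arbitrary set of functions and only its part inside the cube counts; a box can
  therefore be written by inequalities on the coordinates alone.\<close>

definition lifts_on :: "nat \<Rightarrow> ((nat \<Rightarrow> real) \<Rightarrow> 'b) \<Rightarrow> (nat \<Rightarrow> real) set \<Rightarrow> bool" where
  "lifts_on m a S \<longleftrightarrow>
     (\<exists>l. continuous_map (subtopology (cube m) S) (total_space P) l \<and>
        (\<forall>t\<in>topspace (cube m) \<inter> S. bundle_proj P (l t) = a t))"

lemma lifts_on_subset:
  assumes "lifts_on m a S" "topspace (cube m) \<inter> S' \<subseteq> S"
  shows "lifts_on m a S'"
proof -
  obtain l where l: "continuous_map (subtopology (cube m) S) (total_space P) l"
      "\<forall>t\<in>topspace (cube m) \<inter> S. bundle_proj P (l t) = a t"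
    using assms(1) unfolding lifts_on_def by blast
  have "continuous_map (subtopology (cube m) (topspace (cube m) \<inter> S')) (total_space P) l"
    by (rule continuous_map_from_subtopology_mono [OF l(1) assms(2)])
  with l(2) assms(2) show ?thesis
    unfolding lifts_on_def subtopology_restrict [of "cube m" S', symmetric] by blast
qed

text \<open>On the wall t d = v the two lifts differ by a group element. This element, extended to
  all of S so as not to depend on the coordinate d, corrects the second lift, which then matches the
  first on the wall. The hypothesis on S lets every point be moved to the wall within S.\<close>

lemma lifts_on_glue:
  assumes d: "d < m" and S: "\<And>t. t \<in> topspace (cube m) \<inter> S \<Longrightarrow> t(d := v) \<in> topspace (cube m) \<inter> S"
    and l1: "lifts_on m a {t \<in> S. t d \<le> v}" and l2: "lifts_on m a {t \<in> S. v \<le> t d}"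
  shows "lifts_on m a S"
proof -
  let ?X = "subtopology (cube m) S" and ?E = "total_space P"
  let ?L = "{t \<in> S. t d \<le> v}" and ?R = "{t \<in> S. v \<le> t d}"
  obtain l1 where l1: "continuous_map (subtopology (cube m) ?L) ?E l1"
      "\<And>t. t \<in> topspace (cube m) \<inter> ?L \<Longrightarrow> bundle_proj P (l1 t) = a t"
    using l1 unfolding lifts_on_def by blast
  obtain l2 where l2: "continuous_map (subtopology (cube m) ?R) ?E l2"
      "\<And>t. t \<in> topspace (cube m) \<inter> ?R \<Longrightarrow> bundle_proj P (l2 t) = a t"
    using l2 unfolding lifts_on_def by blast
  have upd: "continuous_map ?X (subtopology (cube m) (S \<inter> {t. t d = v})) (\<lambda>t. t(d := v))"
  proof (intro continuous_map_into_subtopology continuous_map_into_cube)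
    fix t assume "t \<in> topspace ?X"
    then show "t(d := v) \<in> topspace (cube m)"
      using S by auto
  next
    fix j assume "j < m"
    then show "continuous_map ?X euclideanreal (\<lambda>x. (x(d := v)) j)"
      by (cases "j = d") (auto intro: continuous_map_cube_coordinate)
  qed (use S in auto)
  let ?g = "\<lambda>t. translation (l2 (t(d := v))) (l1 (t(d := v)))"
  have cu: "continuous_map ?X ?E (\<lambda>t. l2 (t(d := v)))" "continuous_map ?X ?E (\<lambda>t. l1 (t(d := v)))"
    using continuous_map_compose [OF upd continuous_map_from_subtopology_mono [OF l2(1)]]
      continuous_map_compose [OF upd continuous_map_from_subtopology_mono [OF l1(1)]]
    by (auto simp: o_def)
  have g: "continuous_map ?X T ?g"
  proof (rule continuous_map_translation [OF cu])
    fix t assume "t \<in> topspace ?X"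
    then have "t(d := v) \<in> topspace (cube m) \<inter> ?R" "t(d := v) \<in> topspace (cube m) \<inter> ?L"
      using S by auto
    then show "bundle_proj P (l2 (t(d := v))) = bundle_proj P (l1 (t(d := v)))"
      by (simp only: l1(2) l2(2))
  qed
  let ?l = "\<lambda>t. if t d \<le> v then l1 t else bundle_act P (l2 t) (?g t)"
  have eqR: "subtopology ?X {t \<in> topspace ?X. v \<le> t d} = subtopology (cube m) ?R"
    and eqL: "subtopology ?X {t \<in> topspace ?X. t d \<le> v} = subtopology (cube m) ?L"
    by (simp_all only: subtopology_subtopology_Collect)
  have "continuous_map ?X ?E ?l"
  proof (rule continuous_map_cases_le)
    show "continuous_map ?X euclideanreal (\<lambda>t. t d)"
      by (rule continuous_map_cube_coordinate [OF d])
    show "continuous_map (subtopology ?X {t \<in> topspace ?X. t d \<le> v}) ?E l1"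
      unfolding eqL by (rule l1(1))
    show "continuous_map (subtopology ?X {t \<in> topspace ?X. v \<le> t d}) ?E (\<lambda>t. bundle_act P (l2 t) (?g t))"
      by (rule continuous_map_principal_act [OF l2(1) [folded eqR] continuous_map_from_subtopology [OF g]])
    fix t assume t: "t \<in> topspace ?X" "t d = v"
    then have "t(d := v) = t" and "t \<in> topspace (cube m) \<inter> ?R" "t \<in> topspace (cube m) \<inter> ?L"
      by auto
    moreover from this have "l1 t \<in> topspace ?E" "l2 t \<in> topspace ?E"
      using continuous_map_image_subset_topspace [OF l1(1)] continuous_map_image_subset_topspace [OF l2(1)]
      by auto
    ultimately show "l1 t = bundle_act P (l2 t) (?g t)"
      using l1(2) l2(2) by (simp add: translation(2))
  qed simp
  moreover have "bundle_proj P (?l t) = a t" if t: "t \<in> topspace (cube m) \<inter> S" for t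
  proof (cases "t d \<le> v")
    case True
    with t l1(2) show ?thesis
      by simp
  next
    case False
    with t have tR: "t \<in> topspace (cube m) \<inter> ?R"
      by auto
    moreover from tR have "l2 t \<in> topspace ?E"
      using continuous_map_image_subset_topspace [OF l2(1)] by auto
    moreover have "?g t \<in> carrier G"
      using continuous_map_image_subset_topspace [OF g] t principal_topspace by auto
    ultimately show ?thesis
      using False l2(2) [OF tR] by (simp add: principal_proj_act)
  qed
  ultimately show ?thesis
    unfolding lifts_on_def by blast
qed

lemma lifts_on_small_box:
  assumes a: "continuous_map (cube m) (base_space P) a" and x: "x \<in> topspace (cube m)"
  shows "\<exists>\<epsilon>>0. lifts_on m a {t. \<forall>j<m. \<bar>t j - x j\<bar> < \<epsilon>}"
proof -
  have b: "a x \<in> topspace (base_space P)"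
    using continuous_map_image_subset_topspace [OF a] x by blast
  obtain U \<sigma> \<gamma> where U: "a x \<in> U" and triv: "trivialization U \<sigma> \<gamma>"
    using principal_local_triviality [OF b] by blast
  have "openin (cube m) {t \<in> topspace (cube m). a t \<in> U}" (is "openin _ ?V")
    by (rule openin_continuous_map_preimage [OF a trivializationD(1) [OF triv]])
  moreover have "x \<in> ?V"
    using U x by simp
  ultimately have "\<exists>W. finite {i \<in> {..<m}. W i \<noteq> topspace (top_of_set {0..1})} \<and>
      (\<forall>i\<in>{..<m}. openin (top_of_set {0..1}) (W i)) \<and> x \<in> Pi\<^sub>E {..<m} W \<and> Pi\<^sub>E {..<m} W \<subseteq> ?V"
    by (simp only: cube_def openin_product_topology_alt)
  then obtain W where W: "\<And>j. j < m \<Longrightarrow> openin (top_of_set {0..1}) (W j)" "x \<in> Pi\<^sub>E {..<m} W"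
      "Pi\<^sub>E {..<m} W \<subseteq> {t \<in> topspace (cube m). a t \<in> U}"
    by (elim exE conjE) (use lessThan_iff in blast)
  have "\<exists>\<epsilon>>0. \<forall>s\<in>{0..1}. \<bar>s - x j\<bar> < \<epsilon> \<longrightarrow> s \<in> W j" if "j < m" for j
  proof -
    have "x j \<in> W j"
      using W(2) that by auto
    then show ?thesis
      using W(1) [OF that] unfolding openin_euclidean_subtopology_iff dist_real_def by blast
  qed
  then obtain \<epsilon> where \<epsilon>: "\<And>j. j < m \<Longrightarrow> \<epsilon> j > 0"
      "\<And>j s. j < m \<Longrightarrow> s \<in> {0..1} \<Longrightarrow> \<bar>s - x j\<bar> < \<epsilon> j \<Longrightarrow> s \<in> W j"
    by metis
  \<comment> \<open>The 1 keeps the minimum defined for m = 0.\<close>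
  define r where "r = Min (insert 1 (\<epsilon> ` {..<m}))"
  have r: "r > 0" "\<And>j. j < m \<Longrightarrow> r \<le> \<epsilon> j"
    using \<epsilon>(1) by (auto simp: r_def)
  let ?S = "{t. \<forall>j<m. \<bar>t j - x j\<bar> < r}"
  have S: "a t \<in> U" if "t \<in> topspace (cube m)" "t \<in> ?S" for t
  proof -
    have "t \<in> Pi\<^sub>E {..<m} W"
      using that r(2) \<epsilon>(2) unfolding topspace_cube PiE_iff by force
    with W(3) show ?thesis
      by blast
  qed
  have "continuous_map (subtopology (cube m) ?S) (subtopology (base_space P) U) a"
    using a S by (auto simp: continuous_map_in_subtopology continuous_map_from_subtopology)
  from continuous_map_compose [OF this trivializationD(2) [OF triv]]
  have "lifts_on m a ?S"
    unfolding lifts_on_def using S trivializationD(3) [OF triv] by (intro exI [of _ "\<sigma> \<circ> a"]) auto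
  with r(1) show ?thesis
    by blast
qed

text \<open>The boxes on which a lift exists are made as long as the cube in one direction after the other.\<close>

lemma lifts_on_long_box:
  assumes a: "continuous_map (cube m) (base_space P) a" and "d \<le> m" "x \<in> topspace (cube m)"
  shows "\<exists>\<epsilon>>0. lifts_on m a {t. \<forall>j<m. d \<le> j \<longrightarrow> \<bar>t j - x j\<bar> < \<epsilon>}"
  using assms(2,3)
proof (induction d arbitrary: x)
  case 0
  then show ?case
    using lifts_on_small_box [OF a] by simp
next
  case (Suc d)
  then have d: "d < m"
    by simp
  \<comment> \<open>A slab: coordinate d lies in [u, v], the coordinates above d are close to x, and
    those below are free in the cube.\<close>
  let ?B = "\<lambda>u v \<epsilon>. {t. (\<forall>j<m. Suc d \<le> j \<longrightarrow> \<bar>t j - x j\<bar> < \<epsilon>) \<and> u \<le> t d \<and> t d \<le> v}"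
  \<comment> \<open>Compactness of the interval in the form of Bolzano's principle: adjacent slabs
    are glued, and the induction hypothesis at \<open>x(d := s)\<close> covers the short intervals
    around s. The guards 0 \<le> u and v \<le> 1 keep the wall between two slabs inside the cube;
    \<epsilon> is part of the property, as it may shrink with each gluing.\<close>
  have "0 \<le> (0::real) \<longrightarrow> 1 \<le> (1::real) \<longrightarrow> (\<exists>\<epsilon>>0. lifts_on m a (?B 0 1 \<epsilon>))"
  proof (rule Bolzano [where P = "\<lambda>u v. 0 \<le> u \<longrightarrow> v \<le> 1 \<longrightarrow> (\<exists>\<epsilon>>0. lifts_on m a (?B u v \<epsilon>))"])
    fix u v w :: real
    assume uv: "0 \<le> u \<longrightarrow> v \<le> 1 \<longrightarrow> (\<exists>\<epsilon>>0. lifts_on m a (?B u v \<epsilon>))"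
      and vw: "0 \<le> v \<longrightarrow> w \<le> 1 \<longrightarrow> (\<exists>\<epsilon>>0. lifts_on m a (?B v w \<epsilon>))"
      and le: "u \<le> v" "v \<le> w"
    show "0 \<le> u \<longrightarrow> w \<le> 1 \<longrightarrow> (\<exists>\<epsilon>>0. lifts_on m a (?B u w \<epsilon>))"
    proof (intro impI)
      assume bounds: "0 \<le> u" "w \<le> 1"
      then obtain \<epsilon>1 \<epsilon>2 where \<epsilon>: "\<epsilon>1 > 0" "lifts_on m a (?B u v \<epsilon>1)" "\<epsilon>2 > 0" "lifts_on m a (?B v w \<epsilon>2)"
        using uv vw le by force
      let ?\<epsilon> = "min \<epsilon>1 \<epsilon>2"
      have "lifts_on m a (?B u w ?\<epsilon>)"
      proof (rule lifts_on_glue [OF d])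
        show "lifts_on m a {t \<in> ?B u w ?\<epsilon>. t d \<le> v}"
          by (rule lifts_on_subset [OF \<epsilon>(2)]) auto
        show "lifts_on m a {t \<in> ?B u w ?\<epsilon>. v \<le> t d}"
          by (rule lifts_on_subset [OF \<epsilon>(4)]) auto
        show "t(d := v) \<in> topspace (cube m) \<inter> ?B u w ?\<epsilon>" if "t \<in> topspace (cube m) \<inter> ?B u w ?\<epsilon>" for t
          using that d bounds le by (auto simp: topspace_cube PiE_iff extensional_def)
      qed
      moreover have "?\<epsilon> > 0"
        using \<epsilon> by simp
      ultimately show "\<exists>\<epsilon>>0. lifts_on m a (?B u w \<epsilon>)"
        by blast
    qed
  next
    fix s :: real assume s: "0 \<le> s" "s \<le> 1"
    then have xs: "x(d := s) \<in> topspace (cube m)"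
      using Suc.prems d by (auto simp: topspace_cube PiE_iff extensional_def)
    obtain \<epsilon> where \<epsilon>: "\<epsilon> > 0" "lifts_on m a {t. \<forall>j<m. d \<le> j \<longrightarrow> \<bar>t j - (x(d := s)) j\<bar> < \<epsilon>}"
      using Suc.IH [OF less_imp_le [OF d] xs] by blast
    have "lifts_on m a (?B u v \<epsilon>)" if "u \<le> s" "s \<le> v" "v - u < \<epsilon>" for u v
    proof (rule lifts_on_subset [OF \<epsilon>(2)], safe)
      fix t j assume "\<forall>j<m. Suc d \<le> j \<longrightarrow> \<bar>t j - x j\<bar> < \<epsilon>" "u \<le> t d" "t d \<le> v" "j < m" "d \<le> j"
      with that show "\<bar>t j - (x(d := s)) j\<bar> < \<epsilon>"
        by (cases "j = d") auto
    qed
    with \<epsilon>(1) show "\<exists>\<delta>>0. \<forall>u v. u \<le> s \<and> s \<le> v \<and> v - u < \<delta> \<longrightarrow>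
        0 \<le> u \<longrightarrow> v \<le> 1 \<longrightarrow> (\<exists>\<epsilon>>0. lifts_on m a (?B u v \<epsilon>))"
      by blast
  qed simp
  then obtain \<epsilon> where \<epsilon>: "\<epsilon> > 0" "lifts_on m a (?B 0 1 \<epsilon>)"
    by auto
  have "lifts_on m a {t. \<forall>j<m. Suc d \<le> j \<longrightarrow> \<bar>t j - x j\<bar> < \<epsilon>}"
    by (rule lifts_on_subset [OF \<epsilon>(2)]) (use d in \<open>auto simp: topspace_cube PiE_iff\<close>)
  with \<epsilon>(1) show ?case
    by blast
qed

lemma principal_cube_lift:
  assumes "continuous_map (cube m) (base_space P) a"
  shows "\<exists>l. continuous_map (cube m) (total_space P) l \<and> (\<forall>t\<in>topspace (cube m). bundle_proj P (l t) = a t)"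
proof -
  \<comment> \<open>Any centre will do: for d = m no coordinate is constrained.\<close>
  have "(\<lambda>j\<in>{..<m}. 0) \<in> topspace (cube m)"
    by (simp add: topspace_cube)
  then obtain \<epsilon> where "lifts_on m a {t. \<forall>j<m. m \<le> j \<longrightarrow> \<bar>t j - (\<lambda>j\<in>{..<m}. 0) j\<bar> < \<epsilon>}"
    using lifts_on_long_box [OF assms order_refl] by blast
  then have "lifts_on m a UNIV"
    by (rule lifts_on_subset) auto
  then show ?thesis
    by (simp add: lifts_on_def)
qed

end

section \<open>Existence of classifying maps\<close>

text \<open>Where \<open>\<mu> k\<close> is positive, the bundle is trivialized by
  \<open>\<gamma>\<close>: an equivariant map there is determined by its values where
  \<open>\<gamma>\<close> is the unit, and those may be deformed freely. So F is contracted to e0 on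
  these values while \<open>\<theta>\<close> falls from 1 to 0, and the result is carried along the
  orbits by the action. Where \<open>\<theta>\<close> is 0, the map no longer depends on F.\<close>

lemma equivariant_map_step:
  fixes P :: "('v, 'x, 'g) gbundle" and E :: "('e, 'b, 'g) gbundle"
  assumes P: "principal_bundle G T P" and E: "principal_bundle G T E"
    and contr: "contractible_space (total_space E)" "topspace (total_space E) \<noteq> {}"
    and A: "finite A"
    and \<mu>: "\<And>j. j \<in> insert k A \<Longrightarrow> continuous_map (total_space P) euclideanreal (\<mu> j)"
    and \<mu>_act: "\<And>j v g. j \<in> insert k A \<Longrightarrow> v \<in> topspace (total_space P) \<Longrightarrow> g \<in> carrier G \<Longrightarrow>
        \<mu> j (bundle_act P v g) = \<mu> j v"
    and \<gamma>: "continuous_map (subtopology (total_space P) {v. 0 < \<mu> k v}) T \<gamma>"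
    and \<gamma>_act: "\<And>v g. v \<in> topspace (total_space P) \<Longrightarrow> 0 < \<mu> k v \<Longrightarrow> g \<in> carrier G \<Longrightarrow>
        \<gamma> (bundle_act P v g) = \<gamma> v \<otimes>\<^bsub>G\<^esub> g"
    and c: "0 < c"
    and F: "continuous_map (subtopology (total_space P) {v. \<exists>j\<in>A. c / 2 < \<mu> j v}) (total_space E) F"
    and F_act: "\<And>v g. v \<in> topspace (total_space P) \<Longrightarrow> \<exists>j\<in>A. c / 2 < \<mu> j v \<Longrightarrow> g \<in> carrier G \<Longrightarrow>
        F (bundle_act P v g) = bundle_act E (F v) g"
  shows "\<exists>F. continuous_map (subtopology (total_space P) {v. \<exists>j\<in>insert k A. c < \<mu> j v}) (total_space E) F \<and>
     (\<forall>v\<in>topspace (total_space P). (\<exists>j\<in>insert k A. c < \<mu> j v) \<longrightarrow>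
        (\<forall>g\<in>carrier G. F (bundle_act P v g) = bundle_act E (F v) g))"
proof -
  interpret group G by (rule principal_group [OF P])
  let ?X = "total_space P" and ?Y = "total_space E"
  note TG = principal_topspace [OF P]
  obtain H e0 where H: "continuous_map (prod_topology (top_of_set {0..1::real}) ?Y) ?Y H"
    and e0: "e0 \<in> topspace ?Y" and H0: "\<And>x. H (0, x) = x" and H1: "\<And>x. H (1, x) = e0"
    using contractible_spaceE [OF contr] by metis
  \<comment> \<open>\<open>\<theta>\<close> is 1 where some \<open>\<mu> j\<close> exceeds c and 0
    where none exceeds 3/4 c. As F is available above c / 2, open overlaps remain between the three
    ways in which the new map is written. The invariance of the \<open>\<mu> j\<close> makes
    \<open>\<theta>\<close> invariant.\<close>
  define \<theta> where "\<theta> v = min 1 ((\<Sum>j\<in>A. max 0 (\<mu> j v - 3/4 * c)) / (c / 4))" for v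
  have \<theta>_range: "0 \<le> \<theta> v" "\<theta> v \<le> 1" for v
    using c by (auto simp: \<theta>_def intro!: divide_nonneg_pos sum_nonneg)
  have \<theta>1: "\<theta> v = 1" if v: "\<exists>j\<in>A. c < \<mu> j v" for v
  proof -
    obtain j where j: "j \<in> A" "c < \<mu> j v"
      using v by blast
    have "c / 4 \<le> max 0 (\<mu> j v - 3/4 * c)"
      using j by (intro max.coboundedI2) simp
    also have "\<dots> \<le> (\<Sum>j\<in>A. max 0 (\<mu> j v - 3/4 * c))"
      by (rule member_le_sum) (use A j in auto)
    finally show ?thesis
      using c by (simp add: \<theta>_def min_def)
  qed
  have \<theta>0: "\<theta> v = 0" if "\<forall>j\<in>A. \<mu> j v \<le> 3/4 * c" for v
    using that by (simp add: \<theta>_def)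
  have c\<theta>: "continuous_map ?X (top_of_set {0..1}) (\<lambda>v. 1 - \<theta> v)"
  proof (rule continuous_map_into_subtopology)
    show "continuous_map ?X euclideanreal (\<lambda>v. 1 - \<theta> v)"
      unfolding \<theta>_def using A \<mu> c
      by (intro continuous_map_diff continuous_map_real_min continuous_map_real_divide continuous_map_sum
          continuous_map_real_max) auto
  qed (use \<theta>_range in auto)
  have half: "\<exists>j\<in>A. c / 2 < \<mu> j v" if v: "\<exists>j\<in>A. c < \<mu> j v" for v
  proof -
    obtain j where "j \<in> A" "c < \<mu> j v"
      using v by blast
    with c have "c / 2 < \<mu> j v"
      by linarith
    with \<open>j \<in> A\<close> show ?thesis
      by blast
  qed
  let ?W = "{v. \<exists>j\<in>A. c / 2 < \<mu> j v}" and ?U = "{v. 0 < \<mu> k v}"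
  \<comment> \<open>\<open>?s v\<close> is the point of the orbit of v at which
    \<open>\<gamma>\<close> is the unit; it does not change when v is replaced by
    \<open>bundle_act P v g\<close>.\<close>
  let ?s = "\<lambda>v. bundle_act P v (inv\<^bsub>G\<^esub> (\<gamma> v))"
  let ?t = "\<lambda>v. bundle_act E (H (1 - \<theta> v, F (?s v))) (\<gamma> v)"
  let ?e = "\<lambda>v. bundle_act E e0 (\<gamma> v)"
  have \<gamma>_closed: "\<gamma> v \<in> carrier G" if "v \<in> topspace ?X" "v \<in> ?U" for v
    using continuous_map_image_subset_topspace [OF \<gamma>] that TG by auto
  have W_act: "bundle_act P v g \<in> ?W" if "v \<in> topspace ?X" "v \<in> ?W" "g \<in> carrier G" for v g
    using that \<mu>_act by auto
  have cs: "continuous_map (subtopology ?X (?W \<inter> ?U)) (subtopology ?X ?W) ?s"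
  proof (rule continuous_map_into_subtopology)
    have "continuous_map (subtopology ?X (?W \<inter> ?U)) T \<gamma>"
      by (rule continuous_map_from_subtopology_mono [OF \<gamma>]) auto
    from continuous_map_compose [OF this principal_inv [OF P]]
    show "continuous_map (subtopology ?X (?W \<inter> ?U)) ?X ?s"
      by (intro continuous_map_principal_act [OF P]) (simp_all add: continuous_map_from_subtopology o_def)
  qed (use W_act \<gamma>_closed in auto)
  have ct: "continuous_map (subtopology ?X (?W \<inter> ?U)) ?Y ?t"
  proof (rule continuous_map_principal_act [OF E])
    have "continuous_map (subtopology ?X (?W \<inter> ?U)) ?Y (\<lambda>v. F (?s v))"
      using continuous_map_compose [OF cs F] by (simp add: o_def)
    from continuous_map_compose [OF continuous_map_pairedI [OF continuous_map_from_subtopology [OF c\<theta>] this] H]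
    show "continuous_map (subtopology ?X (?W \<inter> ?U)) ?Y (\<lambda>v. H (1 - \<theta> v, F (?s v)))"
      by (simp add: o_def)
    show "continuous_map (subtopology ?X (?W \<inter> ?U)) T \<gamma>"
      by (rule continuous_map_from_subtopology_mono [OF \<gamma>]) auto
  qed
  have ce: "continuous_map (subtopology ?X ?U) ?Y ?e"
    by (rule continuous_map_principal_act [OF E _ \<gamma>]) (simp add: e0)
  have tF: "?t v = F v" if v: "v \<in> topspace ?X" "\<exists>j\<in>A. c < \<mu> j v" "v \<in> ?U" for v
  proof -
    have "v \<in> ?W"
      using half [OF v(2)] by simp
    then have s: "?s v \<in> topspace ?X" "\<exists>j\<in>A. c / 2 < \<mu> j (?s v)"
      using v \<gamma>_closed W_act [of v "inv\<^bsub>G\<^esub> (\<gamma> v)"] principal_act_closed [OF P] by auto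
    have "?t v = bundle_act E (F (?s v)) (\<gamma> v)"
      by (simp add: \<theta>1 [OF v(2)] H0)
    also have "\<dots> = F (bundle_act P (?s v) (\<gamma> v))"
      using F_act [OF s] \<gamma>_closed v by simp
    also have "bundle_act P (?s v) (\<gamma> v) = v"
      using v \<gamma>_closed [OF v(1,3)] by (simp add: principal_act_mult [OF P, symmetric] principal_act_one [OF P])
    finally show ?thesis .
  qed
  define F' where "F' v = (if \<exists>j\<in>A. c < \<mu> j v then F v else if v \<in> ?W then ?t v else ?e v)" for v
  let ?Z = "{v. \<exists>j\<in>insert k A. c < \<mu> j v}"
  have opj: "openin ?X {v \<in> topspace ?X. \<mu> j v \<in> S}" if "j \<in> insert k A" "open S" for j S
    by (rule openin_continuous_map_preimage [OF \<mu> [OF that(1)]]) (simp add: that(2))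
  have op: "openin ?X {v \<in> topspace ?X. \<exists>j\<in>B. a < \<mu> j v}" if "B \<subseteq> insert k A" for a and B
  proof -
    have "{v \<in> topspace ?X. \<exists>j\<in>B. a < \<mu> j v} = (\<Union>j\<in>B. {v \<in> topspace ?X. \<mu> j v \<in> {a<..}})"
      by auto
    also have "openin ?X \<dots>"
    proof (rule openin_Union)
      fix S assume "S \<in> (\<lambda>j. {v \<in> topspace ?X. \<mu> j v \<in> {a<..}}) ` B"
      then obtain j where "j \<in> B" and S: "S = {v \<in> topspace ?X. \<mu> j v \<in> {a<..}}"
        by (rule imageE)
      show "openin ?X S"
        unfolding S using that \<open>j \<in> B\<close> by (intro opj) auto
    qed
    finally show ?thesis .
  qed
  have "continuous_map (subtopology ?X ?Z) ?Y F'"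
  proof (rule continuous_map_openin_cover)
    fix v assume "v \<in> topspace (subtopology ?X ?Z)"
    then have v: "v \<in> topspace ?X" "v \<in> ?Z"
      by auto
    \<comment> \<open>On V1, V2 and V3 the new map is \<open>F\<close>, \<open>?t\<close> and
      \<open>?e\<close> respectively: \<open>?t\<close> equals F where some \<open>\<mu> j\<close>
      exceeds c, and it equals \<open>?e\<close> where \<open>\<theta>\<close> is 0, because H then
      ends at e0. The three sets cover \<open>?Z\<close>.\<close>
    define V1 where "V1 = {v \<in> topspace ?X. \<exists>j\<in>A. c < \<mu> j v}"
    define V2 where "V2 = {v \<in> topspace ?X. \<exists>j\<in>A. c / 2 < \<mu> j v} \<inter> {v \<in> topspace ?X. \<exists>j\<in>{k}. 0 < \<mu> j v}"
    \<comment> \<open>For A = {}, the start of the induction, the inner intersection is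
      \<open>UNIV\<close>; it is cut down to the space.\<close>
    define V3 where "V3 = (topspace ?X \<inter> (\<Inter>j\<in>A. {v \<in> topspace ?X. \<mu> j v \<in> {..<3/4 * c}})) \<inter> {v \<in> topspace ?X. \<exists>j\<in>{k}. 0 < \<mu> j v}"
    have "openin ?X V1" "openin ?X V2"
      unfolding V1_def V2_def by (intro op openin_Int; blast)+
    moreover have "openin ?X V3"
    proof -
      have "openin ?X (topspace ?X \<inter> (\<Inter>j\<in>A. {v \<in> topspace ?X. \<mu> j v \<in> {..<3/4 * c}}))"
      proof (cases "A = {}")
        case False
        then have "openin ?X (\<Inter>j\<in>A. {v \<in> topspace ?X. \<mu> j v \<in> {..<3/4 * c}})"
          using A opj by (intro openin_Inter) (auto simp del: lessThan_iff)
        then show ?thesis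
          by blast
      qed simp
      then show ?thesis
        unfolding V3_def by (rule openin_Int) (rule op, simp)
    qed
    moreover have "continuous_map (subtopology ?X V1) ?Y F'"
      by (rule continuous_map_eq [OF continuous_map_from_subtopology_mono [OF F]])
        (use half in \<open>simp_all add: V1_def F'_def subset_iff\<close>)
    moreover have "continuous_map (subtopology ?X V2) ?Y F'"
      by (rule continuous_map_eq [OF continuous_map_from_subtopology_mono [OF ct]])
        (use tF in \<open>auto simp: V2_def F'_def\<close>)
    moreover have "F' w = ?e w" if "w \<in> V3" for w
    proof -
      have "\<theta> w = 0"
        using that by (intro \<theta>0) (auto simp: V3_def intro: less_imp_le)
      moreover have "\<not> (\<exists>j\<in>A. c < \<mu> j w)"
        using that c by (force simp: V3_def)
      ultimately show ?thesis
        by (simp add: F'_def H1)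
    qed
    then have "continuous_map (subtopology ?X V3) ?Y F'"
      by (intro continuous_map_eq [OF continuous_map_from_subtopology_mono [OF ce]]) (auto simp: V3_def)
    moreover have "v \<in> V1 \<or> v \<in> V2 \<or> v \<in> V3"
    proof (cases "v \<in> V1")
      case False
      then have k: "0 < \<mu> k v"
        using v c by (auto simp: V1_def)
      show ?thesis
      proof (cases "\<exists>j\<in>A. c / 2 < \<mu> j v")
        case False
        then have "\<forall>j\<in>A. \<mu> j v < 3/4 * c"
          using c by (force simp: not_less)
        then show ?thesis
          using k v by (auto simp: V3_def)
      qed (use k v in \<open>auto simp: V2_def\<close>)
    qed simp
    ultimately obtain V where V: "openin ?X V" "v \<in> V" "continuous_map (subtopology ?X V) ?Y F'"
      by blast
    then show "\<exists>U. openin (subtopology ?X ?Z) U \<and> v \<in> U \<and>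
        continuous_map (subtopology (subtopology ?X ?Z) U) ?Y F'"
      using v by (intro exI [of _ "?Z \<inter> V"])
        (auto simp: subtopology_subtopology intro: openin_subtopology_Int2 continuous_map_from_subtopology_mono)
  qed
  moreover have "F' (bundle_act P v g) = bundle_act E (F' v) g"
    if v: "v \<in> topspace ?X" "v \<in> ?Z" and g: "g \<in> carrier G" for v g
  proof -
    have \<mu>g: "\<mu> j (bundle_act P v g) = \<mu> j v" if "j \<in> insert k A" for j
      using \<mu>_act that v g by blast
    then have \<theta>g: "\<theta> (bundle_act P v g) = \<theta> v"
      by (simp add: \<theta>_def)
    show ?thesis
    proof (cases "\<exists>j\<in>A. c < \<mu> j v")
      case True
      note half [OF this]
      with True show ?thesis
        using F_act v g by (simp add: F'_def \<mu>g)
    next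
      case False
      then have k: "0 < \<mu> k v"
        using v c by auto
      note [simp] = \<gamma>_act [OF v(1) k g]
      have \<gamma>v: "\<gamma> v \<in> carrier G"
        using \<gamma>_closed v k by simp
      have sg: "?s (bundle_act P v g) = ?s v"
        using v g \<gamma>v by (simp add: principal_act_mult [OF P, symmetric] inv_mult_group m_assoc [symmetric])
      have "?t (bundle_act P v g) = bundle_act E (?t v) g" if W: "v \<in> ?W"
      proof -
        have "?s v \<in> topspace (subtopology ?X ?W)"
          using W_act [OF v(1) W] principal_act_closed [OF P v(1)] \<gamma>v by simp
        then have "F (?s v) \<in> topspace ?Y"
          using continuous_map_image_subset_topspace [OF F] by blast
        then have "H (1 - \<theta> v, F (?s v)) \<in> topspace ?Y"
          using continuous_map_image_subset_topspace [OF H] \<theta>_range [of v] by auto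
        then show ?thesis
          unfolding sg \<theta>g using g \<gamma>v by (simp add: principal_act_mult [OF E])
      qed
      moreover have "?e (bundle_act P v g) = bundle_act E (?e v) g"
        using e0 g \<gamma>v by (simp add: principal_act_mult [OF E])
      ultimately show ?thesis
        using False by (simp add: F'_def \<mu>g)
    qed
  qed
  ultimately show ?thesis
    by blast
qed

text \<open>The threshold c is generalized in the induction over A, since the step to c starts from
  a map for c / 2.\<close>

lemma equivariant_map_exists:
  fixes P :: "('v, 'x, 'g) gbundle" and E :: "('e, 'b, 'g) gbundle"
  assumes P: "principal_bundle G T P" and E: "universal_principal_bundle G T E"
    and A: "finite A"
    and \<mu>: "\<And>j. j \<in> A \<Longrightarrow> continuous_map (total_space P) euclideanreal (\<mu> j)"
    and \<mu>_act: "\<And>j v g. j \<in> A \<Longrightarrow> v \<in> topspace (total_space P) \<Longrightarrow> g \<in> carrier G \<Longrightarrow>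
        \<mu> j (bundle_act P v g) = \<mu> j v"
    and \<gamma>: "\<And>j. j \<in> A \<Longrightarrow> continuous_map (subtopology (total_space P) {v. 0 < \<mu> j v}) T (\<gamma> j)"
    and \<gamma>_act: "\<And>j v g. j \<in> A \<Longrightarrow> v \<in> topspace (total_space P) \<Longrightarrow> 0 < \<mu> j v \<Longrightarrow> g \<in> carrier G \<Longrightarrow>
        \<gamma> j (bundle_act P v g) = \<gamma> j v \<otimes>\<^bsub>G\<^esub> g"
    and c: "0 < c"
  shows "\<exists>F. continuous_map (subtopology (total_space P) {v. \<exists>j\<in>A. c < \<mu> j v}) (total_space E) F \<and>
     (\<forall>v\<in>topspace (total_space P). (\<exists>j\<in>A. c < \<mu> j v) \<longrightarrow>
        (\<forall>g\<in>carrier G. F (bundle_act P v g) = bundle_act E (F v) g))"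
  using A \<mu> \<mu>_act \<gamma> \<gamma>_act c
proof (induction A arbitrary: c rule: finite_induct)
  case empty
  then show ?case
    by (simp add: continuous_map_on_empty2)
next
  case (insert k A)
  have E': "principal_bundle G T E" "contractible_space (total_space E)" "topspace (total_space E) \<noteq> {}"
    using E by (simp_all add: universal_principal_bundle_def)
  have "0 < c / 2"
    using insert.prems by simp
  have "\<exists>F. continuous_map (subtopology (total_space P) {v. \<exists>j\<in>A. c / 2 < \<mu> j v}) (total_space E) F \<and>
      (\<forall>v\<in>topspace (total_space P). (\<exists>j\<in>A. c / 2 < \<mu> j v) \<longrightarrow>
        (\<forall>g\<in>carrier G. F (bundle_act P v g) = bundle_act E (F v) g))"
    by (rule insert.IH) (rule insert.prems \<open>0 < c / 2\<close>; simp)+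
  then obtain F where F: "continuous_map (subtopology (total_space P) {v. \<exists>j\<in>A. c / 2 < \<mu> j v}) (total_space E) F"
      "\<forall>v\<in>topspace (total_space P). (\<exists>j\<in>A. c / 2 < \<mu> j v) \<longrightarrow>
        (\<forall>g\<in>carrier G. F (bundle_act P v g) = bundle_act E (F v) g)"
    by (elim exE conjE)
  show ?case
    by (rule equivariant_map_step [OF P E' insert.hyps(1) insert.prems(1,2)
          insert.prems(3) [OF insertI1] insert.prems(4) [OF insertI1] insert.prems(5) F(1)])
      (use F(2) in blast)+
qed

text \<open>F sends fibres to fibres and so induces f; the isomorphism with the pullback is v
  \<mapsto> (q v, F v). Its inverse at (x, e) takes any v over x and moves it by the element that
  carries F v to e; it is continuous because local sections and the translation are.\<close>

lemma classified_byI: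
  fixes P :: "('v, 'x, 'g) gbundle" and E :: "('e, 'b, 'g) gbundle"
  assumes P: "principal_bundle G T P" and E: "principal_bundle G T E"
    and F: "continuous_map (total_space P) (total_space E) F"
    and F_act: "\<And>v g. v \<in> topspace (total_space P) \<Longrightarrow> g \<in> carrier G \<Longrightarrow>
        F (bundle_act P v g) = bundle_act E (F v) g"
  shows "\<exists>f. classified_by G P E f"
proof -
  interpret group G by (rule principal_group [OF P])
  let ?X = "total_space P" and ?Y = "total_space E" and ?q = "bundle_proj P" and ?p = "bundle_proj E"
  have F_closed: "F v \<in> topspace ?Y" if "v \<in> topspace ?X" for v
    using continuous_map_image_subset_topspace [OF F] that by blast
  have F_trans: "F v' = bundle_act E (F v) (translation G P v v')"
    if "v \<in> topspace ?X" "v' \<in> topspace ?X" "?q v = ?q v'" for v v'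
    using F_act [OF that(1) translation(1) [OF P that]] translation(2) [OF P that] by simp
  define f where "f x = ?p (F (SOME v. v \<in> topspace ?X \<and> ?q v = x))" for x
  have f: "f (?q v) = ?p (F v)" if v: "v \<in> topspace ?X" for v
  proof -
    define w where "w = (SOME w. w \<in> topspace ?X \<and> ?q w = ?q v)"
    have w: "w \<in> topspace ?X \<and> ?q w = ?q v"
      unfolding w_def by (rule someI [of _ v]) (simp add: v)
    then show ?thesis
      using F_trans [of v w] v by (simp add: f_def w_def [symmetric] F_closed
          principal_proj_act [OF E] translation(1) [OF P])
  qed
  have cf: "continuous_map (base_space P) (base_space E) f"
  proof (rule continuous_map_openin_cover)
    fix b assume "b \<in> topspace (base_space P)"
    then obtain U \<sigma> \<gamma> where U: "b \<in> U" and triv: "trivialization G T P U \<sigma> \<gamma>"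
      using principal_local_triviality [OF P] by blast
    note \<sigma> = trivializationD(2) [OF P triv]
    have "continuous_map (subtopology (base_space P) U) (base_space E) (\<lambda>u. ?p (F (\<sigma> u)))"
      using continuous_map_compose [OF continuous_map_compose [OF \<sigma> F] principal_proj [OF E]]
      by (simp add: o_def)
    moreover have "?p (F (\<sigma> u)) = f u" if "u \<in> topspace (subtopology (base_space P) U)" for u
    proof -
      have "\<sigma> u \<in> topspace ?X"
        using continuous_map_image_subset_topspace [OF \<sigma>] that by blast
      from f [OF this] show ?thesis
        using trivializationD(3) [OF P triv] that by simp
    qed
    ultimately have "continuous_map (subtopology (base_space P) U) (base_space E) f"
      by (rule continuous_map_eq)
    with U trivializationD(1) [OF P triv]
    show "\<exists>U. openin (base_space P) U \<and> b \<in> U \<and> continuous_map (subtopology (base_space P) U) (base_space E) f"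
      by blast
  qed
  let ?Q = "subtopology (prod_topology (base_space P) ?Y) {(x, e). f x = ?p e}"
  \<comment> \<open>A description independent of choices: \<open>\<psi>\<close> can be computed from
    whichever point v over x is at hand, in particular from the local sections used for
    continuity.\<close>
  define \<psi> where "\<psi> = (\<lambda>(x, e). THE v. v \<in> topspace ?X \<and> ?q v = x \<and> F v = e)"
  have \<psi>: "\<psi> (?q v, e) = bundle_act P v (translation G E (F v) e) \<and>
      bundle_act P v (translation G E (F v) e) \<in> topspace ?X \<and>
      ?q (bundle_act P v (translation G E (F v) e)) = ?q v \<and>
      F (bundle_act P v (translation G E (F v) e)) = e"
    if v: "v \<in> topspace ?X" and e: "e \<in> topspace ?Y" "f (?q v) = ?p e" for v e
  proof -
    let ?g = "translation G E (F v) e"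
    have pe: "?p (F v) = ?p e"
      using f [OF v] e by simp
    note g = translation [OF E F_closed [OF v] e(1) pe]
    have w: "bundle_act P v ?g \<in> topspace ?X \<and> ?q (bundle_act P v ?g) = ?q v \<and> F (bundle_act P v ?g) = e"
      using v g by (simp add: principal_act_closed [OF P] principal_proj_act [OF P] F_act)
    moreover have "w = bundle_act P v ?g" if w: "w \<in> topspace ?X \<and> ?q w = ?q v \<and> F w = e" for w
    proof -
      have vw: "v \<in> topspace ?X" "w \<in> topspace ?X" "?q v = ?q w"
        using v w by auto
      note h = translation [OF P vw]
      have "bundle_act E (F v) (translation G P v w) = e"
        using F_trans [OF vw] w by simp
      then have "translation G P v w = ?g"
        using translation_eqI [OF E F_closed [OF v] h(1)] by simp
      then show ?thesis
        using h(2) by simp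
    qed
    ultimately have "\<psi> (?q v, e) = bundle_act P v ?g"
      unfolding \<psi>_def prod.case by (rule the_equality)
    with w show ?thesis
      by simp
  qed
  have surj: "\<exists>v\<in>topspace ?X. ?q v = x" if x: "x \<in> topspace (base_space P)" for x
  proof -
    obtain U \<sigma> \<gamma> where U: "x \<in> U" and triv: "trivialization G T P U \<sigma> \<gamma>"
      using principal_local_triviality [OF P x] by blast
    have "\<sigma> x \<in> topspace ?X"
      using continuous_map_image_subset_topspace [OF trivializationD(2) [OF P triv]] x U by auto
    then show ?thesis
      using trivializationD(3) [OF P triv U] by blast
  qed
  have "homeomorphic_maps ?X ?Q (\<lambda>v. (?q v, F v)) \<psi>"
    unfolding homeomorphic_maps_def
  proof (intro conjI ballI)
    show "continuous_map ?X ?Q (\<lambda>v. (?q v, F v))"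
      using f by (intro continuous_map_into_subtopology continuous_map_pairedI F principal_proj [OF P]) auto
    show "\<psi> (?q v, F v) = v" if "v \<in> topspace ?X" for v
      using \<psi> [OF that F_closed [OF that] f [OF that]] translation_eqI [OF E F_closed [OF that] one_closed] that
      by (simp add: principal_act_one [OF P] principal_act_one [OF E] F_closed)
    show "(?q (\<psi> y), F (\<psi> y)) = y" if y: "y \<in> topspace ?Q" for y
    proof -
      obtain x e where xe: "y = (x, e)" "x \<in> topspace (base_space P)" "e \<in> topspace ?Y" "f x = ?p e"
        using y by auto
      obtain v where v: "v \<in> topspace ?X" "?q v = x"
        using surj [OF xe(2)] by blast
      show ?thesis
        using \<psi> [OF v(1) xe(3)] v xe by simp
    qed
    show "continuous_map ?Q ?X \<psi>"
    proof (rule continuous_map_openin_cover)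
      fix y assume y: "y \<in> topspace ?Q"
      then have "fst y \<in> topspace (base_space P)"
        by auto
      then obtain U \<sigma> \<gamma> where U: "fst y \<in> U" and triv: "trivialization G T P U \<sigma> \<gamma>"
        using principal_local_triviality [OF P] by blast
      note \<sigma> = trivializationD(2) [OF P triv]
      define V where "V = {z \<in> topspace ?Q. fst z \<in> U}"
      have cfst: "continuous_map ?Q (base_space P) fst" and csnd: "continuous_map ?Q ?Y snd"
        by (simp_all add: continuous_map_from_subtopology continuous_map_fst continuous_map_snd)
      have V: "openin ?Q V"
        unfolding V_def by (rule openin_continuous_map_preimage [OF cfst trivializationD(1) [OF P triv]])
      have "continuous_map (subtopology ?Q V) (subtopology (base_space P) U) fst"
        by (rule continuous_map_into_subtopology [OF continuous_map_from_subtopology [OF cfst]]) (auto simp: V_def)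
      from continuous_map_compose [OF this \<sigma>]
      have c\<sigma>: "continuous_map (subtopology ?Q V) ?X (\<lambda>z. \<sigma> (fst z))"
        by (simp add: o_def)
      have cF: "continuous_map (subtopology ?Q V) ?Y (\<lambda>z. F (\<sigma> (fst z)))"
        using continuous_map_compose [OF c\<sigma> F] by (simp add: o_def)
      have z: "\<sigma> (fst z) \<in> topspace ?X" "?q (\<sigma> (fst z)) = fst z" "snd z \<in> topspace ?Y"
        "f (fst z) = ?p (snd z)" if "z \<in> topspace (subtopology ?Q V)" for z
        using continuous_map_image_subset_topspace [OF c\<sigma>] that trivializationD(3) [OF P triv]
        by (auto simp: V_def)
      have "continuous_map (subtopology ?Q V) T (\<lambda>z. translation G E (F (\<sigma> (fst z))) (snd z))"
      proof (rule continuous_map_translation [OF E cF continuous_map_from_subtopology [OF csnd]])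
        fix z assume "z \<in> topspace (subtopology ?Q V)"
        note z = z [OF this]
        show "?p (F (\<sigma> (fst z))) = ?p (snd z)"
          using f [OF z(1)] z by simp
      qed
      from continuous_map_principal_act [OF P c\<sigma> this]
      have "continuous_map (subtopology ?Q V) ?X \<psi>"
      proof (rule continuous_map_eq)
        fix w assume "w \<in> topspace (subtopology ?Q V)"
        note z = z [OF this]
        show "bundle_act P (\<sigma> (fst w)) (translation G E (F (\<sigma> (fst w))) (snd w)) = \<psi> w"
          using \<psi> [OF z(1) z(3)] z(2,4) by simp
      qed
      with V y U show "\<exists>U. openin ?Q U \<and> y \<in> U \<and> continuous_map (subtopology ?Q U) ?X \<psi>"
        by (intro exI [of _ V]) (simp add: V_def)
    qed
  qed
  then have "homeomorphic_map ?X ?Q (\<lambda>v. (?q v, F v))"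
    using homeomorphic_map_maps by blast
  then have "principal_bundle_isomorphic G P (bundle_pullback (base_space P) f E)"
    unfolding principal_bundle_isomorphic_def bundle_pullback_def
    by (auto intro!: exI [of _ "\<lambda>v. (?q v, F v)"] simp: principal_proj_act [OF P] F_act)
  with cf show ?thesis
    unfolding classified_by_def by blast
qed

section \<open>Frames and the general linear group\<close>

lemma norm_vector_scalar_mult:
  fixes x :: "'a::real_normed_field ^ 'k"
  shows "norm (c *s x) = norm c * norm x"
  by (simp add: norm_vec_def norm_mult L2_set_right_distrib)

text \<open>The matrix whose columns are the vectors \<open>v $ i\<close>. Frames become injective
  matrices, spans become ranges, and the right action of \<open>GL\<close> becomes matrix
  multiplication on the right.\<close>

definition coordinate_map :: "'a::field ^ 'k ^ 'n \<Rightarrow> 'a ^ 'n ^ 'k" where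
  "coordinate_map v = (\<chi> r i. v $ i $ r)"

lemma coordinate_map_mult: "coordinate_map v *v c = (\<Sum>j\<in>UNIV. c $ j *s v $ j)"
  by (simp add: coordinate_map_def vec_eq_iff matrix_vector_mult_def mult.commute)

lemma stiefel_iff_inj: "v \<in> stiefel \<longleftrightarrow> inj ((*v) (coordinate_map v))"
  for v :: "'a::field ^ 'k ^ 'n"
proof -
  have "v \<in> stiefel \<longleftrightarrow> (\<forall>c. coordinate_map v *v c = 0 \<longrightarrow> c = 0)"
  proof
    assume v: "v \<in> stiefel"
    show "\<forall>c. coordinate_map v *v c = 0 \<longrightarrow> c = 0"
      using v unfolding stiefel_def coordinate_map_mult by (force simp: vec_eq_iff)
  next
    assume inj: "\<forall>c. coordinate_map v *v c = 0 \<longrightarrow> c = 0"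
    show "v \<in> stiefel"
      unfolding stiefel_def
    proof (intro CollectI allI impI)
      fix c :: "'n \<Rightarrow> 'a" and j
      assume "(\<Sum>j\<in>UNIV. c j *s v $ j) = 0"
      then have "coordinate_map v *v (\<chi> j. c j) = 0"
        by (simp add: coordinate_map_mult)
      with inj have "(\<chi> j. c j) = 0"
        by blast
      then show "c j = 0"
        by (simp add: vec_eq_iff)
    qed
  qed
  also have "\<dots> \<longleftrightarrow> inj ((*v) (coordinate_map v))"
  proof (intro iffI allI impI injI)
    fix c d assume "\<forall>c. coordinate_map v *v c = 0 \<longrightarrow> c = 0" "coordinate_map v *v c = coordinate_map v *v d"
    moreover from this have "coordinate_map v *v (c - d) = 0"
      by (simp add: matrix_vector_mult_diff_distrib)
    ultimately have "c - d = 0"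
      by blast
    then show "c = d"
      by simp
  next
    fix c assume "inj ((*v) (coordinate_map v))" "coordinate_map v *v c = 0"
    then show "c = 0"
      by (metis injD matrix_vector_mult_0_right)
  qed
  finally show ?thesis .
qed

lemma span_range_vec: "vec.span (range (($) v)) = range ((*v) (coordinate_map v))"
  for v :: "'a::field ^ 'k ^ 'n"
proof
  have "v $ i = coordinate_map v *v axis i 1" for i
    by (simp add: matrix_vector_mult_def axis_def coordinate_map_def vec_eq_iff if_distrib cong: if_cong)
  then show "vec.span (range (($) v)) \<subseteq> range ((*v) (coordinate_map v))"
    by (intro vec.span_minimal vec.linear_subspace_image [OF matrix_vector_mul_linear_gen] vec.subspace_UNIV) auto
  show "range ((*v) (coordinate_map v)) \<subseteq> vec.span (range (($) v))"
    unfolding coordinate_map_mult by (intro image_subsetI vec.span_sum vec.span_scale vec.span_base rangeI)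
qed

lemma dim_span_stiefel:
  fixes v :: "'a::field ^ 'k ^ 'n"
  assumes "v \<in> stiefel"
  shows "vec.dim (vec.span (range (($) v))) = CARD('n)"
proof -
  have "vec.dim (range ((*v) (coordinate_map v))) = vec.dim (UNIV :: ('a ^ 'n) set)"
    using assms stiefel_iff_inj by (intro vec.dim_image_eq [OF matrix_vector_mul_linear_gen]) (auto simp: inj_def inj_on_def)
  then show ?thesis
    unfolding span_range_vec vec_dim_card .
qed

lemma grassmannian_span: "v \<in> stiefel \<Longrightarrow> vec.span (range (($) v)) \<in> grassmannian CARD('n)"
  for v :: "'a::field ^ 'k ^ 'n"
  using dim_span_stiefel [of v] by (simp add: grassmannian_def)

lemma span_eq_if_stiefel_in_grassmannian:
  fixes v :: "'a::field ^ 'k ^ 'n"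
  assumes "v \<in> stiefel" "S \<in> grassmannian CARD('n)" "\<And>i. v $ i \<in> S"
  shows "vec.span (range (($) v)) = S"
proof (rule vec.subspace_dim_equal)
  show "vec.span (range (($) v)) \<subseteq> S"
    using assms by (intro vec.span_minimal) (auto simp: grassmannian_def)
qed (use assms dim_span_stiefel [OF assms(1)] in \<open>auto simp: grassmannian_def\<close>)

lemma grassmannian_stiefelE:
  fixes S :: "('a::field ^ 'k) set"
  assumes "S \<in> grassmannian CARD('n)"
  obtains v :: "'a ^ 'k ^ 'n" where "v \<in> stiefel" "vec.span (range (($) v)) = S"
proof -
  have S: "vec.subspace S" "vec.dim S = CARD('n)"
    using assms by (auto simp: grassmannian_def)
  obtain B where B: "B \<subseteq> S" "vec.independent B" "S \<subseteq> vec.span B" "card B = CARD('n)"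
    using vec.basis_exists [of S] S(2) by metis
  then have "finite B"
    by (metis card.infinite zero_less_card_finite less_irrefl)
  then obtain b :: "'n \<Rightarrow> 'a ^ 'k" where b: "bij_betw b UNIV B"
    using B(4) finite_same_card_bij [of "UNIV :: 'n set" B] by auto
  define v where "v = (\<chi> i. b i)"
  have "c i = 0" if c: "(\<Sum>j\<in>UNIV. c j *s v $ j) = 0" for c :: "'n \<Rightarrow> 'a" and i
  proof (rule ccontr)
    assume "c i \<noteq> 0"
    have inv: "inv_into UNIV b (b j) = j" for j
      using b by (simp add: bij_betw_def)
    have "(\<Sum>x\<in>B. c (inv_into UNIV b x) *s x) = (\<Sum>j\<in>UNIV. c (inv_into UNIV b (b j)) *s b j)"
      by (rule sum.reindex_bij_betw [OF b, symmetric])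
    also have "\<dots> = 0"
      using c by (simp add: inv v_def)
    finally have "(\<Sum>x\<in>B. c (inv_into UNIV b x) *s x) = 0" .
    moreover have "\<not> ((\<exists>x\<in>B. c (inv_into UNIV b x) \<noteq> 0) \<and> (\<Sum>x\<in>B. c (inv_into UNIV b x) *s x) = 0)"
      using B(2) unfolding vec.dependent_finite [OF \<open>finite B\<close>] not_ex by (rule spec)
    moreover have "b i \<in> B"
      using b by (auto simp: bij_betw_def)
    ultimately have "c (inv_into UNIV b (b i)) = 0"
      by blast
    with \<open>c i \<noteq> 0\<close> show False
      by (simp add: inv)
  qed
  then have v: "v \<in> stiefel"
    by (simp add: stiefel_def)
  moreover have "vec.span (range (($) v)) = S"
    using b B(1) by (intro span_eq_if_stiefel_in_grassmannian [OF v assms]) (auto simp: v_def bij_betw_def)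
  ultimately show thesis
    by (rule that)
qed

text \<open>
  The square matrix of the coordinates \<open>J l\<close> of the vectors \<open>v $ i\<close>. It is transposed so that the
  right action of \<open>GL\<close> on \<open>v\<close> becomes right multiplication.
\<close>

definition minor :: "('n \<Rightarrow> 'k) \<Rightarrow> 'a::field ^ 'k ^ 'n \<Rightarrow> 'a ^ 'n ^ 'n" where
  "minor J v = (\<chi> l i. v $ i $ J l)"

definition GL_act :: "'a::field ^ 'k ^ 'n \<Rightarrow> 'a ^ 'n ^ 'n \<Rightarrow> 'a ^ 'k ^ 'n" where
  "GL_act v g = (\<chi> i. \<Sum>j\<in>UNIV. g $ j $ i *s v $ j)"

lemma minor_act: "minor J (GL_act v g) = minor J v ** g"
  by (simp add: minor_def GL_act_def vec_eq_iff matrix_matrix_mult_def mult.commute)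

lemma coordinate_map_act: "coordinate_map (GL_act v g) = coordinate_map v ** g"
  by (simp add: coordinate_map_def GL_act_def vec_eq_iff matrix_matrix_mult_def mult.commute)

lemma coordinate_map_inject: "coordinate_map v = coordinate_map w \<longleftrightarrow> v = w"
  by (auto simp: coordinate_map_def vec_eq_iff)

lemma GL_act_mult: "GL_act v (g ** h) = GL_act (GL_act v g) h"
  and GL_act_one: "GL_act v (mat 1) = v"
  by (simp_all add: coordinate_map_act matrix_mul_assoc flip: coordinate_map_inject)

lemma stiefel_if_det_minor:
  assumes "det (minor J v) \<noteq> 0"
  shows "v \<in> stiefel"
  unfolding stiefel_iff_inj
proof (rule injI)
  fix c d assume eq: "coordinate_map v *v c = coordinate_map v *v d"
  have "minor J v *v c = (\<chi> l. (coordinate_map v *v c) $ J l)" for c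
    by (simp add: minor_def coordinate_map_def matrix_vector_mult_def vec_eq_iff)
  with eq have "minor J v *v c = minor J v *v d"
    by simp
  moreover have "\<exists>B. B ** minor J v = mat 1"
    using assms by (simp add: invertible_left_inverse flip: invertible_det_nz)
  ultimately show "c = d"
    by (metis matrix_vector_mul_assoc matrix_vector_mul_lid)
qed

text \<open>Row rank equals column rank: a matrix with a left inverse has rows that span the whole
  space, and n of them that form a basis make up an invertible minor. J ranges over all functions, a
  finite type, rather than over increasing selections.\<close>

lemma stiefel_det_minor:
  fixes v :: "'a::field ^ 'k ^ 'n"
  assumes "v \<in> stiefel"
  obtains J where "det (minor J v) \<noteq> 0"
proof -
  have "column i (coordinate_map v) = v $ i" for i
    by (simp add: column_def coordinate_map_def vec_eq_iff)
  then have "\<exists>B. B ** coordinate_map v = mat 1"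
    using assms by (simp add: matrix_left_invertible_independent_columns stiefel_def)
  then have span: "vec.span (rows (coordinate_map v)) = UNIV"
    by (simp add: matrix_left_invertible_span_rows_gen)
  obtain B where B: "B \<subseteq> rows (coordinate_map v)" "vec.independent B" "rows (coordinate_map v) \<subseteq> vec.span B"
    using vec.maximal_independent_subset by blast
  have UB: "vec.span B = UNIV"
    using span vec.span_minimal [OF B(3) vec.subspace_span] by blast
  have "card B = CARD('n)"
    using vec.dim_span_eq_card_independent [OF B(2)] unfolding UB vec_dim_card by simp
  moreover from this have "finite B"
    by (metis card.infinite zero_less_card_finite less_irrefl)
  ultimately obtain b :: "'n \<Rightarrow> 'a ^ 'n" where b: "bij_betw b UNIV B"
    using finite_same_card_bij [of "UNIV :: 'n set" B] by auto
  have "\<exists>r. b l = row r (coordinate_map v)" for l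
    using b B(1) by (auto simp: bij_betw_def rows_def)
  then obtain J where J: "\<And>l. b l = row (J l) (coordinate_map v)"
    by metis
  have "row l (minor J v) = b l" for l
    unfolding J by (simp add: row_def minor_def coordinate_map_def)
  then have "rows (minor J v) = B"
    using b by (auto simp: rows_def bij_betw_def)
  then have "\<exists>C. C ** minor J v = mat 1"
    by (simp add: matrix_left_invertible_span_rows_gen UB)
  then have "det (minor J v) \<noteq> 0"
    by (simp add: invertible_left_inverse flip: invertible_det_nz)
  then show thesis
    by (rule that)
qed

lemma stiefel_act:
  assumes v: "v \<in> stiefel" and g: "invertible g"
  shows "GL_act v g \<in> stiefel" "vec.span (range (($) (GL_act v g))) = vec.span (range (($) v))"
proof -
  obtain J where "det (minor J v) \<noteq> 0"
    using stiefel_det_minor [OF v] .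
  then show "GL_act v g \<in> stiefel"
    using g by (intro stiefel_if_det_minor [of J]) (simp add: minor_act det_mul invertible_det_nz)
  then show "vec.span (range (($) (GL_act v g))) = vec.span (range (($) v))"
  proof (rule span_eq_if_stiefel_in_grassmannian [OF _ grassmannian_span [OF v]])
    show "GL_act v g $ i \<in> vec.span (range (($) v))" for i
      unfolding GL_act_def vec_lambda_beta by (intro vec.span_sum vec.span_scale vec.span_base) auto
  qed
qed

lemma stiefel_same_span:
  assumes v: "v \<in> stiefel" and w: "w \<in> stiefel" and eq: "vec.span (range (($) v)) = vec.span (range (($) w))"
  obtains g where "invertible g" "w = GL_act v g"
proof -
  have "\<exists>c. w $ i = coordinate_map v *v c" for i
    using eq vec.span_base [of "w $ i" "range (($) w)"] unfolding span_range_vec by auto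
  then obtain c where c: "\<And>i. w $ i = coordinate_map v *v c i"
    by metis
  define g where "g = (\<chi> j i. c i $ j)"
  have wg: "w = GL_act v g"
    by (subst vec_eq_iff) (simp add: c coordinate_map_mult GL_act_def g_def)
  \<comment> \<open>An invertible minor of w is the product of a minor of v with g, so det g is
    nonzero.\<close>
  obtain J where "det (minor J w) \<noteq> 0"
    using stiefel_det_minor [OF w] .
  then have "invertible g"
    by (simp add: wg minor_act det_mul invertible_det_nz)
  then show thesis
    using wg by (rule that)
qed

section \<open>Continuity of the matrix operations\<close>

lemma continuous_on_det:
  fixes f :: "'x::topological_space \<Rightarrow> 'a::real_normed_field ^ 'n ^ 'n"
  assumes "\<And>i j. continuous_on S (\<lambda>x. f x $ i $ j)"
  shows "continuous_on S (\<lambda>x. det (f x))"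
  unfolding det_def
  by (intro continuous_on_sum continuous_on_mult continuous_on_const continuous_on_prod assms)

text \<open>Cramer's rule: column j solves A x = \<open>axis j 1\<close>. Each entry is a polynomial
  in the entries of A divided by det A, which makes inversion visibly continuous.\<close>

definition cofactor_inverse :: "'a::field ^ 'n ^ 'n \<Rightarrow> 'a ^ 'n ^ 'n" where
  "cofactor_inverse A = (\<chi> i j. det (\<chi> k l. if l = i then axis j 1 $ k else A $ k $ l) / det A)"

lemma cofactor_inverse:
  assumes "det A \<noteq> 0"
  shows "A ** cofactor_inverse A = mat 1" "cofactor_inverse A ** A = mat 1"
proof -
  have "(A ** cofactor_inverse A) $ i $ j = mat 1 $ i $ j" for i j
  proof -
    have "A *v (\<chi> k. cofactor_inverse A $ k $ j) = axis j 1"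
      unfolding cramer [OF assms] by (simp add: cofactor_inverse_def)
    then have "(A *v (\<chi> k. cofactor_inverse A $ k $ j)) $ i = axis j 1 $ i"
      by simp
    then show ?thesis
      by (simp add: matrix_matrix_mult_def matrix_vector_mult_def mat_def axis_def)
  qed
  then show "A ** cofactor_inverse A = mat 1"
    by (simp add: vec_eq_iff)
  then show "cofactor_inverse A ** A = mat 1"
    by (simp add: matrix_left_right_inverse)
qed

lemma carrier_GL: "carrier GL = {g. det g \<noteq> 0}"
  by (simp add: GL_def invertible_det_nz)

lemma mult_GL: "mult GL = (**)" and one_GL: "one GL = mat 1"
  by (simp_all add: GL_def)

lemma group_GL: "Group.group (GL :: ('a::field ^ 'n ^ 'n) monoid)"
proof (rule groupI)
  fix x :: "'a ^ 'n ^ 'n" assume "x \<in> carrier GL"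
  then have x: "det x \<noteq> 0"
    by (simp add: carrier_GL)
  have "det (cofactor_inverse x) * det x = 1"
    using cofactor_inverse(2) [OF x] by (simp flip: det_mul)
  then have "det (cofactor_inverse x) \<noteq> 0"
    by auto
  then show "\<exists>y\<in>carrier GL. y \<otimes>\<^bsub>GL\<^esub> x = \<one>\<^bsub>GL\<^esub>"
    using cofactor_inverse(2) [OF x] by (auto simp: carrier_GL mult_GL one_GL)
qed (auto simp: carrier_GL mult_GL one_GL det_mul matrix_mul_assoc)

lemma inv_GL:
  assumes "g \<in> carrier GL"
  shows "inv\<^bsub>GL\<^esub> g = cofactor_inverse g"
proof -
  have g: "det g \<noteq> 0"
    using assms by (simp add: carrier_GL)
  have "det (cofactor_inverse g) * det g = 1"
    using cofactor_inverse(2) [OF g] by (simp flip: det_mul)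
  then have "cofactor_inverse g \<in> carrier GL"
    by (auto simp: carrier_GL)
  then show ?thesis
    using assms cofactor_inverse(2) [OF g]
    by (intro group.inv_equality [OF group_GL]) (simp_all add: mult_GL one_GL)
qed

lemma topspace_GL: "topspace GL_topology = carrier GL"
  by (simp add: GL_topology_def)

lemma continuous_on_vec_nth: "continuous_on S f \<Longrightarrow> continuous_on S (\<lambda>x. f x $ i)"
  by (rule continuous_on_component)

lemma continuous_on_vector_scalar_mult:
  fixes f :: "'x::topological_space \<Rightarrow> 'a::real_normed_field"
  assumes "continuous_on S f" "continuous_on S g"
  shows "continuous_on S (\<lambda>x. f x *s g x)"
  unfolding vector_scalar_mult_def using assms
  by (intro continuous_on_vec_lambda continuous_intros continuous_on_vec_nth)

lemma continuous_on_GL_act: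
  fixes f :: "'x::topological_space \<Rightarrow> 'a::real_normed_field ^ 'k ^ 'n"
  assumes "continuous_on S f" "continuous_on S g"
  shows "continuous_on S (\<lambda>x. GL_act (f x) (g x))"
  unfolding GL_act_def using assms
  by (intro continuous_on_vec_lambda continuous_on_sum continuous_on_vector_scalar_mult continuous_on_vec_nth)

lemma continuous_on_matrix_mult:
  fixes f :: "'x::topological_space \<Rightarrow> 'a::real_normed_field ^ 'k ^ 'n"
  assumes "continuous_on S f" "continuous_on S g"
  shows "continuous_on S (\<lambda>x. f x ** g x)"
  unfolding matrix_matrix_mult_def using assms
  by (intro continuous_on_vec_lambda continuous_intros continuous_on_vec_nth)

lemma continuous_on_minor:
  fixes f :: "'x::topological_space \<Rightarrow> 'a::real_normed_field ^ 'k ^ 'n"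
  assumes "continuous_on S f"
  shows "continuous_on S (\<lambda>x. minor J (f x))"
  unfolding minor_def using assms by (intro continuous_on_vec_lambda continuous_on_vec_nth)

lemma topological_group_GL: "topological_group GL (GL_topology :: ('a::scalar_field ^ 'n ^ 'n) topology)"
  unfolding topological_group_def
proof (intro conjI)
  show "Group.group (GL :: ('a ^ 'n ^ 'n) monoid)"
    by (rule group_GL)
  show "topspace GL_topology = carrier (GL :: ('a ^ 'n ^ 'n) monoid)"
    by (rule topspace_GL)
  have "continuous_on (carrier GL \<times> carrier GL) (\<lambda>x :: ('a ^ 'n ^ 'n) \<times> ('a ^ 'n ^ 'n). fst x ** snd x)"
    by (intro continuous_on_matrix_mult continuous_intros)
  then show "continuous_map (prod_topology GL_topology GL_topology) GL_topology
      (\<lambda>(g, h :: 'a ^ 'n ^ 'n). g \<otimes>\<^bsub>GL\<^esub> h)"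
    by (auto simp: GL_topology_def prod_topology_subtopology_eu case_prod_unfold mult_GL carrier_GL det_mul)
  have "continuous_on {g. det g \<noteq> 0} (cofactor_inverse :: 'a ^ 'n ^ 'n \<Rightarrow> _)"
    unfolding cofactor_inverse_def [abs_def]
  proof (intro continuous_on_vec_lambda continuous_on_divide continuous_on_det)
    show "continuous_on {g. det g \<noteq> 0}
        (\<lambda>x. (\<chi> k l. if l = i then axis j 1 $ k else (x :: 'a ^ 'n ^ 'n) $ k $ l) $ i' $ j')" for i j i' j'
      by (cases "j' = i") (auto intro!: continuous_on_vec_nth continuous_intros)
  qed (auto intro!: continuous_on_vec_nth continuous_on_id)
  moreover have "cofactor_inverse g \<in> carrier GL" if "g \<in> carrier GL" for g :: "'a ^ 'n ^ 'n"
    using group.inv_closed [OF group_GL that] inv_GL [OF that] by simp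
  ultimately have "continuous_map GL_topology GL_topology (cofactor_inverse :: 'a ^ 'n ^ 'n \<Rightarrow> _)"
    by (auto simp: GL_topology_def carrier_GL)
  then show "continuous_map GL_topology GL_topology (\<lambda>g :: 'a ^ 'n ^ 'n. inv\<^bsub>GL\<^esub> g)"
    by (rule continuous_map_eq) (simp add: topspace_GL inv_GL)
qed

section \<open>Connectivity of the Stiefel space\<close>

lemma bounded_bilinear_vector_scalar_mult:
  "bounded_bilinear ((*s) :: 'a::real_normed_field \<Rightarrow> 'a ^ 'k \<Rightarrow> 'a ^ 'k)"
proof
  show "\<exists>K. \<forall>(a::'a) b :: 'a ^ 'k. norm (a *s b) \<le> norm a * norm b * K"
    by (rule exI [of _ 1]) (simp add: norm_vector_scalar_mult)
qed (simp_all add: vec_eq_iff algebra_simps)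

lemma differentiable_vector_scalar_mult:
  fixes g :: "'x::real_normed_vector \<Rightarrow> 'a::real_normed_field ^ 'k"
  assumes "f differentiable (at x within S)" "g differentiable (at x within S)"
  shows "(\<lambda>x. f x *s g x) differentiable (at x within S)"
  using assms bounded_bilinear.FDERIV [OF bounded_bilinear_vector_scalar_mult]
  unfolding differentiable_def by blast

lemma bounded_linear_axis: "bounded_linear (axis i :: 'a::euclidean_space \<Rightarrow> 'a ^ 'k)"
  unfolding linear_conv_bounded_linear [symmetric]
  by (rule linearI) (auto simp: axis_def vec_eq_iff)

text \<open>
  A tuple outside \<open>stiefel\<close> has a row \<open>i\<close> that is a combination of the others. The \<open>n - 1\<close> coefficients
  of this combination are stored in the entries \<open>\<iota>\<close> of row \<open>i\<close>, which leaves room for a real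
  parameter vector of length \<open>d * (k - n + 1)\<close>, where \<open>d\<close> is the real dimension of the field.
\<close>

lemma row_coordinates:
  fixes i :: "'n::finite"
  assumes m: "m < DIM('a::euclidean_space) * (CARD('k::finite) + 1 - CARD('n))"
  obtains \<iota> :: "'n \<Rightarrow> 'k::finite" and \<kappa> :: "nat \<Rightarrow> 'k::finite" and \<beta> :: "nat \<Rightarrow> 'a::euclidean_space"
  where "inj_on \<iota> (- {i})" "inj_on (\<lambda>r. (\<kappa> r, \<beta> r)) {..m}"
    and "\<And>r. r \<le> m \<Longrightarrow> \<kappa> r \<notin> \<iota> ` (- {i}) \<and> \<beta> r \<in> Basis"
proof -
  have "card (- {i}) = CARD('n) - 1"
    by (simp add: card_Diff_singleton Compl_eq_Diff_UNIV)
  moreover have le: "CARD('n) \<le> CARD('k)"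
  proof (rule ccontr)
    assume "\<not> CARD('n) \<le> CARD('k)"
    then have "CARD('k) + 1 - CARD('n) = 0"
      by simp
    with m show False
      by simp
  qed
  ultimately have "card (- {i}) \<le> card (UNIV :: 'k set)"
    by simp
  then obtain \<iota> :: "'n \<Rightarrow> 'k" where \<iota>: "inj_on \<iota> (- {i})"
    using card_le_inj [of "- {i}" "UNIV :: 'k set"] by auto
  have "card (- (\<iota> ` (- {i}))) = CARD('k) + 1 - CARD('n)"
    using card_image [OF \<iota>] \<open>card (- {i}) = CARD('n) - 1\<close> le
    by (simp add: Compl_eq_Diff_UNIV card_Diff_subset)
  \<comment> \<open>One slot more than there are parameters: the slots 0, ..., m - 1 hold the
    parameters, and slot m is a spare that is kept at 0. This is where the strict inequality in the
    bound on m enters.\<close>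
  then have "card {..m} \<le> card ((- (\<iota> ` (- {i}))) \<times> (Basis :: 'a set))"
    using m by (simp add: card_cartesian_product mult.commute Suc_le_eq)
  then obtain f where f: "f ` {..m} \<subseteq> (- (\<iota> ` (- {i}))) \<times> (Basis :: 'a set)" "inj_on f {..m}"
    using card_le_inj [of "{..m}" "(- (\<iota> ` (- {i}))) \<times> (Basis :: 'a set)"] by auto
  show thesis
  proof (rule that [OF \<iota>, of "fst \<circ> f" "snd \<circ> f"])
    show "inj_on (\<lambda>r. ((fst \<circ> f) r, (snd \<circ> f) r)) {..m}"
      using f(2) by simp
    show "(fst \<circ> f) r \<notin> \<iota> ` (- {i}) \<and> (snd \<circ> f) r \<in> Basis" if "r \<le> m" for r
    proof -
      have "f r \<in> (- (\<iota> ` (- {i}))) \<times> (Basis :: 'a set)"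
        using f(1) that by auto
      then show ?thesis
        by (auto simp: mem_Times_iff)
    qed
  qed
qed

text \<open>The translations w that fail form a null set. Such a w is encoded by a point of the
  matrix space whose spare real coordinate is 0, hence by a point of a hyperplane, and the decoding
  map \<open>\<Phi>\<close> is differentiable, so the image of the hyperplane is negligible. Every
  ball therefore contains a good w, and one w serves all parameters t, also those outside the
  cube.\<close>

lemma stiefel_general_position:
  fixes h :: "'v::euclidean_space \<Rightarrow> 'a::scalar_field ^ 'k ^ 'n"
  assumes m: "m < DIM('a) * (CARD('k) + 1 - CARD('n))" and h: "polynomial_function h" and "0 < \<epsilon>"
  obtains w where "norm w < \<epsilon>" "\<And>t :: nat \<Rightarrow> real. h (\<Sum>r<m. t r *\<^sub>R b r) + w \<in> stiefel"
proof -
  define bad where "bad i = {w. \<exists>(t :: nat \<Rightarrow> real) c. (h (\<Sum>r<m. t r *\<^sub>R b r) + w) $ i =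
      (\<Sum>l\<in>- {i}. c l *s (h (\<Sum>r<m. t r *\<^sub>R b r) + w) $ l)}" for i
  have "negligible (bad i)" for i
  proof -
    obtain \<iota> :: "'n \<Rightarrow> 'k" and \<kappa> :: "nat \<Rightarrow> 'k" and \<beta> :: "nat \<Rightarrow> 'a"
      where \<iota>: "inj_on \<iota> (- {i})" and inj: "inj_on (\<lambda>r. (\<kappa> r, \<beta> r)) {..m}"
        and \<kappa>\<beta>: "\<And>r. r \<le> m \<Longrightarrow> \<kappa> r \<notin> \<iota> ` (- {i}) \<and> \<beta> r \<in> Basis"
      using row_coordinates [OF m, of i] by blast
    define \<tau> :: "nat \<Rightarrow> 'a ^ 'k ^ 'n \<Rightarrow> real" where "\<tau> r x = x $ i $ \<kappa> r \<bullet> \<beta> r" for r x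
    \<comment> \<open>Decoding: the coefficients stored in row i of x rebuild that row from the
      others, which gives back the dependent tuple; then h at the stored parameters is subtracted,
      which leaves w.\<close>
    define \<Phi> where "\<Phi> x = x + axis i ((\<Sum>l\<in>- {i}. x $ i $ \<iota> l *s x $ l) - x $ i) - h (\<Sum>r<m. \<tau> r x *\<^sub>R b r)" for x
    have bl: "bounded_linear (\<lambda>x :: 'a ^ 'k ^ 'n. x $ i $ j)" for i j
      by (rule bounded_linear_compose [OF bounded_linear_vec_nth bounded_linear_vec_nth])
    have "bounded_linear (\<lambda>x. \<Sum>r<m. \<tau> r x *\<^sub>R b r)"
      unfolding \<tau>_def
      by (intro bounded_linear_sum bounded_linear_compose [OF bounded_linear_scaleR_left]
          bounded_linear_compose [OF bounded_linear_inner_left] bl)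
    then have "(\<lambda>x. \<Sum>r<m. \<tau> r x *\<^sub>R b r) differentiable (at x)" for x
      by (rule bounded_linear_imp_differentiable)
    from differentiable_chain_at [OF this differentiable_at_polynomial_function [OF h]]
    have "(\<lambda>x. h (\<Sum>r<m. \<tau> r x *\<^sub>R b r)) differentiable (at x)" for x
      by (simp add: o_def)
    moreover have "(\<lambda>x :: 'a ^ 'k ^ 'n. (\<Sum>l\<in>- {i}. x $ i $ \<iota> l *s x $ l) - x $ i) differentiable (at x)" for x
      by (intro differentiable_diff differentiable_sum differentiable_vector_scalar_mult ballI
          bounded_linear_imp_differentiable [OF bl] bounded_linear_imp_differentiable [OF bounded_linear_vec_nth]) simp
    from differentiable_chain_at [OF this bounded_linear_imp_differentiable [OF bounded_linear_axis]]
    have "(\<lambda>x :: 'a ^ 'k ^ 'n. axis i ((\<Sum>l\<in>- {i}. x $ i $ \<iota> l *s x $ l) - x $ i)) differentiable (at x)" for x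
      by (simp add: o_def)
    ultimately have "\<Phi> differentiable (at x)" for x
      unfolding \<Phi>_def [abs_def] by (intro differentiable_diff differentiable_add) simp_all
    then have "\<Phi> differentiable_on {x. \<tau> m x = 0}"
      by (intro differentiable_at_imp_differentiable_on) simp
    moreover have "negligible {x. \<tau> m x = 0}"
    proof -
      have "{x. \<tau> m x = 0} = {x. axis i (axis (\<kappa> m) (\<beta> m)) \<bullet> x = 0}"
        by (simp add: \<tau>_def inner_axis' inner_commute [of _ "\<beta> m"])
      moreover have "axis i (axis (\<kappa> m) (\<beta> m)) \<in> (Basis :: ('a ^ 'k ^ 'n) set)"
        using \<kappa>\<beta> by simp
      then have "axis i (axis (\<kappa> m) (\<beta> m)) \<noteq> (0 :: 'a ^ 'k ^ 'n)"
        by (rule nonzero_Basis)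
      ultimately show ?thesis
        by (simp add: negligible_hyperplane)
    qed
    ultimately have "negligible (\<Phi> ` {x. \<tau> m x = 0})"
      by (intro negligible_differentiable_image_negligible) simp_all
    moreover have "bad i \<subseteq> \<Phi> ` {x. \<tau> m x = 0}"
    proof
      fix w assume "w \<in> bad i"
      then obtain t :: "nat \<Rightarrow> real" and c
        where c: "(h (\<Sum>r<m. t r *\<^sub>R b r) + w) $ i = (\<Sum>l\<in>- {i}. c l *s (h (\<Sum>r<m. t r *\<^sub>R b r) + w) $ l)"
        by (auto simp: bad_def)
      define v where "v = h (\<Sum>r<m. t r *\<^sub>R b r) + w"
      \<comment> \<open>The encoded row i of the tuple v. Several parameters may share one entry, in
        different real directions \<open>\<beta> r\<close>; hence the sum.\<close>
      define y :: "'a ^ 'k" where "y = (\<chi> j. if j \<in> \<iota> ` (- {i}) then c (inv_into (- {i}) \<iota> j)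
          else \<Sum>r | r < m \<and> \<kappa> r = j. t r *\<^sub>R \<beta> r)"
      define x where "x = (\<chi> l. if l = i then y else v $ l)"
      have y\<iota>: "y $ \<iota> l = c l" if "l \<noteq> i" for l
        using that \<iota> by (simp add: y_def)
      have \<tau>: "\<tau> r x = (if r < m then t r else 0)" if r: "r \<le> m" for r
      proof -
        have "\<tau> r x = (\<Sum>s | s < m \<and> \<kappa> s = \<kappa> r. t s *\<^sub>R \<beta> s) \<bullet> \<beta> r"
          using \<kappa>\<beta> [OF r] by (simp add: \<tau>_def x_def y_def)
        also have "\<dots> = (\<Sum>s | s < m \<and> \<kappa> s = \<kappa> r. if s = r then t s else 0)"
          unfolding inner_sum_left
        proof (rule sum.cong)
          fix s assume s: "s \<in> {s. s < m \<and> \<kappa> s = \<kappa> r}"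
          then have "\<beta> s = \<beta> r \<longleftrightarrow> s = r"
            using r inj_onD [OF inj, of s r] by auto
          then show "t s *\<^sub>R \<beta> s \<bullet> \<beta> r = (if s = r then t s else 0)"
            using s r \<kappa>\<beta> [of s] \<kappa>\<beta> [OF r] by (simp add: inner_Basis)
        qed simp
        also have "\<dots> = (if r < m then t r else 0)"
          by (simp add: sum.delta)
        finally show ?thesis .
      qed
      have "(\<Sum>l\<in>- {i}. x $ i $ \<iota> l *s x $ l) = v $ i"
        unfolding v_def c by (rule sum.cong) (simp_all add: x_def y\<iota> v_def)
      then have "x + axis i ((\<Sum>l\<in>- {i}. x $ i $ \<iota> l *s x $ l) - x $ i) = v"
        by (simp add: vec_eq_iff axis_def x_def)
      then have "\<Phi> x = v - h (\<Sum>r<m. t r *\<^sub>R b r)"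
        by (simp add: \<Phi>_def \<tau>)
      then have "w = \<Phi> x"
        by (simp add: v_def)
      then show "w \<in> \<Phi> ` {x. \<tau> m x = 0}"
        using \<tau> [of m] by auto
    qed
    ultimately show ?thesis
      by (rule negligible_subset)
  qed
  then have "negligible (\<Union>i. bad i)"
    by (intro negligible_Union) auto
  moreover have "\<not> negligible (ball (0 :: 'a ^ 'k ^ 'n) \<epsilon>)"
    using \<open>0 < \<epsilon>\<close> by (intro open_not_negligible) auto
  ultimately have "\<not> ball 0 \<epsilon> \<subseteq> (\<Union>i. bad i)"
    using negligible_subset by blast
  then obtain w where w: "norm w < \<epsilon>" "w \<notin> (\<Union>i. bad i)"
    by (auto simp: subset_iff)
  show thesis
  proof (rule that [OF w(1)])
    fix t :: "nat \<Rightarrow> real"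
    define v where "v = h (\<Sum>r<m. t r *\<^sub>R b r) + w"
    have "c i = 0" if c: "(\<Sum>j\<in>UNIV. c j *s v $ j) = 0" for c :: "'n \<Rightarrow> 'a" and i
    proof (rule ccontr)
      assume ci: "c i \<noteq> 0"
      have "(\<Sum>j\<in>UNIV. c j *s v $ j) = c i *s v $ i + (\<Sum>j\<in>- {i}. c j *s v $ j)"
        by (simp add: sum.remove [of UNIV i] Compl_eq_Diff_UNIV)
      then have "c i *s v $ i = - (\<Sum>j\<in>- {i}. c j *s v $ j)"
        using c by (simp add: eq_neg_iff_add_eq_0)
      then have "(1 / c i) *s (c i *s v $ i) = (1 / c i) *s (- (\<Sum>j\<in>- {i}. c j *s v $ j))"
        by simp
      then have "v $ i = (\<Sum>j\<in>- {i}. (- c j / c i) *s v $ j)"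
        using ci by (simp add: vec_eq_iff sum_distrib_left sum_negf mult.assoc divide_simps)
      then have "w \<in> bad i"
        unfolding bad_def v_def mem_Collect_eq by (intro exI [of _ t] exI [of _ "\<lambda>j. - c j / c i"])
      with w(2) show False
        by blast
    qed
    then show "h (\<Sum>r<m. t r *\<^sub>R b r) + w \<in> stiefel"
      by (simp add: stiefel_def v_def)
  qed
qed

section \<open>Filling spheres in the Stiefel space\<close>

lemma open_stiefel: "open (stiefel :: ('a::scalar_field ^ 'k ^ 'n) set)"
proof -
  have eq: "(stiefel :: ('a ^ 'k ^ 'n) set) = (\<Union>J. {v. det (minor J v) \<noteq> 0})"
  proof (intro equalityI subsetI)
    fix v :: "'a ^ 'k ^ 'n" assume "v \<in> stiefel"
    then obtain J where "det (minor J v) \<noteq> 0"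
      by (rule stiefel_det_minor)
    then show "v \<in> (\<Union>J. {v. det (minor J v) \<noteq> 0})"
      by auto
  qed (auto intro: stiefel_if_det_minor)
  have "open {v :: 'a ^ 'k ^ 'n. det (minor J v) \<noteq> 0}" for J
    by (intro open_Collect_neq continuous_on_det continuous_on_vec_nth continuous_on_minor continuous_intros)
  then show ?thesis
    unfolding eq by (intro open_UN) blast
qed

lemma compact_space_cube: "compact_space (cube m)"
  unfolding cube_def by (intro compact_space_product_topology [THEN iffD2] disjI2) (auto intro!: compact_space_subtopology)

lemma compactin_cube_boundary: "compactin (cube m) (cube_boundary m)"
proof (rule closedin_compact_space [OF compact_space_cube])
  have "closedin (cube m) {t \<in> topspace (cube m). cube_norm m t \<in> {1}}"
    using continuous_map_cube_norm [of m m UNIV]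
    by (intro closedin_continuous_map_preimage [where Y = euclideanreal]) simp_all
  moreover have "{t \<in> topspace (cube m). cube_norm m t \<in> {1}} = cube_boundary m"
    using cube_boundary_iff cube_boundary_subset by blast
  ultimately show "closedin (cube m) (cube_boundary m)"
    by simp
qed

text \<open>
  A map from the boundary is extended to a map \<open>G\<close> into the vector space, \<open>G\<close> is approximated by a map
  in general position, and the approximation is deformed back to \<open>G\<close> near the boundary.
\<close>

lemma cube_fillable_stiefel:
  assumes m: "m < DIM('a::scalar_field) * (CARD('k) + 1 - CARD('n))"
  shows "cube_fillable m (top_of_set (stiefel :: ('a ^ 'k ^ 'n) set))"
  unfolding cube_fillable_def
proof (intro allI impI)
  fix a :: "_ \<Rightarrow> 'a ^ 'k ^ 'n"
  assume a: "continuous_map (subtopology (cube m) (cube_boundary m)) (top_of_set stiefel) a"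
  \<comment> \<open>The cube is placed by \<open>e\<close> into the matrix space along m of its
    basis vectors, with \<open>d\<close> reading the coordinates off again, so that extension and
    polynomial approximation can be applied to maps between Euclidean spaces.\<close>
  have "m \<le> DIM('a ^ 'k ^ 'n)"
  proof -
    have "CARD('k) + 1 - CARD('n) \<le> CARD('k) * CARD('n)"
      by (cases "CARD('n)") auto
    then have "DIM('a) * (CARD('k) + 1 - CARD('n)) \<le> DIM('a) * (CARD('k) * CARD('n))"
      by (rule mult_le_mono2)
    moreover have "DIM('a ^ 'k ^ 'n) = DIM('a) * (CARD('k) * CARD('n))"
      by (simp add: mult.commute mult.left_commute)
    ultimately show ?thesis
      using m by linarith
  qed
  then obtain b where b: "b ` {..<m} \<subseteq> (Basis :: ('a ^ 'k ^ 'n) set)" "inj_on b {..<m}"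
    using card_le_inj [of "{..<m}" "Basis :: ('a ^ 'k ^ 'n) set"] by auto
  define e where "e t = (\<Sum>r<m. t r *\<^sub>R b r)" for t :: "nat \<Rightarrow> real"
  have e_inner: "e t \<bullet> b r = t r" if "r < m" for t r
  proof -
    have "e t \<bullet> b r = (\<Sum>s<m. if s = r then t s else 0)"
      unfolding e_def inner_sum_left
    proof (rule sum.cong)
      fix s assume "s \<in> {..<m}"
      then have "b s \<in> Basis" "b r \<in> Basis" "b s = b r \<longleftrightarrow> s = r"
        using b that by (auto dest: inj_onD)
      then show "t s *\<^sub>R b s \<bullet> b r = (if s = r then t s else 0)"
        by (simp add: inner_Basis)
    qed simp
    also have "\<dots> = t r"
      using that by (simp add: sum.delta)
    finally show ?thesis .
  qed
  have ce: "continuous_map (cube m) euclidean e"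
    unfolding e_def
  proof (intro continuous_map_sum)
    fix r assume "r \<in> {..<m}"
    then have "continuous_map (cube m) euclideanreal (\<lambda>t. t r)"
      using continuous_map_cube_coordinate [of r m UNIV] by simp
    from continuous_map_compose [OF this, of euclidean "\<lambda>s. s *\<^sub>R b r"]
    show "continuous_map (cube m) euclidean (\<lambda>t. t r *\<^sub>R b r)"
      by (simp add: o_def continuous_intros)
  qed simp
  have compact_e: "compact (e ` A)" if "compactin (cube m) A" for A
    using image_compactin [OF that ce] by simp
  let ?D = "cube_boundary m"
  define d where "d y = (\<lambda>r\<in>{..<m}. y \<bullet> b r)" for y
  have de: "d (e t) = t" if "t \<in> topspace (cube m)" for t
    using that by (auto simp: d_def e_inner topspace_cube PiE_iff extensional_def)
  have "continuous_map (top_of_set (e ` ?D)) (subtopology (cube m) ?D) d"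
  proof (intro continuous_map_into_subtopology continuous_map_into_cube)
    show "continuous_map (top_of_set (e ` ?D)) euclideanreal (\<lambda>y. d y j)" if "j < m" for j
      using that by (auto simp: d_def intro!: continuous_intros)
  qed (use de cube_boundary_subset in \<open>auto simp: subset_iff\<close>)
  from continuous_map_compose [OF this a]
  have "continuous_on (e ` ?D) (a \<circ> d)"
    by (simp add: continuous_map_in_subtopology)
  moreover have "closed (e ` ?D)"
    by (rule compact_imp_closed [OF compact_e [OF compactin_cube_boundary]])
  ultimately obtain G where G: "continuous_on UNIV G" "\<And>y. y \<in> e ` ?D \<Longrightarrow> G y = (a \<circ> d) y"
    using Tietze_unbounded [of "e ` ?D" "a \<circ> d" UNIV] by auto
  have Ga: "G (e t) = a t" if "t \<in> ?D" for t
    using G(2) [of "e t"] that de [of t] cube_boundary_subset [of m] by auto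
  let ?B = "G ` e ` ?D"
  have B: "compact ?B"
    by (intro compact_continuous_image continuous_on_subset [OF G(1)] compact_e compactin_cube_boundary) simp
  have "?B \<subseteq> stiefel"
  proof -
    have "a t \<in> stiefel" if "t \<in> ?D" for t
      using continuous_map_image_subset_topspace [OF a] that cube_boundary_subset [of m] by auto
    then show ?thesis
      using Ga by auto
  qed
  then obtain \<epsilon> where \<epsilon>: "0 < \<epsilon>" "(\<Union>x\<in>?B. ball x \<epsilon>) \<subseteq> stiefel"
    using compact_subset_open_imp_ball_epsilon_subset [OF B open_stiefel] by blast
  have "compact (e ` topspace (cube m))"
    using compact_space_cube by (intro compact_e) (simp add: compact_space_def)
  \<comment> \<open>Half of \<epsilon> is spent on the approximation and on w, a quarter each; the
    other half is the width of the zone around \<open>?B\<close> in which \<open>\<theta>\<close> is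
    positive.\<close>
  then obtain h where h: "polynomial_function h" "\<And>y. y \<in> e ` topspace (cube m) \<Longrightarrow> norm (G y - h y) < \<epsilon> / 4"
    using Stone_Weierstrass_polynomial_function [of "e ` topspace (cube m)" G "\<epsilon> / 4"]
      continuous_on_subset [OF G(1)] \<epsilon>(1) by auto
  obtain w where w: "norm w < \<epsilon> / 4" "\<And>t. h (e t) + w \<in> stiefel"
    using stiefel_general_position [OF m h(1), of "\<epsilon> / 4" b] \<epsilon>(1) unfolding e_def by auto
  \<comment> \<open>\<open>\<theta>\<close> is 1 where G takes values in \<open>?B\<close>, in
    particular on the boundary, and 0 where G is at distance \<epsilon> / 2 or more from
    \<open>?B\<close>: there f is the map in general position, and elsewhere it stays within
    \<epsilon> of \<open>?B\<close>. The case distinction is for m = 0: \<open>infdist\<close> to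
    the empty set is 0, which would make \<open>\<theta>\<close> equal to 1.\<close>
  define \<theta> where "\<theta> y = (if ?D = {} then 0 else max 0 (1 - infdist (G y) ?B / (\<epsilon> / 2)))" for y
  define f where "f y = (h y + w) + \<theta> y *\<^sub>R (G y - (h y + w))" for y
  have "continuous_on UNIV \<theta>"
    unfolding \<theta>_def using G(1) \<epsilon>(1) by (cases "?D = {}") (auto intro!: continuous_intros)
  then have "continuous_on UNIV f"
    unfolding f_def using G(1) continuous_on_polymonial_function [OF h(1)] by (intro continuous_intros)
  then have "continuous_map (cube m) euclidean (f \<circ> e)"
    by (intro continuous_map_compose [OF ce]) simp
  moreover have "f (e t) \<in> stiefel" if t: "t \<in> topspace (cube m)" for t
  proof (cases "\<theta> (e t) = 0")
    case True
    then show ?thesis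
      by (simp add: f_def w)
  next
    case False
    then have D: "?D \<noteq> {}"
      by (auto simp: \<theta>_def)
    then have \<theta>: "\<theta> (e t) = 1 - infdist (G (e t)) ?B / (\<epsilon> / 2)" "0 \<le> \<theta> (e t)"
      using False by (auto simp: \<theta>_def max_def split: if_splits)
    then have "infdist (G (e t)) ?B / (\<epsilon> / 2) < 1"
      using False by linarith
    then have "infdist (G (e t)) ?B < \<epsilon> / 2"
      using \<epsilon>(1) by (simp add: divide_less_eq)
    moreover obtain x where x: "x \<in> ?B" "infdist (G (e t)) ?B = dist (G (e t)) x"
      using infdist_attains_inf [OF compact_imp_closed [OF B], of "G (e t)"] D by auto
    ultimately have dist: "dist (G (e t)) x < \<epsilon> / 2"
      by simp
    have "\<theta> (e t) \<le> 1"
      using \<theta>(1) \<epsilon>(1) infdist_nonneg [of "G (e t)" ?B] by simp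
    have "f (e t) - G (e t) = (1 - \<theta> (e t)) *\<^sub>R (w - (G (e t) - h (e t)))"
      by (simp add: f_def algebra_simps)
    then have "norm (f (e t) - G (e t)) = \<bar>1 - \<theta> (e t)\<bar> * norm (w - (G (e t) - h (e t)))"
      by simp
    also have "\<dots> \<le> 1 * norm (w - (G (e t) - h (e t)))"
      using \<open>\<theta> (e t) \<le> 1\<close> \<theta>(2) by (intro mult_right_mono) auto
    also have "\<dots> \<le> norm w + norm (G (e t) - h (e t))"
      using norm_triangle_ineq4 [of w] by simp
    also have "\<dots> < \<epsilon> / 2"
      using w(1) h(2) [of "e t"] t by auto
    finally have "dist x (f (e t)) < \<epsilon>"
      using dist dist_triangle [of x "f (e t)" "G (e t)"] by (simp add: dist_norm norm_minus_commute)
    with x(1) \<epsilon>(2) show ?thesis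
      by (auto simp: subset_iff)
  qed
  ultimately have "continuous_map (cube m) (top_of_set stiefel) (f \<circ> e)"
    by (auto intro: continuous_map_into_subtopology)
  moreover have "(f \<circ> e) t = a t" if t: "t \<in> ?D" for t
  proof -
    have "\<theta> (e t) = 1"
      using t by (auto simp: \<theta>_def)
    then show ?thesis
      using Ga [OF t] by (simp add: f_def)
  qed
  ultimately show "\<exists>b. continuous_map (cube m) (top_of_set stiefel) b \<and> (\<forall>t\<in>?D. b t = a t)"
    by blast
qed

section \<open>Continuity on the Grassmannian\<close>

lemma orthogonal_projection_ident: "x \<in> vec.span S \<Longrightarrow> orthogonal_projection S x = x"
  for x :: "'a::scalar_field ^ 'k"
  by (rule orthogonal_projection_eqI) simp_all

lemma norm_orthogonal_projection:
  fixes x :: "'a::scalar_field ^ 'k"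
  shows "norm (orthogonal_projection S x) \<le> norm x" "norm (x - orthogonal_projection S x) \<le> norm x"
proof -
  let ?p = "orthogonal_projection S x"
  have "orthogonal ?p (x - ?p)"
    using orthogonal_projection(2) [OF orthogonal_projection(1)] by (simp add: orthogonal_def inner_commute)
  from norm_add_Pythagorean [OF this] have "(norm x)\<^sup>2 = (norm ?p)\<^sup>2 + (norm (x - ?p))\<^sup>2"
    by simp
  then show "norm ?p \<le> norm x" "norm (x - ?p) \<le> norm x"
    by (simp_all add: power2_le_imp_le)
qed

lemma norm_diff_orthogonal_projection_le:
  fixes x :: "'a::scalar_field ^ 'k"
  assumes "y \<in> vec.span S"
  shows "norm (x - orthogonal_projection S x) \<le> norm (x - y)"
proof -
  let ?p = "orthogonal_projection S x"
  have "orthogonal (x - ?p) (?p - y)"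
    unfolding orthogonal_def by (intro orthogonal_projection(2) vec.span_diff orthogonal_projection(1) assms)
  from norm_add_Pythagorean [OF this] have "(norm (x - y))\<^sup>2 = (norm (x - ?p))\<^sup>2 + (norm (?p - y))\<^sup>2"
    by simp
  then show ?thesis
    by (simp add: power2_le_imp_le)
qed

text \<open>
  The second summand of \<open>P\<^sub>E - P\<^sub>F = (1 - P\<^sub>F) P\<^sub>E - P\<^sub>F (1 - P\<^sub>E)\<close> is the adjoint of \<open>(1 - P\<^sub>E) P\<^sub>F\<close>.
\<close>

lemma grassmannian_dist_le:
  fixes E F :: "('a::scalar_field ^ 'k) set"
  assumes a: "\<And>x. x \<in> vec.span E \<Longrightarrow> norm (x - orthogonal_projection F x) \<le> a * norm x"
    and b: "\<And>x. x \<in> vec.span F \<Longrightarrow> norm (x - orthogonal_projection E x) \<le> b * norm x"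
    and "0 \<le> a" "0 \<le> b"
  shows "grassmannian_dist E F \<le> a + b"
  unfolding grassmannian_dist_def
proof (rule onorm_le)
  fix x :: "'a ^ 'k"
  let ?E = "orthogonal_projection E" and ?F = "orthogonal_projection F"
  define y where "y = x - ?E x"
  define z where "z = ?F y"
  have "?F x = ?F (?E x) + z"
    using bounded_linear.linear [OF bounded_linear_orthogonal_projection [of F]]
    by (simp add: z_def y_def linear_diff)
  then have "norm (?E x - ?F x) \<le> norm (?E x - ?F (?E x)) + norm z"
    using norm_triangle_ineq4 [of "?E x - ?F (?E x)" z] by (simp add: algebra_simps)
  also have "norm (?E x - ?F (?E x)) \<le> a * norm (?E x)"
    by (rule a) (rule orthogonal_projection(1))
  also have "\<dots> \<le> a * norm x"
    using \<open>0 \<le> a\<close> norm_orthogonal_projection(1) by (rule mult_left_mono [rotated])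
  also have "norm z \<le> b * norm x"
  proof (cases "z = 0")
    case False
    have z: "z \<in> vec.span F"
      unfolding z_def by (rule orthogonal_projection(1))
    have "inner (y - z) z = 0"
      unfolding z_def by (rule orthogonal_projection(2)) (rule orthogonal_projection(1))
    \<comment> \<open>The adjoint at work: z is tested against itself, and since y is orthogonal to
      the span of E, the second z may be replaced by its component orthogonal to that span, which
      the hypothesis on b bounds.\<close>
    then have "norm z * norm z = inner y z"
      by (simp add: inner_diff_left norm_eq_square flip: power2_norm_eq_inner power2_eq_square)
    also have "\<dots> = inner y (z - ?E z)"
    proof -
      have "inner y (?E z) = 0"
        unfolding y_def by (rule orthogonal_projection(2)) (rule orthogonal_projection(1))
      then show ?thesis
        by (simp add: inner_diff_right)
    qed
    also have "\<dots> \<le> norm y * norm (z - ?E z)"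
      by (rule norm_cauchy_schwarz)
    also have "\<dots> \<le> norm x * (b * norm z)"
      unfolding y_def by (intro mult_mono norm_orthogonal_projection b z) simp_all
    finally show ?thesis
      using False by (simp add: mult.commute mult.left_commute)
  qed (use \<open>0 \<le> b\<close> in simp)
  finally show "norm (?E x - ?F x) \<le> (a + b) * norm x"
    by (simp add: algebra_simps)
qed

lemma norm_coordinate_map_mult_le:
  fixes v :: "'a::real_normed_field ^ 'k ^ 'n"
  shows "norm (coordinate_map v *v c) \<le> CARD('n) * norm v * norm c"
proof -
  have "norm (coordinate_map v *v c) \<le> (\<Sum>j\<in>UNIV. norm (c $ j *s v $ j))"
    unfolding coordinate_map_mult by (rule norm_sum)
  also have "\<dots> \<le> (\<Sum>j\<in>(UNIV :: 'n set). norm c * norm v)"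
    unfolding norm_vector_scalar_mult by (intro sum_mono mult_mono Finite_Cartesian_Product.norm_nth_le) simp_all
  finally show ?thesis
    by (simp add: mult.commute mult.left_commute)
qed

lemma coordinate_map_diff: "coordinate_map (v - w) = coordinate_map v - coordinate_map w"
  by (simp add: coordinate_map_def vec_eq_iff)

text \<open>A linear injection in finite dimension is bounded below. Half of the bound is kept in
  reserve, so that frames close to w still satisfy it with \<kappa>.\<close>

lemma stiefel_bounded_below:
  fixes w :: "'a::scalar_field ^ 'k ^ 'n"
  assumes "w \<in> stiefel"
  obtains \<kappa> where "0 < \<kappa>" "\<And>c. 2 * \<kappa> * norm c \<le> norm (coordinate_map w *v c)"
proof -
  have "linear ((*v) (coordinate_map w))"
  proof (rule linearI)
    fix r and x :: "'a ^ 'n"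
    show "coordinate_map w *v (r *\<^sub>R x) = r *\<^sub>R (coordinate_map w *v x)"
      by (simp add: vec_eq_iff matrix_vector_mult_def scaleR_sum_right)
  qed (simp add: matrix_vector_right_distrib)
  moreover have "inj ((*v) (coordinate_map w))"
    using assms by (simp add: stiefel_iff_inj)
  ultimately obtain B where B: "0 < B" "\<And>c. B * norm c \<le> norm (coordinate_map w *v c)"
    using linear_inj_bounded_below_pos by blast
  show thesis
    by (rule that [of "B / 2"]) (use B in simp_all)
qed

text \<open>A vector of one span is compared with the vector of the other that has the same
  coefficients c. The two differ by at most \<open>CARD('n) * norm (v - w) * norm c\<close>, and
  norm c is controlled by the lower bound, for w by hypothesis and for v by perturbation. The factor
  2 comes from the two summands of \<open>grassmannian_dist_le\<close>.\<close>

lemma grassmannian_dist_span_le: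
  fixes v w :: "'a::scalar_field ^ 'k ^ 'n"
  assumes \<kappa>: "0 < \<kappa>" "\<And>c. 2 * \<kappa> * norm c \<le> norm (coordinate_map w *v c)"
    and vw: "CARD('n) * norm (v - w) \<le> \<kappa>"
  shows "grassmannian_dist (vec.span (range (($) v))) (vec.span (range (($) w))) \<le>
           2 * CARD('n) * norm (v - w) / \<kappa>"
proof -
  have diff: "norm (coordinate_map v *v c - coordinate_map w *v c) \<le> CARD('n) * norm (v - w) * norm c" for c
    using norm_coordinate_map_mult_le [of "v - w" c]
    by (simp add: coordinate_map_diff matrix_vector_mult_diff_rdistrib)
  have below_v: "\<kappa> * norm c \<le> norm (coordinate_map v *v c)" for c
  proof -
    have "2 * \<kappa> * norm c \<le> norm (coordinate_map v *v c) + CARD('n) * norm (v - w) * norm c"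
      using \<kappa>(2) [of c] diff [of c] norm_triangle_sub [of "coordinate_map w *v c" "coordinate_map v *v c"]
      by (simp add: norm_minus_commute)
    moreover have "CARD('n) * norm (v - w) * norm c \<le> \<kappa> * norm c"
      using vw by (intro mult_right_mono) simp_all
    ultimately show ?thesis
      by simp
  qed
  have below_w: "\<kappa> * norm c \<le> norm (coordinate_map w *v c)" for c
  proof -
    have "0 \<le> \<kappa> * norm c"
      using \<kappa>(1) by simp
    with \<kappa>(2) [of c] show ?thesis
      by simp
  qed
  let ?V = "vec.span (range (($) v))" and ?W = "vec.span (range (($) w))"
  let ?a = "CARD('n) * norm (v - w) / \<kappa>"
  have bound: "CARD('n) * norm (v - w) * norm c \<le> ?a * r" if "\<kappa> * norm c \<le> r" for c :: "'a ^ 'n" and r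
  proof -
    have "CARD('n) * norm (v - w) * norm c = ?a * (\<kappa> * norm c)"
      using \<kappa>(1) by simp
    also have "\<dots> \<le> ?a * r"
      using that \<kappa>(1) by (intro mult_left_mono) simp_all
    finally show ?thesis .
  qed
  have "grassmannian_dist ?V ?W \<le> ?a + ?a"
  proof (rule grassmannian_dist_le)
    fix x assume "x \<in> vec.span ?V"
    then obtain c where x: "x = coordinate_map v *v c"
      unfolding trans [OF vec.span_span span_range_vec] by blast
    have "norm (x - orthogonal_projection ?W x) \<le> norm (x - coordinate_map w *v c)"
      by (rule norm_diff_orthogonal_projection_le) (unfold trans [OF vec.span_span span_range_vec], rule rangeI)
    also have "\<dots> \<le> CARD('n) * norm (v - w) * norm c"
      unfolding x by (rule diff)
    also have "\<dots> \<le> ?a * norm x"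
      unfolding x by (rule bound [OF below_v])
    finally show "norm (x - orthogonal_projection ?W x) \<le> ?a * norm x" .
  next
    fix x assume "x \<in> vec.span ?W"
    then obtain c where x: "x = coordinate_map w *v c"
      unfolding trans [OF vec.span_span span_range_vec] by blast
    have "norm (x - orthogonal_projection ?V x) \<le> norm (x - coordinate_map v *v c)"
      by (rule norm_diff_orthogonal_projection_le) (unfold trans [OF vec.span_span span_range_vec], rule rangeI)
    also have "\<dots> \<le> CARD('n) * norm (v - w) * norm c"
      unfolding x using diff [of c] by (simp add: norm_minus_commute)
    also have "\<dots> \<le> ?a * norm x"
      unfolding x by (rule bound [OF below_w])
    finally show "norm (x - orthogonal_projection ?V x) \<le> ?a * norm x" .
  qed (use \<kappa>(1) in simp_all)
  then show ?thesis
    by simp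
qed

lemma topspace_grassmannian: "topspace (grassmannian_topology n) = grassmannian n"
  by (simp add: grassmannian_topology_def Metric_space.topspace_mtopology [OF Metric_space_grassmannian])

lemma continuous_map_span:
  "continuous_map (top_of_set stiefel) (grassmannian_topology CARD('n))
     (\<lambda>v :: 'a::scalar_field ^ 'k ^ 'n. vec.span (range (($) v)))"
  unfolding grassmannian_topology_def Metric_space.continuous_map_to_metric [OF Metric_space_grassmannian]
proof (intro ballI allI impI)
  fix w :: "'a ^ 'k ^ 'n" and \<epsilon> :: real assume "w \<in> topspace (top_of_set stiefel)" and \<epsilon>: "0 < \<epsilon>"
  then have w: "w \<in> stiefel"
    by simp
  obtain \<kappa> where \<kappa>: "0 < \<kappa>" "\<And>c. 2 * \<kappa> * norm c \<le> norm (coordinate_map w *v c)"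
    using stiefel_bounded_below [OF w] by blast
  \<comment> \<open>The first bound admits v to \<open>grassmannian_dist_span_le\<close>, the second
    makes the resulting estimate less than \<epsilon>.\<close>
  define \<delta> where "\<delta> = min (\<kappa> / CARD('n)) (\<epsilon> * \<kappa> / (2 * CARD('n)))"
  have \<delta>: "0 < \<delta>"
    using \<kappa>(1) \<epsilon> by (simp add: \<delta>_def)
  show "\<exists>U. openin (top_of_set stiefel) U \<and> w \<in> U \<and>
      (\<forall>v\<in>U. vec.span (range (($) v)) \<in>
        Metric_space.mball (grassmannian CARD('n)) grassmannian_dist (vec.span (range (($) w))) \<epsilon>)"
  proof (intro exI conjI ballI)
    show "openin (top_of_set stiefel) (stiefel \<inter> ball w \<delta>)"
      by (simp add: openin_open_Int)
    show "w \<in> stiefel \<inter> ball w \<delta>"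
      using w \<delta> by simp
    fix v assume "v \<in> stiefel \<inter> ball w \<delta>"
    then have v: "v \<in> stiefel" "norm (v - w) < \<delta>"
      by (auto simp: dist_norm norm_minus_commute)
    then have "norm (v - w) < \<kappa> / CARD('n)" "norm (v - w) < \<epsilon> * \<kappa> / (2 * CARD('n))"
      by (simp_all add: \<delta>_def)
    then have "CARD('n) * norm (v - w) < \<kappa>" "2 * CARD('n) * norm (v - w) < \<epsilon> * \<kappa>"
      by (simp_all add: field_simps)
    then have "2 * CARD('n) * norm (v - w) / \<kappa> < \<epsilon>"
      using \<kappa>(1) by (simp add: divide_less_eq)
    with grassmannian_dist_span_le [OF \<kappa>, of v] \<open>CARD('n) * norm (v - w) < \<kappa>\<close>
    have "grassmannian_dist (vec.span (range (($) v))) (vec.span (range (($) w))) < \<epsilon>"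
      by linarith
    then have "grassmannian_dist (vec.span (range (($) w))) (vec.span (range (($) v))) < \<epsilon>"
      by (subst Metric_space.commute [OF Metric_space_grassmannian])
    then show "vec.span (range (($) v)) \<in>
        Metric_space.mball (grassmannian CARD('n)) grassmannian_dist (vec.span (range (($) w))) \<epsilon>"
      using v(1) w by (simp add: Metric_space.in_mball [OF Metric_space_grassmannian] grassmannian_span)
  qed
qed

text \<open>A local section of the bundle: for a frame w it takes the value w at the span of w, and
  for S close to that span it is a frame of S.\<close>

definition projected_frame :: "'a::scalar_field ^ 'k ^ 'n \<Rightarrow> ('a ^ 'k) set \<Rightarrow> 'a ^ 'k ^ 'n" where
  "projected_frame w S = (\<chi> i. orthogonal_projection S (w $ i))"

lemma continuous_map_projected_frame:
  "continuous_map (grassmannian_topology m) euclidean (projected_frame (w :: 'a::scalar_field ^ 'k ^ 'n))"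
proof -
  interpret Metric_space "grassmannian m :: ('a ^ 'k) set set" grassmannian_dist
    by (rule Metric_space_grassmannian)
  have le: "norm (projected_frame w E - projected_frame w F) \<le> CARD('n) * norm w * grassmannian_dist F E" for E F
  proof -
    have "norm (projected_frame w E - projected_frame w F) \<le> (\<Sum>i\<in>UNIV. norm ((projected_frame w E - projected_frame w F) $ i))"
      by (simp add: norm_vec_def L2_set_le_sum)
    also have "\<dots> \<le> (\<Sum>i\<in>(UNIV :: 'n set). norm w * grassmannian_dist F E)"
    proof (rule sum_mono)
      fix i
      have "norm ((projected_frame w E - projected_frame w F) $ i) \<le> grassmannian_dist E F * norm (w $ i)"
        unfolding grassmannian_dist_def
        using onorm [OF bounded_linear_sub [OF bounded_linear_orthogonal_projection bounded_linear_orthogonal_projection]]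
        by (simp add: projected_frame_def)
      also have "\<dots> \<le> grassmannian_dist E F * norm w"
        by (intro mult_left_mono Finite_Cartesian_Product.norm_nth_le nonneg)
      finally show "norm ((projected_frame w E - projected_frame w F) $ i) \<le> norm w * grassmannian_dist F E"
        by (simp add: mult.commute commute)
    qed
    finally show ?thesis
      by (simp add: mult.assoc)
  qed
  have "\<exists>U. openin mtopology U \<and> E \<in> U \<and> (\<forall>F\<in>U. projected_frame w F \<in> Met_TC.mball (projected_frame w E) \<epsilon>)"
    if E: "E \<in> topspace mtopology" and \<epsilon>: "0 < \<epsilon>" for E \<epsilon>
  proof (intro exI conjI ballI)
    \<comment> \<open>The Lipschitz constant \<open>CARD('n) * norm w\<close> vanishes for w = 0;
      adding 1 keeps the denominator positive.\<close>
    define \<delta> where "\<delta> = \<epsilon> / (CARD('n) * norm w + 1)"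
    have pos: "0 < CARD('n) * norm w + 1"
      by (simp add: add_nonneg_pos)
    then have \<delta>: "0 < \<delta>"
      using \<epsilon> by (simp add: \<delta>_def)
    show "openin mtopology (mball E \<delta>)"
      by (rule openin_mball)
    show "E \<in> mball E \<delta>"
      using E \<delta> by simp
    fix F assume "F \<in> mball E \<delta>"
    then have F: "grassmannian_dist E F < \<delta>"
      by simp
    have "norm (projected_frame w F - projected_frame w E) \<le> CARD('n) * norm w * grassmannian_dist E F"
      by (rule le)
    also have "\<dots> \<le> (CARD('n) * norm w + 1) * grassmannian_dist E F"
      by (intro mult_right_mono nonneg) simp
    also have "\<dots> < (CARD('n) * norm w + 1) * \<delta>"
      using F pos by (rule mult_strict_left_mono)
    also have "\<dots> = \<epsilon>"
      using pos by (simp add: \<delta>_def)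
    finally show "projected_frame w F \<in> Met_TC.mball (projected_frame w E) \<epsilon>"
      by (simp add: dist_norm norm_minus_commute)
  qed
  then have "continuous_map mtopology Met_TC.mtopology (projected_frame w)"
    unfolding Met_TC.continuous_map_to_metric by blast
  then show ?thesis
    by (simp add: grassmannian_topology_def)
qed

section \<open>The Stiefel bundle\<close>

lemma continuous_map_into_GL:
  "continuous_map X GL_topology f \<longleftrightarrow>
     continuous_map X euclidean f \<and> (\<forall>x\<in>topspace X. det (f x) \<noteq> 0)"
  by (auto simp: GL_topology_def continuous_map_in_subtopology carrier_GL)

lemma continuous_map_minor:
  "continuous_map euclidean euclidean (minor J :: 'a::scalar_field ^ 'k ^ 'n \<Rightarrow> _)"
  using continuous_on_minor [of UNIV "\<lambda>x. x"] by simp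

lemma continuous_map_det: "continuous_map euclidean euclidean (det :: 'a::scalar_field ^ 'n ^ 'n \<Rightarrow> 'a)"
  using continuous_on_det [of UNIV "\<lambda>x. x"] by (simp add: continuous_on_vec_nth)

lemma continuous_map_GL_act:
  fixes f :: "'x \<Rightarrow> 'a::scalar_field ^ 'k ^ 'n"
  assumes "continuous_map X euclidean f" "continuous_map X euclidean g"
  shows "continuous_map X euclidean (\<lambda>x. GL_act (f x) (g x))"
proof -
  have "continuous_map euclidean euclidean (\<lambda>(v :: 'a ^ 'k ^ 'n, g). GL_act v g)"
    by (simp add: case_prod_unfold continuous_on_GL_act continuous_intros)
  moreover have "continuous_map X euclidean (\<lambda>x. (f x, g x))"
    using continuous_map_pairedI [OF assms] by simp
  ultimately show ?thesis
    using continuous_map_compose [of X euclidean "\<lambda>x. (f x, g x)" euclidean "\<lambda>(v, g). GL_act v g"]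
    by (simp add: o_def)
qed

lemma continuous_map_GL_mult_inv:
  fixes f g :: "'x \<Rightarrow> 'a::scalar_field ^ 'n ^ 'n"
  assumes f: "continuous_map X GL_topology f" and g: "continuous_map X GL_topology g"
  shows "continuous_map X GL_topology (\<lambda>x. inv\<^bsub>GL\<^esub> (f x) \<otimes>\<^bsub>GL\<^esub> g x)"
proof -
  have mult: "continuous_map (prod_topology GL_topology GL_topology) GL_topology
      (\<lambda>(g, h :: 'a ^ 'n ^ 'n). g \<otimes>\<^bsub>GL\<^esub> h)"
    and inv: "continuous_map GL_topology GL_topology (\<lambda>g :: 'a ^ 'n ^ 'n. inv\<^bsub>GL\<^esub> g)"
    using topological_group_GL unfolding topological_group_def by blast+
  show ?thesis
    using continuous_map_compose [OF continuous_map_pairedI [OF continuous_map_compose [OF f inv] g] mult]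
    by (simp add: o_def)
qed

lemma stiefel_bundle_simps:
  "total_space (stiefel_bundle :: ('a::scalar_field ^ 'k ^ 'n, _, _) gbundle) = top_of_set stiefel"
  "base_space (stiefel_bundle :: ('a ^ 'k ^ 'n, _, _) gbundle) = grassmannian_topology CARD('n)"
  "bundle_proj (stiefel_bundle :: ('a ^ 'k ^ 'n, _, _) gbundle) = (\<lambda>v. vec.span (range (($) v)))"
  "bundle_act (stiefel_bundle :: ('a ^ 'k ^ 'n, _, _) gbundle) = GL_act"
  by (simp_all add: stiefel_bundle_def GL_act_def [abs_def])

lemma projected_frame_self: "projected_frame w (vec.span (range (($) w))) = w"
proof -
  have "orthogonal_projection (vec.span (range (($) w))) (w $ i) = w $ i" for i
    by (rule orthogonal_projection_ident) (simp add: vec.span_span vec.span_base)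
  then show ?thesis
    by (simp add: projected_frame_def vec_eq_iff)
qed

lemma span_projected_frame:
  fixes w :: "'a::scalar_field ^ 'k ^ 'n"
  assumes "S \<in> grassmannian CARD('n)" "projected_frame w S \<in> stiefel"
  shows "vec.span (range (($) (projected_frame w S))) = S"
proof (rule span_eq_if_stiefel_in_grassmannian [OF assms(2,1)])
  have eq: "vec.span S = S"
    using assms(1) by (simp add: grassmannian_def)
  show "projected_frame w S $ i \<in> S" for i
    using orthogonal_projection(1) [of S "w $ i", unfolded eq] by (simp add: projected_frame_def)
qed

text \<open>The section is \<open>projected_frame w\<close> on the open set where its minor J is
  invertible. Since minors turn the action into right multiplication, the group coordinate of v over
  S is the inverse of the minor of the section at S times the minor of v.\<close>

lemma stiefel_local_triviality:
  fixes b :: "('a::scalar_field ^ 'k) set"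
  assumes "b \<in> grassmannian CARD('n)"
  obtains U and \<phi> :: "('a ^ 'k) set \<times> ('a ^ 'n ^ 'n) \<Rightarrow> 'a ^ 'k ^ 'n"
  where "openin (grassmannian_topology CARD('n)) U" "b \<in> U"
    and "homeomorphic_map (prod_topology (subtopology (grassmannian_topology CARD('n)) U) GL_topology)
      (subtopology (top_of_set stiefel) {v \<in> stiefel. vec.span (range (($) v)) \<in> U}) \<phi>"
    and "\<And>u g. u \<in> U \<Longrightarrow> g \<in> carrier GL \<Longrightarrow> vec.span (range (($) (\<phi> (u, g)))) = u"
    and "\<And>u g h. u \<in> U \<Longrightarrow> g \<in> carrier GL \<Longrightarrow> h \<in> carrier GL \<Longrightarrow> \<phi> (u, g ** h) = GL_act (\<phi> (u, g)) h"
proof -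
  interpret group "GL :: ('a ^ 'n ^ 'n) monoid"
    by (rule group_GL)
  obtain w :: "'a ^ 'k ^ 'n" where w: "w \<in> stiefel" "vec.span (range (($) w)) = b"
    using grassmannian_stiefelE [OF assms] by blast
  obtain J where J: "det (minor J w) \<noteq> 0"
    using stiefel_det_minor [OF w(1)] by blast
  let ?Gr = "grassmannian_topology CARD('n) :: ('a ^ 'k) set topology"
  let ?q = "\<lambda>v :: 'a ^ 'k ^ 'n. vec.span (range (($) v))"
  define \<sigma> where "\<sigma> = projected_frame w"
  have c\<sigma>: "continuous_map ?Gr euclidean \<sigma>"
    unfolding \<sigma>_def by (rule continuous_map_projected_frame)
  define U where "U = {S \<in> topspace ?Gr. det (minor J (\<sigma> S)) \<in> - {0}}"
  have U: "openin ?Gr U"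
    unfolding U_def
    by (rule openin_continuous_map_preimage [where Y = euclidean])
      (use continuous_map_compose [OF continuous_map_compose [OF c\<sigma> continuous_map_minor] continuous_map_det]
        in \<open>auto simp: o_def\<close>)
  have b: "b \<in> U"
    using assms J w(2) by (auto simp: U_def \<sigma>_def topspace_grassmannian projected_frame_self)
  have detU: "det (minor J (\<sigma> S)) \<noteq> 0" and UGr: "S \<in> grassmannian CARD('n)" if "S \<in> U" for S
    using that by (auto simp: U_def topspace_grassmannian)
  have \<sigma>_stiefel: "\<sigma> S \<in> stiefel" and q\<sigma>: "?q (\<sigma> S) = S" if "S \<in> U" for S
    using stiefel_if_det_minor [OF detU [OF that]] span_projected_frame UGr [OF that] by (simp_all add: \<sigma>_def)
  have minor_GL: "minor J (\<sigma> S) \<in> carrier GL" if "S \<in> U" for S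
    using detU [OF that] by (simp add: carrier_GL)
  let ?X = "prod_topology (subtopology ?Gr U) (GL_topology :: ('a ^ 'n ^ 'n) topology)"
  let ?Y = "subtopology (top_of_set stiefel) {v \<in> stiefel. ?q v \<in> U}"
  have X: "S \<in> U \<and> g \<in> carrier GL" if "(S, g) \<in> topspace ?X" for S g
    using that by (auto simp: topspace_GL)
  define \<phi> where "\<phi> = (\<lambda>(S, g :: 'a ^ 'n ^ 'n). GL_act (\<sigma> S) g)"
  define \<gamma> where "\<gamma> v = inv\<^bsub>GL\<^esub> (minor J (\<sigma> (?q v))) \<otimes>\<^bsub>GL\<^esub> minor J v" for v
  have \<phi>: "\<phi> (S, g) \<in> stiefel" "?q (\<phi> (S, g)) = S" if "S \<in> U" "g \<in> carrier GL" for S g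
    using stiefel_act [OF \<sigma>_stiefel [OF that(1)], of g] that q\<sigma>
    by (simp_all add: \<phi>_def carrier_GL invertible_det_nz)
  have \<gamma>\<phi>: "\<gamma> (\<phi> (S, g)) = g" if S: "S \<in> U" and g: "g \<in> carrier GL" for S g
  proof -
    have "\<gamma> (\<phi> (S, g)) = inv\<^bsub>GL\<^esub> (minor J (\<sigma> S)) \<otimes>\<^bsub>GL\<^esub> (minor J (\<sigma> S) \<otimes>\<^bsub>GL\<^esub> g)"
      unfolding \<gamma>_def \<phi>(2) [OF S g] by (simp add: \<phi>_def minor_act mult_GL)
    then show ?thesis
      using minor_GL [OF S] g by (simp add: m_assoc [symmetric])
  qed
  have ex: "\<exists>g\<in>carrier GL. v = \<phi> (?q v, g)" if v: "v \<in> stiefel" "?q v \<in> U" for v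
  proof -
    obtain g where "invertible g" "v = GL_act (\<sigma> (?q v)) g"
      using stiefel_same_span [OF \<sigma>_stiefel [OF v(2)] v(1) q\<sigma> [OF v(2)]] by blast
    then show ?thesis
      by (auto simp: \<phi>_def carrier_GL invertible_det_nz)
  qed
  have "homeomorphic_maps ?X ?Y \<phi> (\<lambda>v. (?q v, \<gamma> v))"
    unfolding homeomorphic_maps_def
  proof (intro conjI ballI)
    show "continuous_map ?X ?Y \<phi>"
    proof (intro continuous_map_into_subtopology)
      have "continuous_map ?X ?Gr fst"
        using continuous_map_fst continuous_map_in_subtopology by blast
      from continuous_map_compose [OF this c\<sigma>] have "continuous_map ?X euclidean (\<lambda>x. \<sigma> (fst x))"
        by (simp add: o_def)
      moreover have "continuous_map ?X euclidean snd"
        using continuous_map_snd [of "subtopology ?Gr U" GL_topology] continuous_map_into_GL by blast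
      ultimately show "continuous_map ?X euclidean \<phi>"
        unfolding \<phi>_def case_prod_unfold by (rule continuous_map_GL_act)
    qed (use \<phi> X in auto)
    have Y: "v \<in> stiefel \<and> ?q v \<in> U" if "v \<in> topspace ?Y" for v
      using that by auto
    have q: "continuous_map ?Y (subtopology ?Gr U) ?q"
      using Y by (intro continuous_map_into_subtopology continuous_map_from_subtopology continuous_map_span) auto
    have "continuous_map ?Y ?Gr ?q"
      using q continuous_map_in_subtopology by blast
    from continuous_map_compose [OF continuous_map_compose [OF this c\<sigma>] continuous_map_minor]
    have "continuous_map ?Y euclidean (\<lambda>v. minor J (\<sigma> (?q v)))"
      by (simp only: o_def)
    then have "continuous_map ?Y GL_topology (\<lambda>v. minor J (\<sigma> (?q v)))"
      unfolding continuous_map_into_GL using detU Y by blast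
    moreover have "det (minor J v) \<noteq> 0" if v: "v \<in> topspace ?Y" for v
    proof -
      obtain g where g: "g \<in> carrier GL" "v = \<phi> (?q v, g)"
        using ex Y [OF v] by blast
      have "minor J v = minor J (\<sigma> (?q v)) ** g"
        by (subst g(2)) (simp add: \<phi>_def minor_act)
      then show ?thesis
        using detU Y [OF v] g(1) by (simp add: det_mul carrier_GL)
    qed
    then have "continuous_map ?Y GL_topology (minor J)"
      using continuous_map_from_subtopology [OF continuous_map_from_subtopology [OF continuous_map_minor]]
      unfolding continuous_map_into_GL by blast
    ultimately have "continuous_map ?Y GL_topology \<gamma>"
      unfolding \<gamma>_def [abs_def] by (rule continuous_map_GL_mult_inv)
    with q show "continuous_map ?Y ?X (\<lambda>v. (?q v, \<gamma> v))"
      by (rule continuous_map_pairedI)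
    show "(?q (\<phi> x), \<gamma> (\<phi> x)) = x" if "x \<in> topspace ?X" for x
      using X [of "fst x" "snd x"] that \<phi>(2) \<gamma>\<phi> by (metis prod.collapse)
    show "\<phi> (?q v, \<gamma> v) = v" if v: "v \<in> topspace ?Y" for v
    proof -
      obtain g where g: "g \<in> carrier GL" "v = \<phi> (?q v, g)"
        using ex Y [OF v] by blast
      have "\<gamma> v = g"
        by (subst g(2), rule \<gamma>\<phi>) (use Y [OF v] g(1) in auto)
      then show ?thesis
        using g(2) by simp
    qed
  qed
  then have "homeomorphic_map ?X ?Y \<phi>"
    using homeomorphic_map_maps by blast
  from that [OF U b this \<phi>(2)] show thesis
    by (simp add: \<phi>_def GL_act_mult)
qed

lemma principal_bundle_stiefel:
  "principal_bundle GL GL_topology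
     (stiefel_bundle :: ('a::scalar_field ^ 'k ^ 'n, ('a ^ 'k) set, 'a ^ 'n ^ 'n) gbundle)"
  unfolding principal_bundle_def stiefel_bundle_simps
proof (intro conjI ballI)
  show "topological_group GL (GL_topology :: ('a ^ 'n ^ 'n) topology)"
    by (rule topological_group_GL)
  show "continuous_map (top_of_set stiefel) (grassmannian_topology CARD('n))
      (\<lambda>v :: 'a ^ 'k ^ 'n. vec.span (range (($) v)))"
    by (rule continuous_map_span)
  have "continuous_on (stiefel \<times> carrier GL) (\<lambda>x :: ('a ^ 'k ^ 'n) \<times> ('a ^ 'n ^ 'n). GL_act (fst x) (snd x))"
    by (intro continuous_on_GL_act continuous_intros)
  then show "continuous_map (prod_topology (top_of_set stiefel) GL_topology) (top_of_set stiefel)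
      (\<lambda>(v :: 'a ^ 'k ^ 'n, g). GL_act v g)"
    by (auto simp: GL_topology_def prod_topology_subtopology_eu case_prod_unfold carrier_GL
        invertible_det_nz stiefel_act(1))
  fix v :: "'a ^ 'k ^ 'n" assume "v \<in> topspace (top_of_set stiefel)"
  then have v: "v \<in> stiefel"
    by simp
  show "GL_act v \<one>\<^bsub>GL\<^esub> = v"
    by (simp add: one_GL GL_act_one)
  fix g :: "'a ^ 'n ^ 'n" assume g: "g \<in> carrier GL"
  then show "vec.span (range (($) (GL_act v g))) = vec.span (range (($) v))"
    by (intro stiefel_act v) (simp add: carrier_GL invertible_det_nz)
  show "GL_act v (g \<otimes>\<^bsub>GL\<^esub> h) = GL_act (GL_act v g) h" for h
    by (simp add: mult_GL GL_act_mult)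
next
  fix b :: "('a ^ 'k) set" assume "b \<in> topspace (grassmannian_topology CARD('n))"
  then have "b \<in> grassmannian CARD('n)"
    by (simp add: topspace_grassmannian)
  then obtain U and \<phi> :: "('a ^ 'k) set \<times> ('a ^ 'n ^ 'n) \<Rightarrow> 'a ^ 'k ^ 'n"
    where U: "openin (grassmannian_topology CARD('n)) U" "b \<in> U"
    and \<phi>: "homeomorphic_map (prod_topology (subtopology (grassmannian_topology CARD('n)) U) GL_topology)
      (subtopology (top_of_set stiefel) {v \<in> stiefel. vec.span (range (($) v)) \<in> U}) \<phi>"
    and q\<phi>: "\<And>u g. u \<in> U \<Longrightarrow> g \<in> carrier GL \<Longrightarrow> vec.span (range (($) (\<phi> (u, g)))) = u"
    and \<phi>_act: "\<And>u g h. u \<in> U \<Longrightarrow> g \<in> carrier GL \<Longrightarrow> h \<in> carrier GL \<Longrightarrow> \<phi> (u, g ** h) = GL_act (\<phi> (u, g)) h"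
    by (rule stiefel_local_triviality) blast
  show "\<exists>U \<phi>. openin (grassmannian_topology CARD('n)) U \<and> b \<in> U \<and>
      homeomorphic_map (prod_topology (subtopology (grassmannian_topology CARD('n)) U) GL_topology)
        (subtopology (top_of_set stiefel) {e \<in> topspace (top_of_set stiefel). vec.span (range (($) e)) \<in> U}) \<phi> \<and>
      (\<forall>u\<in>U. \<forall>g\<in>carrier GL. vec.span (range (($) (\<phi> (u, g) :: 'a ^ 'k ^ 'n))) = u \<and>
        (\<forall>h\<in>carrier GL. \<phi> (u, g \<otimes>\<^bsub>GL\<^esub> h) = GL_act (\<phi> (u, g)) h))"
    using U \<phi> q\<phi> \<phi>_act by (intro exI [of _ U] exI [of _ \<phi>]) (simp add: mult_GL)
qed

text \<open>The matrix \<open>minor J\<close> itself is the equivariant group coordinate where it is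
  invertible. The action scales the norm of its determinant by the norm of det g, the same factor
  for all J, so dividing by the sum over J yields invariant weights with sum 1.\<close>

lemma stiefel_bundle_classified:
  fixes E :: "('e, 'b, 'a::scalar_field ^ 'n ^ 'n) gbundle"
  assumes E: "universal_principal_bundle GL GL_topology E"
  shows "\<exists>f. classified_by GL (stiefel_bundle :: ('a ^ 'k ^ 'n, ('a ^ 'k) set, 'a ^ 'n ^ 'n) gbundle) E f"
proof -
  let ?P = "stiefel_bundle :: ('a ^ 'k ^ 'n, ('a ^ 'k) set, 'a ^ 'n ^ 'n) gbundle"
  define s :: "'a ^ 'k ^ 'n \<Rightarrow> real" where "s v = (\<Sum>J\<in>UNIV. norm (det (minor J v)))" for v
  define \<mu> where "\<mu> J v = norm (det (minor J v)) / s v" for J and v :: "'a ^ 'k ^ 'n"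
  have s: "0 < s v" if v: "v \<in> stiefel" for v
  proof -
    obtain J where "det (minor J v) \<noteq> 0"
      using stiefel_det_minor [OF v] by blast
    then show ?thesis
      unfolding s_def by (intro sum_pos2 [of _ J]) auto
  qed
  have det_act: "norm (det (minor J (GL_act v g))) = norm (det (minor J v)) * norm (det g)"
    for J and v :: "'a ^ 'k ^ 'n" and g
    by (simp add: minor_act det_mul norm_mult)
  have pos: "0 < \<mu> J v \<longleftrightarrow> det (minor J v) \<noteq> 0" if "v \<in> stiefel" for J v
    using s [OF that] by (simp add: \<mu>_def zero_less_divide_iff)
  \<comment> \<open>The weights sum to 1, so some weight is at least the reciprocal of the number of
    all J; half of that is exceeded strictly.\<close>
  define c :: real where "c = 1 / (2 * CARD('n \<Rightarrow> 'k))"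
  have c: "0 < c"
    by (simp add: c_def)
  have cdet: "continuous_on S (\<lambda>v :: 'a ^ 'k ^ 'n. norm (det (minor J v)))" for J S
    by (intro continuous_on_norm continuous_on_det continuous_on_vec_nth continuous_on_minor continuous_on_id)
  have "\<exists>F. continuous_map (subtopology (total_space ?P) {v. \<exists>J\<in>UNIV. c < \<mu> J v}) (total_space E) F \<and>
     (\<forall>v\<in>topspace (total_space ?P). (\<exists>J\<in>UNIV. c < \<mu> J v) \<longrightarrow>
        (\<forall>g\<in>carrier GL. F (bundle_act ?P v g) = bundle_act E (F v) g))"
  proof (rule equivariant_map_exists [OF principal_bundle_stiefel E, where \<gamma> = minor])
    show "continuous_map (total_space ?P) euclideanreal (\<mu> J)" for J
    proof -
      have "continuous_on stiefel s"
        unfolding s_def [abs_def] by (intro continuous_on_sum cdet)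
      moreover have "\<forall>v\<in>stiefel. s v \<noteq> 0"
        using s by force
      ultimately show ?thesis
        unfolding stiefel_bundle_simps \<mu>_def [abs_def] continuous_map_iff_continuous
        by (intro continuous_on_divide cdet)
    qed
    show "\<mu> J (bundle_act ?P v g) = \<mu> J v" if "g \<in> carrier GL" for J v g
      using that by (simp add: stiefel_bundle_simps \<mu>_def s_def det_act carrier_GL flip: sum_distrib_right)
    show "continuous_map (subtopology (total_space ?P) {v. 0 < \<mu> J v}) GL_topology (minor J)" for J
      unfolding stiefel_bundle_simps continuous_map_into_GL
      using pos by (auto intro!: continuous_map_from_subtopology continuous_map_minor)
    show "minor J (bundle_act ?P v g) = minor J v \<otimes>\<^bsub>GL\<^esub> g" for J v g
      by (simp add: stiefel_bundle_simps minor_act mult_GL)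
  qed (simp_all add: c)
  then obtain F where F: "continuous_map (subtopology (total_space ?P) {v. \<exists>J\<in>UNIV. c < \<mu> J v}) (total_space E) F"
    "\<And>v g. v \<in> topspace (total_space ?P) \<Longrightarrow> (\<exists>J\<in>UNIV. c < \<mu> J v) \<Longrightarrow> g \<in> carrier GL \<Longrightarrow>
        F (bundle_act ?P v g) = bundle_act E (F v) g"
    by blast
  have cover: "\<exists>J\<in>UNIV. c < \<mu> J v" if v: "v \<in> stiefel" for v
  proof (rule ccontr)
    assume "\<not> ?thesis"
    then have "(\<Sum>J\<in>UNIV. \<mu> J v) \<le> (\<Sum>J\<in>(UNIV :: ('n \<Rightarrow> 'k) set). c)"
      by (intro sum_mono) (simp add: not_less)
    also have "\<dots> = 1 / 2"
      by (simp add: c_def)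
    also have "(\<Sum>J\<in>UNIV. \<mu> J v) = 1"
      using s [OF v] by (simp add: \<mu>_def s_def flip: sum_divide_distrib)
    finally show False
      by simp
  qed
  have "subtopology (total_space ?P) {v. \<exists>J\<in>UNIV. c < \<mu> J v} = total_space ?P"
    by (rule subtopology_superset) (use cover in \<open>auto simp: stiefel_bundle_simps\<close>)
  with F(1) have "continuous_map (total_space ?P) (total_space E) F"
    by simp
  moreover have "principal_bundle GL GL_topology E"
    using E by (simp add: universal_principal_bundle_def)
  ultimately show ?thesis
    using F(2) cover by (intro classified_byI [OF principal_bundle_stiefel]) (auto simp: stiefel_bundle_simps)
qed

text \<open>The bound on i is the one for filling the Stiefel space in dimension i + 1; filling in
  dimension i follows from the same bound.\<close>

lemma stiefel_bundle_homotopy_iso: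
  fixes E :: "('e, 'b, 'a::scalar_field ^ 'n ^ 'n) gbundle"
  assumes E: "universal_principal_bundle GL GL_topology E"
    and f: "classified_by GL (stiefel_bundle :: ('a ^ 'k ^ 'n, ('a ^ 'k) set, 'a ^ 'n ^ 'n) gbundle) E f"
    and i: "Suc i < DIM('a) * (CARD('k) + 1 - CARD('n))"
  shows "homotopy_iso i (base_space (stiefel_bundle :: ('a ^ 'k ^ 'n, ('a ^ 'k) set, 'a ^ 'n ^ 'n) gbundle))
    (base_space E) f"
proof -
  let ?P = "stiefel_bundle :: ('a ^ 'k ^ 'n, ('a ^ 'k) set, 'a ^ 'n ^ 'n) gbundle"
  have E': "principal_bundle GL GL_topology E" "contractible_space (total_space E)" "topspace (total_space E) \<noteq> {}"
    using E by (simp_all add: universal_principal_bundle_def)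
  have cf: "continuous_map (base_space ?P) (base_space E) f"
    and iso: "principal_bundle_isomorphic GL ?P (bundle_pullback (base_space ?P) f E)"
    using f by (simp_all add: classified_by_def)
  obtain \<phi> where \<phi>: "homeomorphic_map (top_of_set (stiefel :: ('a ^ 'k ^ 'n) set))
      (subtopology (prod_topology (base_space ?P) (total_space E)) {(x, e). f x = bundle_proj E e}) \<phi>"
    using iso by (auto simp: principal_bundle_isomorphic_def bundle_pullback_def stiefel_bundle_simps)
  show ?thesis
    by (rule homotopy_iso_pullback [OF cf principal_proj [OF E'(1)] \<phi> principal_cube_lift [OF E'(1)]
          cube_fillable_contractible [OF E'(2,3)] cube_fillable_stiefel cube_fillable_stiefel])
      (use i in simp_all)
qed

theorem corollary5p2:
  fixes ER :: "('er, 'br, real ^ 'n ^ 'n) gbundle"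
    and EC :: "('ec, 'bc, complex ^ 'n ^ 'n) gbundle"
    and StR :: "(real ^ 'k ^ 'n, (real ^ 'k) set, real ^ 'n ^ 'n) gbundle"
    and StC :: "(complex ^ 'k ^ 'n, (complex ^ 'k) set, complex ^ 'n ^ 'n) gbundle"
  assumes "CARD('n) \<le> CARD('k)"
    and "StR = stiefel_bundle"
    and "StC = stiefel_bundle"
  shows
    "(principal_bundle GL GL_topology StR \<and>
      (universal_principal_bundle GL GL_topology ER \<longrightarrow>
        (\<exists>f. classified_by GL StR ER f) \<and>
        (\<forall>f. classified_by GL StR ER f \<longrightarrow>
          (\<forall>i. int i \<le> int CARD('k) - int CARD('n) - 1 \<longrightarrow>
            homotopy_iso i (base_space StR) (base_space ER) f)))) \<and>
     (principal_bundle GL GL_topology StC \<and>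
      (universal_principal_bundle GL GL_topology EC \<longrightarrow>
        (\<exists>f. classified_by GL StC EC f) \<and>
        (\<forall>f. classified_by GL StC EC f \<longrightarrow>
          (\<forall>i. int i \<le> 2 * (int CARD('k) - int CARD('n)) \<longrightarrow>
            homotopy_iso i (base_space StC) (base_space EC) f))))"
proof -
  \<comment> \<open>For d = 1 and d = 2 the bounds are i + 1 < k - n + 1 and i + 1 < 2 (k - n) + 2.
    The integers in the statement make the real range empty for k = n.\<close>
  have "Suc i < DIM(real) * (CARD('k) + 1 - CARD('n))" if "int i \<le> int CARD('k) - int CARD('n) - 1" for i
    using that assms(1) by simp
  moreover have "Suc i < DIM(complex) * (CARD('k) + 1 - CARD('n))" if "int i \<le> 2 * (int CARD('k) - int CARD('n))" for i
    using that assms(1) by simp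
  ultimately show ?thesis
    unfolding assms(2,3)
    by (intro conjI impI allI principal_bundle_stiefel stiefel_bundle_classified stiefel_bundle_homotopy_iso)
qed

end
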